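(* Let $G=(V,E)$ be a graph. The polytope $$P_G := \mathrm{conv}(\{\mu\in \mathbb{Z}^V_{\geq 0} \mid \mu \text{ is a feasible split vector for } G\})$$ is a polymatroid, and its integral points are exactly the feasible split vectors of $G$. Furthermore, one can optimize linear functions over $P_G$ in polynomial time, and for any feasible split vector $\mu\in \mathbb{Z}^V_{\geq 0}$ one can find in polynomial time a connected graph $H=(W,F)$ and an onto function $\phi:W\rightarrow V$ such that $G$ is the homomorphic image of $H$ by $\phi$ and $|\phi^{-1}(v)| = \mu(v)+1$ for all $v\in V$.
   Context: All graphs are undirected, connected, may have loops and parallel edges, and have at least $2$ vertices. A graph $G=(V,E)$ is the homomorphic image of a graph $H=(W,F)$ by an onto function $\phi:W\rightarrow V$ if for any two vertices $u,v\in V$ (possibly $u=v$), the number of edges of $G$ between $u$ and $v$ equals the number of edges of $H$ whose endpoints are mapped by $\phi$ to $\{u,v\}$. A vector $\lambda\in\mathbb{Z}^V_{>0}$ is a feasible multiplicity vector for $G$ if there is a connected graph $H=(W,F)$ and an onto function $\phi:W\rightarrow V$ such that $G$ is the homomorphic image of $H$ by $\phi$ and $|\phi^{-1}(v)|=\lambda(v)$ for all $v\in V$. A vector $\mu\in\mathbb{Z}^V_{\geq 0}$ is a feasible split vector if $\mu+\mathbf{1}$ is a feasible multiplicity vector, where $\mathbf{1}$ is the all-ones vector. A polymatroid over a finite set $N$ is a polytope of the form $\{x\in\mathbb{R}^N_{\geq 0}\mid x(S)\leq f(S)\ \forall S\subseteq N\}$ for a submodular function $f:2^N\to\mathbb{Z}_{\geq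 0}$. *)

theory Defs
  imports
    "HOL-Analysis.Analysis"
    "HOL-Analysis.Finite_Function_Topology"
    "HOL-Library.Multiset"
    "HOL-Library.Uprod"
    "HOL-Library.Poly_Mapping"
    "HOL-Computational_Algebra.Polynomial"
begin

section \<open>Graphs and homomorphic images\<close>

text \<open>A loop at \<open>v\<close> is the unordered pair \<open>Upair v v\<close>; parallel edges are
  multiplicities in the multiset.\<close>

record 'v mgraph =
  verts :: "'v set"
  edges :: "'v uprod multiset"

definition adj_rel :: "'v mgraph \<Rightarrow> ('v \<times> 'v) set" where
  "adj_rel G = {(u, v). Upair u v \<in># edges G}"

definition connected_graph :: "'v mgraph \<Rightarrow> bool" where
  "connected_graph G \<longleftrightarrow> (\<forall>u\<in>verts G. \<forall>v\<in>verts G. (u, v) \<in> (adj_rel G)\<^sup>*)"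

text \<open>Every graph is finite, connected, and has at least two vertices.\<close>

definition graph :: "'v mgraph \<Rightarrow> bool" where
  "graph G \<longleftrightarrow> finite (verts G) \<and> 2 \<le> card (verts G) \<and>
     (\<forall>e\<in>#edges G. set_uprod e \<subseteq> verts G) \<and> connected_graph G"

definition homomorphic_image :: "'v mgraph \<Rightarrow> 'w mgraph \<Rightarrow> ('w \<Rightarrow> 'v) \<Rightarrow> bool" where
  "homomorphic_image G H \<phi> \<longleftrightarrow> \<phi> ` verts H = verts G \<and>
     (\<forall>u\<in>verts G. \<forall>v\<in>verts G.
        count (edges G) (Upair u v) = size {#e \<in># edges H. \<phi> ` set_uprod e = {u, v}#})"

text \<open>A vector in \<open>\<int>\<^sup>V\<close> with nonnegative entries is a function of which only the values on
  \<open>verts G\<close> matter. As \<open>H\<close> is finite, its vertices may be taken to be natural numbers.\<close>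

definition feasible_multiplicity :: "'v mgraph \<Rightarrow> ('v \<Rightarrow> nat) \<Rightarrow> bool" where
  "feasible_multiplicity G l \<longleftrightarrow> (\<forall>v\<in>verts G. 0 < l v) \<and>
     (\<exists>(H :: nat mgraph) \<phi>. graph H \<and> homomorphic_image G H \<phi> \<and>
        (\<forall>v\<in>verts G. card {w \<in> verts H. \<phi> w = v} = l v))"

definition feasible_split :: "'v mgraph \<Rightarrow> ('v \<Rightarrow> nat) \<Rightarrow> bool" where
  "feasible_split G \<mu> \<longleftrightarrow> feasible_multiplicity G (\<lambda>v. \<mu> v + 1)"


section \<open>The polytope and polymatroids\<close>

text \<open>For a finite set \<open>N\<close>, the space \<open>\<real>\<^sup>N\<close> is rendered as the finitely supported functions
  whose support is contained in \<open>N\<close>. This is a real vector space in which the dimension can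
  vary with \<open>N\<close>.\<close>

definition split_vectors :: "'v mgraph \<Rightarrow> ('v \<Rightarrow>\<^sub>0 real) set" where
  "split_vectors G = {x. Poly_Mapping.keys x \<subseteq> verts G \<and>
     (\<exists>\<mu>. feasible_split G \<mu> \<and> (\<forall>v\<in>verts G. Poly_Mapping.lookup x v = real (\<mu> v)))}"

definition split_polytope :: "'v mgraph \<Rightarrow> ('v \<Rightarrow>\<^sub>0 real) set" where
  "split_polytope G = convex hull (split_vectors G)"

definition submodular :: "'v set \<Rightarrow> ('v set \<Rightarrow> nat) \<Rightarrow> bool" where
  "submodular N f \<longleftrightarrow> (\<forall>S T. S \<subseteq> N \<longrightarrow> T \<subseteq> N \<longrightarrow> f (S \<union> T) + f (S \<inter> T) \<le> f S + f T)"

definition polymatroid :: "'v set \<Rightarrow> ('v \<Rightarrow>\<^sub>0 real) set \<Rightarrow> bool" where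
  "polymatroid N P \<longleftrightarrow> finite N \<and> polytope P \<and>
     (\<exists>f. submodular N f \<and>
        P = {x. Poly_Mapping.keys x \<subseteq> N \<and> (\<forall>v\<in>N. 0 \<le> Poly_Mapping.lookup x v) \<and>
               (\<forall>S. S \<subseteq> N \<longrightarrow> (\<Sum>v\<in>S. Poly_Mapping.lookup x v) \<le> real (f S))})"

definition integral_points :: "('v \<Rightarrow>\<^sub>0 real) set \<Rightarrow> ('v \<Rightarrow>\<^sub>0 real) set" where
  "integral_points P = {x \<in> P. \<forall>v. Poly_Mapping.lookup x v \<in> \<int>}"


section \<open>Polynomial time\<close>

text \<open>The machine model is a first-order, call-by-value, LISP-like language over binary trees.
  A program is a finite list of function bodies; the variables of a body are de Bruijn indices
  into an environment that initially holds the arguments. Every evaluation step costs one plus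
  the size of the tree it returns, so a computation of cost \<open>t\<close> only handles trees of size at most
  \<open>t\<close>, and the model is equivalent to Turing machines up to a polynomial.\<close>

datatype tree = Leaf | Node tree tree

primrec left :: "tree \<Rightarrow> tree" where
  "left Leaf = Leaf"
| "left (Node a b) = a"

primrec right :: "tree \<Rightarrow> tree" where
  "right Leaf = Leaf"
| "right (Node a b) = b"

datatype expr =
    Var nat
  | LeafE
  | NodeE expr expr
  | LeftE expr
  | RightE expr
  | IfNode expr expr expr
  | LetE expr expr
  | Call nat "expr list"

type_synonym program = "expr list"

text \<open>\<open>evaluates P env e v t\<close>: in program \<open>P\<close> and environment \<open>env\<close>, the expression \<open>e\<close> has value \<open>v\<close>,
  at cost \<open>t\<close>.\<close>

inductive
  evaluates :: "program \<Rightarrow> tree list \<Rightarrow> expr \<Rightarrow> tree \<Rightarrow> nat \<Rightarrow> bool" and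
  evaluates_list :: "program \<Rightarrow> tree list \<Rightarrow> expr list \<Rightarrow> tree list \<Rightarrow> nat \<Rightarrow> bool"
  for P :: program
where
  evaluates_Var: "i < length env \<Longrightarrow> evaluates P env (Var i) (env ! i) (1 + size (env ! i))"
| evaluates_Leaf: "evaluates P env LeafE Leaf (1 + size Leaf)"
| evaluates_Node: "evaluates P env a u s \<Longrightarrow> evaluates P env b v t \<Longrightarrow>
    evaluates P env (NodeE a b) (Node u v) (s + t + 1 + size (Node u v))"
| evaluates_Left: "evaluates P env a u s \<Longrightarrow> evaluates P env (LeftE a) (left u) (s + 1 + size (left u))"
| evaluates_Right: "evaluates P env a u s \<Longrightarrow> evaluates P env (RightE a) (right u) (s + 1 + size (right u))"
| evaluates_If_Node: "evaluates P env a u s \<Longrightarrow> u \<noteq> Leaf \<Longrightarrow> evaluates P env b v t \<Longrightarrow>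
    evaluates P env (IfNode a b c) v (s + t + 1 + size v)"
| evaluates_If_Leaf: "evaluates P env a Leaf s \<Longrightarrow> evaluates P env c v t \<Longrightarrow>
    evaluates P env (IfNode a b c) v (s + t + 1 + size v)"
| evaluates_Let: "evaluates P env a u s \<Longrightarrow> evaluates P (u # env) b v t \<Longrightarrow>
    evaluates P env (LetE a b) v (s + t + 1 + size v)"
| evaluates_Call: "f < length P \<Longrightarrow> evaluates_list P env as us s \<Longrightarrow> evaluates P us (P ! f) v t \<Longrightarrow>
    evaluates P env (Call f as) v (s + t + 1 + size v)"
| evaluates_list_Nil: "evaluates_list P env [] [] 0"
| evaluates_list_Cons: "evaluates P env a u s \<Longrightarrow> evaluates_list P env as us t \<Longrightarrow> evaluates_list P env (a # as) (u # us) (s + t)"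

lemma evaluates_size: "evaluates P env e v t \<Longrightarrow> size v < t"
  and evaluates_list_size: "evaluates_list P env es vs t \<Longrightarrow> True"
  by (induction rule: evaluates_evaluates_list.inducts) auto

inductive_cases evaluates_elims:
  "evaluates P env (Var i) v t"
  "evaluates P env LeafE v t"
  "evaluates P env (NodeE a b) v t"
  "evaluates P env (LeftE a) v t"
  "evaluates P env (RightE a) v t"
  "evaluates P env (IfNode a b c) v t"
  "evaluates P env (LetE a b) v t"
  "evaluates P env (Call f as) v t"

inductive_cases evaluates_list_elims:
  "evaluates_list P env [] vs t"
  "evaluates_list P env (a # as) vs t"

lemma evaluates_deterministic:
    "evaluates P env e v t \<Longrightarrow> evaluates P env e v' t' \<Longrightarrow> v' = v \<and> t' = t"
  and evaluates_list_deterministic: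
    "evaluates_list P env es vs t \<Longrightarrow> evaluates_list P env es vs' t' \<Longrightarrow> vs' = vs \<and> t' = t"
proof (induction arbitrary: v' t' and vs' t' rule: evaluates_evaluates_list.inducts)
  case evaluates_Var
  from evaluates_Var.prems show ?case
    by (elim evaluates_elims(1)) simp_all
next
  case evaluates_Leaf
  from evaluates_Leaf.prems show ?case
    by (elim evaluates_elims(2)) simp_all
next
  case evaluates_Node
  from evaluates_Node.prems show ?case
    by (elim evaluates_elims(3)) (auto dest!: evaluates_Node.IH(2,4))
next
  case evaluates_Left
  from evaluates_Left.prems show ?case
    by (elim evaluates_elims(4)) (auto dest!: evaluates_Left.IH(2))
next
  case evaluates_Right
  from evaluates_Right.prems show ?case
    by (elim evaluates_elims(5)) (auto dest!: evaluates_Right.IH(2))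
next
  case evaluates_If_Node
  from evaluates_If_Node.prems show ?case
    by (elim evaluates_elims(6)) (auto dest!: evaluates_If_Node.IH(2,4) simp: evaluates_If_Node.hyps)
next
  case evaluates_If_Leaf
  from evaluates_If_Leaf.prems show ?case
    by (elim evaluates_elims(6)) (auto dest!: evaluates_If_Leaf.IH(2,4))
next
  case evaluates_Let
  from evaluates_Let.prems show ?case
    by (elim evaluates_elims(7)) (auto dest!: evaluates_Let.IH(2,4))
next
  case evaluates_Call
  from evaluates_Call.prems show ?case
    by (elim evaluates_elims(8)) (auto dest!: evaluates_Call.IH(3,5))
next
  case evaluates_list_Nil
  from evaluates_list_Nil.prems show ?case
    by (elim evaluates_list_elims(1)) simp_all
next
  case evaluates_list_Cons
  from evaluates_list_Cons.prems show ?case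
    by (elim evaluates_list_elims(2)) (auto dest!: evaluates_list_Cons.IH(2,4))
qed

text \<open>A problem is a set \<open>I\<close> of admissible inputs and a relation \<open>R\<close> between inputs and correct
  outputs. The running time is bounded by a polynomial in the size of the encoded input.\<close>

definition polytime_solvable ::
  "('i \<Rightarrow> tree) \<Rightarrow> ('o \<Rightarrow> tree) \<Rightarrow> 'i set \<Rightarrow> ('i \<Rightarrow> 'o \<Rightarrow> bool) \<Rightarrow> bool" where
  "polytime_solvable enc_in enc_out I R \<longleftrightarrow>
     (\<exists>(P :: program) (e :: expr) (p :: nat poly). \<forall>i\<in>I. \<exists>y t.
        evaluates P [enc_in i] e (enc_out y) t \<and> t \<le> poly p (size (enc_in i)) \<and> R i y)"


section \<open>Encodings\<close>

text \<open>Numbers are encoded in binary, least significant bit first.\<close>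

definition enc_bool :: "bool \<Rightarrow> tree" where
  "enc_bool b = (if b then Node Leaf Leaf else Leaf)"

fun enc_nat :: "nat \<Rightarrow> tree" where
  "enc_nat n = (if n = 0 then Leaf else Node (enc_bool (odd n)) (enc_nat (n div 2)))"

declare enc_nat.simps [simp del]

definition enc_int :: "int \<Rightarrow> tree" where
  "enc_int k = Node (enc_bool (k < 0)) (enc_nat (nat \<bar>k\<bar>))"

definition enc_rat :: "rat \<Rightarrow> tree" where
  "enc_rat r = (case quotient_of r of (a, b) \<Rightarrow> Node (enc_int a) (enc_int b))"

definition enc_pair :: "('a \<Rightarrow> tree) \<Rightarrow> ('b \<Rightarrow> tree) \<Rightarrow> 'a \<times> 'b \<Rightarrow> tree" where
  "enc_pair f g = (\<lambda>(x, y). Node (f x) (g y))"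

primrec enc_list :: "('a \<Rightarrow> tree) \<Rightarrow> 'a list \<Rightarrow> tree" where
  "enc_list f [] = Leaf"
| "enc_list f (x # xs) = Node (f x) (enc_list f xs)"

text \<open>A concrete graph is a number \<open>n\<close> of vertices and a list of edges between the vertices
  \<open>0, \<dots>, n - 1\<close>, in which a parallel edge is repeated.\<close>

type_synonym graph_code = "nat \<times> (nat \<times> nat) list"

definition graph_of :: "graph_code \<Rightarrow> nat mgraph" where
  "graph_of = (\<lambda>(n, es). \<lparr>verts = {..<n}, edges = mset (map (\<lambda>(u, v). Upair u v) es)\<rparr>)"

definition enc_graph :: "graph_code \<Rightarrow> tree" where
  "enc_graph = enc_pair enc_nat (enc_list (enc_pair enc_nat enc_nat))"


lemma inj_enc_nat: "inj enc_nat"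
proof -
  have "enc_nat m = enc_nat n \<Longrightarrow> m = n" for m n
  proof (induction m arbitrary: n rule: less_induct)
    case (less m)
    show ?case
    proof (cases "m = 0 \<or> n = 0")
      case True
      with less.prems show ?thesis
        by (auto simp: enc_nat.simps[of m] enc_nat.simps[of n] split: if_splits)
    next
      case False
      with less.prems have "odd m = odd n" "enc_nat (m div 2) = enc_nat (n div 2)"
        by (auto simp: enc_nat.simps[of m] enc_nat.simps[of n] enc_bool_def split: if_splits)
      moreover from this less.IH[of "m div 2" "n div 2"] False have "m div 2 = n div 2"
        by simp
      ultimately show ?thesis
        by presburger
    qed
  qed
  then show ?thesis by (rule injI)
qed

lemma inj_enc_int: "inj enc_int"
proof (rule injI)
  fix k l assume "enc_int k = enc_int l"
  then have "(k < 0) = (l < 0)" "nat \<bar>k\<bar> = nat \<bar>l\<bar>"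
    using injD[OF inj_enc_nat] by (auto simp: enc_int_def enc_bool_def split: if_splits)
  then show "k = l" by linarith
qed

lemma inj_enc_rat: "inj enc_rat"
proof (rule injI)
  fix r s assume "enc_rat r = enc_rat s"
  then have "quotient_of r = quotient_of s"
    using injD[OF inj_enc_int] by (auto simp: enc_rat_def split: prod.splits)
  then show "r = s" by (simp add: quotient_of_inject)
qed

lemma inj_enc_pair: "inj f \<Longrightarrow> inj g \<Longrightarrow> inj (enc_pair f g)"
  by (auto simp: enc_pair_def inj_def)

lemma inj_enc_list:
  assumes "inj f"
  shows "inj (enc_list f)"
proof (rule injI)
  fix xs ys assume "enc_list f xs = enc_list f ys"
  then show "xs = ys"
  proof (induction xs arbitrary: ys)
    case Nil
    then show ?case by (cases ys) auto
  next
    case (Cons x xs)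
    then show ?case using injD[OF assms] by (cases ys) auto
  qed
qed

lemma inj_enc_graph: "inj enc_graph"
  unfolding enc_graph_def by (intro inj_enc_pair inj_enc_list inj_enc_nat)


section \<open>The two algorithmic problems\<close>

text \<open>Maximise \<open>c\<close> over the polytope, for a rational objective \<open>c\<close> of arbitrary sign
  (so that minimisation is covered as well).\<close>

definition optimization_inputs :: "(graph_code \<times> rat list) set" where
  "optimization_inputs = {(g, c). graph (graph_of g) \<and> length c = fst g}"

definition optimization_solution :: "graph_code \<times> rat list \<Rightarrow> rat list \<Rightarrow> bool" where
  "optimization_solution = (\<lambda>(g, c) xs.
     let obj = (\<lambda>y. \<Sum>v<fst g. real_of_rat (c ! v) * Poly_Mapping.lookup y v)
     in length xs = fst g \<and>
        (\<exists>x\<in>split_polytope (graph_of g).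
           (\<forall>v<fst g. Poly_Mapping.lookup x v = real_of_rat (xs ! v)) \<and>
           (\<forall>y\<in>split_polytope (graph_of g). obj y \<le> obj x)))"

definition splitting_inputs :: "(graph_code \<times> nat list) set" where
  "splitting_inputs = {(g, \<mu>). graph (graph_of g) \<and> length \<mu> = fst g \<and>
     feasible_split (graph_of g) ((!) \<mu>)}"

definition splitting_solution :: "graph_code \<times> nat list \<Rightarrow> graph_code \<times> nat list \<Rightarrow> bool" where
  "splitting_solution = (\<lambda>(g, \<mu>) (h, \<phi>).
     graph (graph_of h) \<and> length \<phi> = fst h \<and>
     homomorphic_image (graph_of g) (graph_of h) ((!) \<phi>) \<and>
     (\<forall>v<fst g. card {w \<in> verts (graph_of h). \<phi> ! w = v} = \<mu> ! v + 1))"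

end

theory Submission
  imports Defs
begin

text \<open>
  Rooting the connected graph \<open>H\<close> shows that feasible split vectors arise from a spanning tree of \<open>G\<close>
  by assigning some of the remaining edges to one of their ends, each such edge creating a leaf copy.
  By Rado's theorem applied to the dual of the graphic matroid, they are then the integral points of the
  polymatroid of \<open>f(S) = |E\<^sub>S| + 1 - |S| - c(G - S)\<close>, where \<open>E\<^sub>S\<close> is the set of edges touching \<open>S\<close> and
  \<open>c\<close> counts components.

  The matroid theory is replaced by an augmentation on orientations of \<open>G\<close>: if every vertex is
  reachable from a root \<open>r\<close>, then the numbers (in-degree minus one, with one more at \<open>r\<close>) form
  a point of the base face of the polymatroid. Reversing a path from \<open>u\<close> to \<open>w\<close> moves one unit from
  \<open>w\<close> to \<open>u\<close>, and uncrossing tight sets shows that as long as a vector satisfying the bounds is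
  not dominated, some such reversal keeps the orientation rooted. This yields the
  splitting algorithm, a membership test, and with it the greedy algorithm. That the polymatroid is the hull
  of its integral points follows by moving a fractional point along a direction \<open>e\<^sub>v\<close> or
  \<open>e\<^sub>u - e\<^sub>v\<close> that preserves all tight sets.
\<close>

section \<open>Polynomial-time functions\<close>

text \<open>The bound f is a minimum over exponentially many sets and is never evaluated by an
  algorithm: membership is decided by running the augmentation and checking whether its target was
  met. Orientations suit this because a search from \<open>r\<close> uses up one entering edge per
  vertex, the virtual edge serving \<open>r\<close>, while every other edge into v can be rehung to
  a fresh copy of v without disconnecting anything. Load above \<mu>(v) is thus room for \<mu>(v)
  splits. Necessity of the bounds is a direct count in \<open>H\<close>: the preimage of S touches
  as many edges of \<open>H\<close> as S does in \<open>G\<close>, and its removal leaves at least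
  as many components. The machine model shapes the programs. Running times are proved for all
  inputs, even codes of no graph, so every loop is a fold over an existing list. Often this is the
  edge list, used only as a clock: a search round that is not the last consumes an edge, and the
  rounds of augmentation and of saturation are limited by f(V), which is at most |E|. A polynomial
  step does not by itself make a polynomial loop; hence the size bounds that accompany the
  folds.\<close>

definition poly_bounded :: "(nat \<Rightarrow> nat) \<Rightarrow> bool" where
  "poly_bounded h \<longleftrightarrow> (\<exists>k. \<forall>n. h n \<le> (n + 2) ^ k)"

text \<open>The base n + 2 is at least 2 even for n = 0, so a constant c is absorbed by the exponent
  c.\<close>

lemma poly_bounded_const: "poly_bounded (\<lambda>n. c)"
proof -
  have "c \<le> (n + 2) ^ c" for n :: nat
    using less_exp[of c] power_mono[of 2 "n + 2" c] by simp
  then show ?thesis unfolding poly_bounded_def by blast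
qed

lemma poly_bounded_id: "poly_bounded (\<lambda>n. n)"
  unfolding poly_bounded_def by (rule exI[of _ 1]) simp

lemma poly_bounded_mult:
  assumes "poly_bounded f" "poly_bounded g"
  shows "poly_bounded (\<lambda>n. f n * g n)"
proof -
  obtain i j where "\<forall>n. f n \<le> (n + 2) ^ i" "\<forall>n. g n \<le> (n + 2) ^ j"
    using assms unfolding poly_bounded_def by blast
  then have "\<forall>n. f n * g n \<le> (n + 2) ^ (i + j)"
    by (simp add: power_add mult_mono)
  then show ?thesis unfolding poly_bounded_def by blast
qed

lemma poly_bounded_add:
  assumes "poly_bounded f" "poly_bounded g"
  shows "poly_bounded (\<lambda>n. f n + g n)"
proof -
  obtain i j where ij: "\<forall>n. f n \<le> (n + 2) ^ i" "\<forall>n. g n \<le> (n + 2) ^ j"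
    using assms unfolding poly_bounded_def by blast
  have "f n + g n \<le> (n + 2) ^ (max i j + 1)" for n
  proof -
    have "f n \<le> (n + 2) ^ max i j" "g n \<le> (n + 2) ^ max i j"
      using ij by (meson le_trans max.cobounded1 max.cobounded2 power_increasing le_add2 one_le_numeral)+
    then have "f n + g n \<le> 2 * (n + 2) ^ max i j" by simp
    also have "\<dots> \<le> (n + 2) * (n + 2) ^ max i j" by (intro mult_right_mono) auto
    finally show ?thesis by simp
  qed
  then show ?thesis unfolding poly_bounded_def by blast
qed

lemma poly_bounded_power: "poly_bounded f \<Longrightarrow> poly_bounded (\<lambda>n. f n ^ k)"
  by (induction k) (auto intro: poly_bounded_const poly_bounded_mult)

lemma poly_bounded_Suc: "poly_bounded f \<Longrightarrow> poly_bounded (\<lambda>n. Suc (f n))"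
  using poly_bounded_add[of f "\<lambda>_. 1"] poly_bounded_const by auto

lemmas poly_bounded_intros =
  poly_bounded_const poly_bounded_id poly_bounded_mult poly_bounded_add poly_bounded_power
  poly_bounded_Suc

text \<open>Calls refer to absolute positions in the program, so code placed behind \<open>k\<close>
  other functions has to be relocated. This is the linker for all compositions below.\<close>

primrec shift_calls :: "nat \<Rightarrow> expr \<Rightarrow> expr" where
  "shift_calls k (Var i) = Var i"
| "shift_calls k LeafE = LeafE"
| "shift_calls k (NodeE a b) = NodeE (shift_calls k a) (shift_calls k b)"
| "shift_calls k (LeftE a) = LeftE (shift_calls k a)"
| "shift_calls k (RightE a) = RightE (shift_calls k a)"
| "shift_calls k (IfNode a b c) = IfNode (shift_calls k a) (shift_calls k b) (shift_calls k c)"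
| "shift_calls k (LetE a b) = LetE (shift_calls k a) (shift_calls k b)"
| "shift_calls k (Call f es) = Call (f + k) (map (shift_calls k) es)"

lemma evaluates_shift:
  shows "evaluates P env e v t \<Longrightarrow>
      evaluates (Q @ map (shift_calls (length Q)) P) env (shift_calls (length Q) e) v t"
    and "evaluates_list P env es vs t \<Longrightarrow>
      evaluates_list (Q @ map (shift_calls (length Q)) P) env (map (shift_calls (length Q)) es) vs t"
proof (induction rule: evaluates_evaluates_list.inducts)
  case (evaluates_Call f as env us s v t)
  have "(Q @ map (shift_calls (length Q)) P) ! (f + length Q) = shift_calls (length Q) (P ! f)"
    using evaluates_Call(1) by (simp add: nth_append)
  then have "evaluates (Q @ map (shift_calls (length Q)) P) us
      ((Q @ map (shift_calls (length Q)) P) ! (f + length Q)) v t"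
    using evaluates_Call by (simp only:)
  moreover have "f + length Q < length (Q @ map (shift_calls (length Q)) P)"
    using evaluates_Call(1) by simp
  ultimately show ?case
    unfolding shift_calls.simps using evaluates_Call by (blast intro: evaluates_evaluates_list.intros)
qed (unfold shift_calls.simps list.map, (blast intro: evaluates_evaluates_list.intros)+)

lemma evaluates_program_append:
  shows "evaluates P env e v t \<Longrightarrow> evaluates (P @ Q) env e v t"
    and "evaluates_list P env es vs t \<Longrightarrow> evaluates_list (P @ Q) env es vs t"
proof (induction rule: evaluates_evaluates_list.inducts)
  case (evaluates_Call f as env us s v t)
  have "(P @ Q) ! f = P ! f"
    using evaluates_Call(1) by (simp add: nth_append)
  then have "evaluates (P @ Q) us ((P @ Q) ! f) v t"
    using evaluates_Call by (simp only:)
  moreover have "f < length (P @ Q)"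
    using evaluates_Call(1) by simp
  ultimately show ?case
    using evaluates_Call by (blast intro: evaluates_evaluates_list.intros)
qed (blast intro: evaluates_evaluates_list.intros)+

text \<open>De Bruijn indices count from the front, so code compiled for one argument still runs
  when a \<open>LetE\<close> has pushed that argument in front of older values.\<close>

lemma evaluates_env_append:
  shows "evaluates P env e v t \<Longrightarrow> evaluates P (env @ env') e v t"
    and "evaluates_list P env es vs t \<Longrightarrow> evaluates_list P (env @ env') es vs t"
proof (induction rule: evaluates_evaluates_list.inducts)
  case (evaluates_Var i env)
  have "(env @ env') ! i = env ! i"
    using evaluates_Var by (simp add: nth_append)
  with evaluates_Var show ?case
    using evaluates_evaluates_list.evaluates_Var[of i "env @ env'" P] by simp
next
  case (evaluates_Let env a u s b v t)
  then show ?case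
    using evaluates_evaluates_list.evaluates_Let by fastforce
qed (blast intro: evaluates_evaluates_list.intros)+

text \<open>The bound depends on the size of the encoded input only, and the function is total, so that
  no domains have to be tracked.\<close>

definition runs :: "program \<Rightarrow> expr \<Rightarrow> ('a \<Rightarrow> tree) \<Rightarrow> ('b \<Rightarrow> tree) \<Rightarrow> ('a \<Rightarrow> 'b) \<Rightarrow> nat \<Rightarrow> bool" where
  "runs P e ea eb f k \<longleftrightarrow>
     (\<forall>a. \<exists>t \<le> (size (ea a) + 2) ^ k. evaluates P [ea a] e (eb (f a)) t)"

definition polytime :: "('a \<Rightarrow> tree) \<Rightarrow> ('b \<Rightarrow> tree) \<Rightarrow> ('a \<Rightarrow> 'b) \<Rightarrow> bool" where
  "polytime ea eb f \<longleftrightarrow> (\<exists>P e k. runs P e ea eb f k)"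

lemma polytimeI:
  assumes "poly_bounded h"
    and "\<And>a. \<exists>t \<le> h (size (ea a)). evaluates P [ea a] e (eb (f a)) t"
  shows "polytime ea eb f"
proof -
  obtain k where "h n \<le> (n + 2) ^ k" for n
    using assms(1) unfolding poly_bounded_def by blast
  then have "runs P e ea eb f k"
    unfolding runs_def using assms(2) le_trans by blast
  then show ?thesis unfolding polytime_def by blast
qed

lemma runs_append: "runs P e ea eb f k \<Longrightarrow> runs (P @ Q) e ea eb f k"
  unfolding runs_def using evaluates_program_append(1) by blast

text \<open>Relocated behind a given \<open>P\<close>, the new code leaves the functions of
  \<open>P\<close> in place, so \<open>runs_append\<close> keeps the earlier components valid in the
  common program.\<close>

lemma polytime_extend:
  assumes "polytime ea eb f"
  obtains Q e k where "runs (P @ Q) e ea eb f k"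
proof -
  obtain P' e k where *: "runs P' e ea eb f k"
    using assms unfolding polytime_def by blast
  have "runs (P @ map (shift_calls (length P)) P') (shift_calls (length P) e) ea eb f k"
    using * evaluates_shift(1)[of P'] unfolding runs_def by blast
  then show thesis using that by blast
qed

lemma runsE:
  assumes "runs P e ea eb f k"
  obtains t where "evaluates P (ea a # env) e (eb (f a)) t" "t \<le> (size (ea a) + 2) ^ k"
proof -
  obtain t where "t \<le> (size (ea a) + 2) ^ k" "evaluates P [ea a] e (eb (f a)) t"
    using assms unfolding runs_def by blast
  then show thesis
    using that evaluates_env_append(1)[of P "[ea a]" e "eb (f a)" t env] by simp
qed

text \<open>The cost of an evaluation exceeds the size of its result, so a time bound is also an
  output bound. It supplies the size of the entries in \<open>polytime_map\<close>.\<close>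

lemma polytime_size:
  assumes "polytime ea eb f"
  obtains k where "\<And>a. size (eb (f a)) \<le> (size (ea a) + 2) ^ k"
proof -
  obtain P e k where r: "runs P e ea eb f k"
    using assms unfolding polytime_def by blast
  have "size (eb (f a)) \<le> (size (ea a) + 2) ^ k" for a
  proof -
    obtain t where "evaluates P (ea a # []) e (eb (f a)) t" "t \<le> (size (ea a) + 2) ^ k"
      using r by (rule runsE)
    then show ?thesis using evaluates_size by fastforce
  qed
  then show thesis using that by blast
qed

text \<open>Only the encoded output matters. An intermediate function may therefore return bare
  trees under the identity encoding and be replaced afterwards by the function on numbers that has
  the same code.\<close>

lemma polytime_cong: "polytime ea eb f \<Longrightarrow> (\<And>a. eb (f a) = eb' (g a)) \<Longrightarrow> polytime ea eb' g"
  unfolding polytime_def runs_def by simp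

lemma bounded_exI: "Q t \<Longrightarrow> t \<le> h \<Longrightarrow> \<exists>t\<le>h::nat. Q t"
  by blast

section \<open>Closure properties of polynomial-time functions\<close>

lemma polytime_id: "polytime ea ea (\<lambda>a. a)"
proof (rule polytimeI[of "\<lambda>n. n + 1" _ "[]" "Var 0"])
  show "poly_bounded (\<lambda>n. n + 1)" by (intro poly_bounded_intros)
  show "\<exists>t\<le>size (ea a) + 1. evaluates [] [ea a] (Var 0) (ea a) t" for a
    using evaluates_Var[of 0 "[ea a]" "[]"] by (intro exI[of _ "1 + size (ea a)"]) auto
qed

lemma polytime_const: "polytime ea eb (\<lambda>a. c)"
proof -
  have "\<exists>e t. \<forall>env. evaluates [] env e u t" for u
  proof (induction u)
    case Leaf
    show ?case using evaluates_Leaf by blast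
  next
    case (Node u v)
    then show ?case using evaluates_Node by metis
  qed
  then obtain e t where "\<forall>env. evaluates [] env e (eb c) t" by blast
  then show ?thesis
    by (intro polytimeI[of "\<lambda>n. t" _ "[]" e] poly_bounded_intros) auto
qed

lemma polytime_comp:
  assumes "polytime eb ec g" "polytime ea eb f"
  shows "polytime ea ec (\<lambda>a. g (f a))"
proof -
  obtain P e k where f: "runs P e ea eb f k"
    using assms(2) unfolding polytime_def by blast
  obtain Q e' k' where g: "runs (P @ Q) e' eb ec g k'"
    using polytime_extend[OF assms(1)] by blast
  note f = runs_append[OF f, of Q]
  let ?h = "\<lambda>n. (n + 2) ^ k + ((n + 2) ^ k + 2) ^ k' + 1 + ((n + 2) ^ k + 2) ^ k'"
  show ?thesis
  proof (rule polytimeI[of ?h _ "P @ Q" "LetE e e'"])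
    show "poly_bounded ?h" by (intro poly_bounded_intros)
    fix a
    obtain t where t: "evaluates (P @ Q) (ea a # []) e (eb (f a)) t" "t \<le> (size (ea a) + 2) ^ k"
      using f by (rule runsE)
    obtain t' where t': "evaluates (P @ Q) (eb (f a) # [ea a]) e' (ec (g (f a))) t'"
        "t' \<le> (size (eb (f a)) + 2) ^ k'"
      using g by (rule runsE)
    have "size (eb (f a)) \<le> (size (ea a) + 2) ^ k"
      using evaluates_size[OF t(1)] t(2) by simp
    then have "t' \<le> ((size (ea a) + 2) ^ k + 2) ^ k'"
      using t'(2) power_mono[of "size (eb (f a)) + 2" "(size (ea a) + 2) ^ k + 2" k'] by simp
    moreover have "size (ec (g (f a))) \<le> t'"
      using evaluates_size[OF t'(1)] by simp
    ultimately show "\<exists>t\<le>?h (size (ea a)). evaluates (P @ Q) [ea a] (LetE e e') (ec (g (f a))) t"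
      using t(2) evaluates_Let[OF t(1) t'(1)] by (intro exI conjI) simp_all
  qed
qed

lemma polytime_Node:
  assumes "polytime ea eb f" "polytime ea ec g" "\<And>a. ed (h a) = Node (eb (f a)) (ec (g a))"
  shows "polytime ea ed h"
proof -
  obtain P e k where f: "runs P e ea eb f k"
    using assms(1) unfolding polytime_def by blast
  obtain Q e' k' where g: "runs (P @ Q) e' ea ec g k'"
    using polytime_extend[OF assms(2)] by blast
  note f = runs_append[OF f, of Q]
  let ?h = "\<lambda>n. 2 * (n + 2) ^ k + 2 * (n + 2) ^ k' + 2"
  show ?thesis
  proof (rule polytimeI[of ?h _ "P @ Q" "NodeE e e'"])
    show "poly_bounded ?h" by (intro poly_bounded_intros)
    fix a
    obtain t where t: "evaluates (P @ Q) (ea a # []) e (eb (f a)) t" "t \<le> (size (ea a) + 2) ^ k"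
      using f by (rule runsE)
    obtain t' where t': "evaluates (P @ Q) (ea a # []) e' (ec (g a)) t'" "t' \<le> (size (ea a) + 2) ^ k'"
      using g by (rule runsE)
    show "\<exists>t\<le>?h (size (ea a)). evaluates (P @ Q) [ea a] (NodeE e e') (ed (h a)) t"
      unfolding assms(3) using t(2) t'(2) evaluates_Node[OF t(1) t'(1)]
        evaluates_size[OF t(1)] evaluates_size[OF t'(1)]
      by (intro exI conjI) auto
  qed
qed

lemma polytime_left:
  assumes "polytime ea eb f" "\<And>a. ec (g a) = left (eb (f a))"
  shows "polytime ea ec g"
proof -
  obtain P e k where f: "runs P e ea eb f k"
    using assms(1) unfolding polytime_def by blast
  let ?h = "\<lambda>n. 2 * (n + 2) ^ k + 1"
  show ?thesis
  proof (rule polytimeI[of ?h _ P "LeftE e"])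
    show "poly_bounded ?h" by (intro poly_bounded_intros)
    fix a
    obtain t where t: "evaluates P (ea a # []) e (eb (f a)) t" "t \<le> (size (ea a) + 2) ^ k"
      using f by (rule runsE)
    have "size (left (eb (f a))) \<le> size (eb (f a))" by (cases "eb (f a)") auto
    then show "\<exists>t\<le>?h (size (ea a)). evaluates P [ea a] (LeftE e) (ec (g a)) t"
      unfolding assms(2) using t(2) evaluates_Left[OF t(1)] evaluates_size[OF t(1)]
      by (intro exI conjI) auto
  qed
qed

lemma polytime_right:
  assumes "polytime ea eb f" "\<And>a. ec (g a) = right (eb (f a))"
  shows "polytime ea ec g"
proof -
  obtain P e k where f: "runs P e ea eb f k"
    using assms(1) unfolding polytime_def by blast
  let ?h = "\<lambda>n. 2 * (n + 2) ^ k + 1"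
  show ?thesis
  proof (rule polytimeI[of ?h _ P "RightE e"])
    show "poly_bounded ?h" by (intro poly_bounded_intros)
    fix a
    obtain t where t: "evaluates P (ea a # []) e (eb (f a)) t" "t \<le> (size (ea a) + 2) ^ k"
      using f by (rule runsE)
    have "size (right (eb (f a))) \<le> size (eb (f a))" by (cases "eb (f a)") auto
    then show "\<exists>t\<le>?h (size (ea a)). evaluates P [ea a] (RightE e) (ec (g a)) t"
      unfolding assms(2) using t(2) evaluates_Right[OF t(1)] evaluates_size[OF t(1)]
      by (intro exI conjI) auto
  qed
qed

text \<open>The machine can only distinguish \<open>Leaf\<close> from \<open>Node\<close>. As
  \<open>Leaf\<close> is the code of \<open>False\<close>, of 0 and of \<open>[]\<close> alike, the
  connectives, the zero test and the emptiness test are all instances.\<close>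

lemma polytime_test:
  assumes "polytime ea ed d" "polytime ea eb f" "polytime ea eb g"
    and "\<And>a. ed (d a) \<noteq> Leaf \<Longrightarrow> h a = f a" "\<And>a. ed (d a) = Leaf \<Longrightarrow> h a = g a"
  shows "polytime ea eb h"
proof -
  obtain P e1 k1 where d: "runs P e1 ea ed d k1"
    using assms(1) unfolding polytime_def by blast
  obtain Q e2 k2 where f: "runs (P @ Q) e2 ea eb f k2"
    using polytime_extend[OF assms(2)] by blast
  obtain R e3 k3 where g: "runs ((P @ Q) @ R) e3 ea eb g k3"
    using polytime_extend[OF assms(3)] by blast
  let ?P = "(P @ Q) @ R"
  note d = runs_append[OF runs_append[OF d, of Q], of R]
  note f = runs_append[OF f, of R]
  let ?h = "\<lambda>n. (n + 2) ^ k1 + 2 * (n + 2) ^ k2 + 2 * (n + 2) ^ k3 + 1"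
  show ?thesis
  proof (rule polytimeI[of ?h _ ?P "IfNode e1 e2 e3"])
    show "poly_bounded ?h" by (intro poly_bounded_intros)
    fix a
    obtain t1 where t1: "evaluates ?P (ea a # []) e1 (ed (d a)) t1" "t1 \<le> (size (ea a) + 2) ^ k1"
      using d by (rule runsE)
    obtain t2 where t2: "evaluates ?P (ea a # []) e2 (eb (f a)) t2" "t2 \<le> (size (ea a) + 2) ^ k2"
      using f by (rule runsE)
    obtain t3 where t3: "evaluates ?P (ea a # []) e3 (eb (g a)) t3" "t3 \<le> (size (ea a) + 2) ^ k3"
      using g by (rule runsE)
    show "\<exists>t\<le>?h (size (ea a)). evaluates ?P [ea a] (IfNode e1 e2 e3) (eb (h a)) t"
    proof (cases "ed (d a) = Leaf")
      case True
      show ?thesis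
        unfolding assms(5)[OF True]
        by (rule bounded_exI, rule evaluates_If_Leaf[OF t1(1)[unfolded True] t3(1)])
          (use t1(2) t3(2) evaluates_size[OF t3(1)] in auto)
    next
      case False
      show ?thesis
        unfolding assms(4)[OF False]
        by (rule bounded_exI, rule evaluates_If_Node[OF t1(1) False t2(1)])
          (use t1(2) t2(2) evaluates_size[OF t2(1)] in auto)
    qed
  qed
qed

lemma polytime_Pair:
  "polytime ea eb f \<Longrightarrow> polytime ea ec g \<Longrightarrow> polytime ea (enc_pair eb ec) (\<lambda>a. (f a, g a))"
  by (erule polytime_Node, assumption) (simp add: enc_pair_def)

lemma polytime_fst: "polytime ea (enc_pair eb ec) f \<Longrightarrow> polytime ea eb (\<lambda>a. fst (f a))"
  by (erule polytime_left) (simp add: enc_pair_def split: prod.split)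

lemma polytime_snd: "polytime ea (enc_pair eb ec) f \<Longrightarrow> polytime ea ec (\<lambda>a. snd (f a))"
  by (erule polytime_right) (simp add: enc_pair_def split: prod.split)

lemma polytime_If:
  assumes "polytime ea enc_bool b" "polytime ea eb f" "polytime ea eb g"
  shows "polytime ea eb (\<lambda>a. if b a then f a else g a)"
  using assms by (rule polytime_test) (auto simp: enc_bool_def split: if_splits)

lemma polytime_Not: "polytime ea enc_bool b \<Longrightarrow> polytime ea enc_bool (\<lambda>a. \<not> b a)"
  by (erule polytime_test[of _ _ _ _ "\<lambda>a. False" "\<lambda>a. True"])
    (auto intro: polytime_const simp: enc_bool_def split: if_splits)

lemma polytime_conj:
  "polytime ea enc_bool b \<Longrightarrow> polytime ea enc_bool c \<Longrightarrow> polytime ea enc_bool (\<lambda>a. b a \<and> c a)"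
  by (erule polytime_test[of _ _ _ _ c "\<lambda>a. False"])
    (auto intro: polytime_const simp: enc_bool_def split: if_splits)

lemma polytime_disj:
  "polytime ea enc_bool b \<Longrightarrow> polytime ea enc_bool c \<Longrightarrow> polytime ea enc_bool (\<lambda>a. b a \<or> c a)"
  by (erule polytime_test[of _ _ _ _ "\<lambda>a. True" c])
    (auto intro: polytime_const simp: enc_bool_def split: if_splits)

lemma polytime_bool_eq:
  assumes "polytime ea enc_bool b" "polytime ea enc_bool c"
  shows "polytime ea enc_bool (\<lambda>a. b a = c a)"
  by (rule polytime_test[OF assms(1,2) polytime_Not[OF assms(2)]]) (auto simp: enc_bool_def split: if_splits)

lemma polytime_Cons:
  "polytime ea ex f \<Longrightarrow> polytime ea (enc_list ex) g \<Longrightarrow> polytime ea (enc_list ex) (\<lambda>a. f a # g a)"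
  by (erule polytime_Node, assumption) simp

lemma polytime_tl: "polytime ea (enc_list ex) f \<Longrightarrow> polytime ea (enc_list ex) (\<lambda>a. tl (f a))"
proof (erule polytime_right)
  show "enc_list ex (tl (f a)) = right (enc_list ex (f a))" for a by (cases "f a") auto
qed

lemma polytime_is_Nil: "polytime ea (enc_list ex) f \<Longrightarrow> polytime ea enc_bool (\<lambda>a. f a = [])"
  apply (erule polytime_test[of _ _ _ _ "\<lambda>a. False" "\<lambda>a. True"])
  apply (auto intro: polytime_const)
  subgoal for a by (cases "f a") auto
  done

text \<open>The default branch shields the head of the list from the junk value \<open>hd []\<close>.\<close>

lemma polytime_case_list:
  assumes "polytime ea (enc_list ex) l" "polytime ea eb f"
    and "polytime (enc_pair ea ex) eb (\<lambda>p. g (fst p) (snd p))"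
  shows "polytime ea eb (\<lambda>a. case l a of [] \<Rightarrow> f a | x # xs \<Rightarrow> g a x)"
proof -
  obtain P e1 k1 where l: "runs P e1 ea (enc_list ex) l k1"
    using assms(1) unfolding polytime_def by blast
  obtain Q e2 k2 where f: "runs (P @ Q) e2 ea eb f k2"
    using polytime_extend[OF assms(2)] by blast
  obtain R e3 k3 where g: "runs ((P @ Q) @ R) e3 (enc_pair ea ex) eb (\<lambda>p. g (fst p) (snd p)) k3"
    using polytime_extend[OF assms(3)] by blast
  let ?P = "(P @ Q) @ R"
  note l = runs_append[OF runs_append[OF l, of Q], of R]
  note f = runs_append[OF f, of R]
  let ?h = "\<lambda>n. (n + 2) ^ k1 + 2 * (n + 2) ^ k2 + 1 + (n + 2) ^ k1 + (n + 2) ^ k1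
     + 2 * n + 2 * (n + 2) ^ k1 + 2 + 2 + 3 * (n + (n + 2) ^ k1 + 3) ^ k3 + 2"
  \<comment> \<open>The branch code expects the single argument \<open>(a, x)\<close>, so this pair
    is built and bound first; \<open>e1\<close> is run a second time to obtain the head.\<close>
  show ?thesis
  proof (rule polytimeI[of ?h _ ?P "IfNode e1 (LetE (NodeE (Var 0) (LeftE e1)) e3) e2"])
    show "poly_bounded ?h" by (intro poly_bounded_intros)
    fix a
    obtain t1 where t1: "evaluates ?P (ea a # []) e1 (enc_list ex (l a)) t1" "t1 \<le> (size (ea a) + 2) ^ k1"
      using l by (rule runsE)
    obtain t2 where t2: "evaluates ?P (ea a # []) e2 (eb (f a)) t2" "t2 \<le> (size (ea a) + 2) ^ k2"
      using f by (rule runsE)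
    show "\<exists>t\<le>?h (size (ea a)). evaluates ?P [ea a] (IfNode e1 (LetE (NodeE (Var 0) (LeftE e1)) e3) e2)
        (eb (case l a of [] \<Rightarrow> f a | x # xs \<Rightarrow> g a x)) t"
    proof (cases "l a")
      case Nil
      then have *: "evaluates ?P [ea a] e1 Leaf t1" using t1(1) by simp
      show ?thesis
        unfolding Nil list.case
        by (rule bounded_exI, rule evaluates_If_Leaf[OF * t2(1)])
          (use t1(2) t2(2) evaluates_size[OF t2(1)] in auto)
    next
      case (Cons x xs)
      obtain t3 where t3: "evaluates ?P (enc_pair ea ex (a, x) # [ea a]) e3 (eb (g (fst (a, x)) (snd (a, x)))) t3"
          "t3 \<le> (size (enc_pair ea ex (a, x)) + 2) ^ k3"
        using g by (rule runsE)
      have v: "evaluates ?P [ea a] (Var 0) (ea a) (1 + size (ea a))"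
        using evaluates_Var[of 0 "[ea a]"] by simp
      have le: "evaluates ?P [ea a] (LeftE e1) (ex x) (t1 + 1 + size (ex x))"
        using evaluates_Left[OF t1(1)] Cons by simp
      have n: "evaluates ?P [ea a] (NodeE (Var 0) (LeftE e1)) (enc_pair ea ex (a, x))
          ((1 + size (ea a)) + (t1 + 1 + size (ex x)) + 1 + size (Node (ea a) (ex x)))"
        using evaluates_Node[OF v le] by (simp add: enc_pair_def)
      have sx: "size (ex x) \<le> (size (ea a) + 2) ^ k1"
        using evaluates_size[OF t1(1)] t1(2) Cons by simp
      then have "size (enc_pair ea ex (a, x)) + 2 \<le> size (ea a) + (size (ea a) + 2) ^ k1 + 3"
        by (simp add: enc_pair_def)
      then have t3': "t3 \<le> (size (ea a) + (size (ea a) + 2) ^ k1 + 3) ^ k3"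
        using t3(2) power_mono[of "size (enc_pair ea ex (a, x)) + 2" _ k3] le_trans by blast
      have "enc_list ex (l a) \<noteq> Leaf" using Cons by simp
      note ev = evaluates_If_Node[OF t1(1) this evaluates_Let[OF n t3(1)], of e2]
      show ?thesis
        unfolding Cons list.case
        by (rule bounded_exI, rule ev[unfolded fst_conv snd_conv])
          (use t1(2) t3' sx evaluates_size[OF t3(1)] in \<open>unfold fst_conv snd_conv tree.size, linarith\<close>)
    qed
  qed
qed

text \<open>The potential \<open>M\<close> bounds both the depth of the recursion and the size of its arguments.\<close>

lemma polytime_linear_recursion:
  assumes "polytime ea enc_bool b" "polytime ea eb h" "polytime ea ea d"
    and "polytime (enc_pair ea eb) eb g"
    and f: "\<And>x. f x = (if b x then h x else g (x, f (d x)))"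
    and M: "\<And>x. \<not> b x \<Longrightarrow> M (d x) < M x" "\<And>x. size (ea x) \<le> M x"
      "\<And>x. M x \<le> Hi (size (ea x))" "poly_bounded Hi"
    and Ho: "\<And>x. size (eb (f x)) \<le> Ho (M x)" "poly_bounded Ho"
  shows "polytime ea eb f"
proof -
  obtain P1 e1 k1 where r1: "runs P1 e1 ea enc_bool b k1"
    using assms(1) unfolding polytime_def by blast
  obtain P2 e2 k2 where r2: "runs (P1 @ P2) e2 ea eb h k2"
    using polytime_extend[OF assms(2)] by blast
  obtain P3 e3 k3 where r3: "runs ((P1 @ P2) @ P3) e3 ea ea d k3"
    using polytime_extend[OF assms(3)] by blast
  obtain P4 e4 k4 where r4: "runs (((P1 @ P2) @ P3) @ P4) e4 (enc_pair ea eb) eb g k4"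
    using polytime_extend[OF assms(4)] by blast
  let ?Q = "((P1 @ P2) @ P3) @ P4"
  \<comment> \<open>The body becomes the last function of the program, so its own index is
    \<open>length ?Q\<close>.\<close>
  let ?body = "IfNode e1 e2 (LetE (NodeE (Var 0) (Call (length ?Q) [e3])) e4)"
  let ?P = "?Q @ [?body]"
  note r1 = runs_append[OF runs_append[OF runs_append[OF runs_append[OF r1, of P2], of P3], of P4], of "[?body]"]
  note r2 = runs_append[OF runs_append[OF runs_append[OF r2, of P3], of P4], of "[?body]"]
  note r3 = runs_append[OF runs_append[OF r3, of P4], of "[?body]"]
  note r4 = runs_append[OF r4, of "[?body]"]
  obtain k where k: "Ho n \<le> (n + 2) ^ k" for n
    using Ho(2) unfolding poly_bounded_def by blast
  obtain j where j: "Hi n \<le> (n + 2) ^ j" for n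
    using M(4) unfolding poly_bounded_def by blast
  \<comment> \<open>\<open>C (M x)\<close> pays for one activation without its recursive call,
    including the handling of the recursive result. Since \<open>M\<close> strictly decreases, there
    are at most \<open>M x + 1\<close> activations.\<close>
  define C where "C n = (n + 2) ^ k1 + 2 * (n + 2) ^ k2 + (n + 2) ^ k3 + 10
     + 2 * n + 2 * (n + 2) ^ k + 3 * (n + (n + 2) ^ k + 3) ^ k4" for n :: nat
  have mono: "C m \<le> C n" if "m \<le> n" for m n :: nat
    using that unfolding C_def by (intro add_mono mult_mono power_mono) auto
  have main: "\<exists>t \<le> (M x + 1) * C (M x). evaluates ?P [ea x] ?body (eb (f x)) t" for x
  proof (induction "M x" arbitrary: x rule: less_induct)
    case less
    obtain t1 where t1: "evaluates ?P (ea x # []) e1 (enc_bool (b x)) t1" "t1 \<le> (size (ea x) + 2) ^ k1"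
      using r1 by (rule runsE)
    have t1': "t1 \<le> (M x + 2) ^ k1"
      using t1(2) M(2)[of x] power_mono[of "size (ea x) + 2" "M x + 2" k1] by linarith
    show ?case
    proof (cases "b x")
      case True
      obtain t2 where t2: "evaluates ?P (ea x # []) e2 (eb (h x)) t2" "t2 \<le> (size (ea x) + 2) ^ k2"
        using r2 by (rule runsE)
      have t2': "t2 \<le> (M x + 2) ^ k2"
        using t2(2) M(2)[of x] power_mono[of "size (ea x) + 2" "M x + 2" k2] by linarith
      have "enc_bool (b x) \<noteq> Leaf" using True by (simp add: enc_bool_def)
      note ev = evaluates_If_Node[OF t1(1) this t2(1)]
      have "t1 + t2 + 1 + size (eb (h x)) \<le> C (M x)"
        unfolding C_def using t1' t2' evaluates_size[OF t2(1)] by linarith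
      also have "\<dots> \<le> (M x + 1) * C (M x)"
        by simp
      finally have "t1 + t2 + 1 + size (eb (h x)) \<le> (M x + 1) * C (M x)" .
      moreover have "f x = h x" using f[of x] True by simp
      ultimately show ?thesis using ev by metis
    next
      case False
      obtain t3 where t3: "evaluates ?P (ea x # []) e3 (ea (d x)) t3" "t3 \<le> (size (ea x) + 2) ^ k3"
        using r3 by (rule runsE)
      have t3': "t3 \<le> (M x + 2) ^ k3"
        using t3(2) M(2)[of x] power_mono[of "size (ea x) + 2" "M x + 2" k3] by linarith
      obtain t where t: "t \<le> (M (d x) + 1) * C (M (d x))" "evaluates ?P [ea (d x)] ?body (eb (f (d x))) t"
        using less[OF M(1)[OF False]] by blast
      have "(M (d x) + 1) * C (M (d x)) \<le> M x * C (M x)"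
        using M(1)[OF False] by (intro mult_mono mono) auto
      then have t': "t \<le> M x * C (M x)" using t(1) by linarith
      have args: "evaluates_list ?P [ea x] [e3] [ea (d x)] (t3 + 0)"
        by (intro evaluates_list_Cons evaluates_list_Nil t3(1))
      have call: "evaluates ?P [ea x] (Call (length ?Q) [e3]) (eb (f (d x)))
          ((t3 + 0) + t + 1 + size (eb (f (d x))))"
        by (rule evaluates_Call[OF _ args]) (use t(2) in \<open>simp_all add: nth_append\<close>)
      have v: "evaluates ?P [ea x] (Var 0) (ea x) (1 + size (ea x))"
        using evaluates_Var[of 0 "[ea x]"] by simp
      let ?n = "(1 + size (ea x)) + ((t3 + 0) + t + 1 + size (eb (f (d x)))) + 1
          + size (Node (ea x) (eb (f (d x))))"
      have n: "evaluates ?P [ea x] (NodeE (Var 0) (Call (length ?Q) [e3])) (enc_pair ea eb (x, f (d x))) ?n"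
        using evaluates_Node[OF v call] by (simp add: enc_pair_def)
      obtain t4 where t4: "evaluates ?P (enc_pair ea eb (x, f (d x)) # [ea x]) e4 (eb (g (x, f (d x)))) t4"
          "t4 \<le> (size (enc_pair ea eb (x, f (d x))) + 2) ^ k4"
        using r4 by (rule runsE)
      have "size (eb (f (d x))) \<le> (M (d x) + 2) ^ k"
        using Ho(1)[of "d x"] k[of "M (d x)"] by linarith
      also have "\<dots> \<le> (M x + 2) ^ k"
        using M(1)[OF False] by (intro power_mono) auto
      finally have s: "size (eb (f (d x))) \<le> (M x + 2) ^ k" .
      have "(size (enc_pair ea eb (x, f (d x))) + 2) ^ k4 \<le> (M x + (M x + 2) ^ k + 3) ^ k4"
        using s M(2)[of x] by (intro power_mono) (auto simp: enc_pair_def)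
      then have t4': "t4 \<le> (M x + (M x + 2) ^ k + 3) ^ k4"
        using t4(2) by linarith
      have "enc_bool (b x) = Leaf" using False by (simp add: enc_bool_def)
      note ev = evaluates_If_Leaf[OF t1(1)[unfolded this] evaluates_Let[OF n t4(1)], of e2]
      have "t1 + (?n + t4 + 1 + size (eb (g (x, f (d x))))) + 1 + size (eb (g (x, f (d x))))
          \<le> C (M x) + M x * C (M x)"
        unfolding C_def[of "M x"] using t1' t3' t'[unfolded C_def] t4' s M(2)[of x] evaluates_size[OF t4(1)]
        unfolding tree.size by linarith
      also have "\<dots> = (M x + 1) * C (M x)" by simp
      finally have le: "t1 + (?n + t4 + 1 + size (eb (g (x, f (d x))))) + 1 + size (eb (g (x, f (d x))))
          \<le> (M x + 1) * C (M x)" .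
      have "f x = g (x, f (d x))" using f[of x] False by simp
      then show ?thesis using ev le by metis
    qed
  qed
  let ?h = "\<lambda>n. ((n + 2) ^ j + 1) * C ((n + 2) ^ j)"
  show ?thesis
  proof (rule polytimeI[of ?h _ ?P ?body])
    show "poly_bounded ?h" unfolding C_def by (intro poly_bounded_intros)
    fix a
    have "M a \<le> (size (ea a) + 2) ^ j"
      using M(3)[of a] j[of "size (ea a)"] by linarith
    then have "(M a + 1) * C (M a) \<le> ?h (size (ea a))"
      by (intro mult_mono mono) auto
    then show "\<exists>t\<le>?h (size (ea a)). evaluates ?P [ea a] ?body (eb (f a)) t"
      using main[of a] le_trans by blast
  qed
qed

subsection \<open>Lists\<close>

lemma size_enc_list: "size (enc_list e xs) = (\<Sum>x\<leftarrow>xs. size (e x) + 1)"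
  by (induction xs) auto

lemma size_enc_pair: "size (enc_pair e e' p) = size (e (fst p)) + size (e' (snd p)) + 1"
  by (simp add: enc_pair_def split: prod.split)

lemma size_enc_bool: "size (enc_bool b) \<le> 1"
  by (simp add: enc_bool_def)

lemma size_enc_list_le:
  assumes "\<And>x. x \<in> set xs \<Longrightarrow> size (e x) \<le> B" "length xs \<le> n"
  shows "size (enc_list e xs) \<le> n * (B + 1)"
proof -
  have "size (enc_list e xs) \<le> length xs * (B + 1)"
    using assms(1) by (induction xs) fastforce+
  also have "\<dots> \<le> n * (B + 1)" using assms(2) by (rule mult_right_mono) simp
  finally show ?thesis .
qed

lemma size_enc_list_mem: "x \<in> set xs \<Longrightarrow> size (e x) < size (enc_list e xs)"
  by (induction xs) auto

lemma length_le_size_enc_list: "length xs \<le> size (enc_list e xs)"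
  by (induction xs) auto

lemmas polytime_proj = polytime_fst polytime_snd polytime_id

lemma polytime_comp2:
  assumes "polytime (enc_pair eb ec) ed (\<lambda>p. h (fst p) (snd p))"
    and "polytime ea eb f" "polytime ea ec g"
  shows "polytime ea ed (\<lambda>a. h (f a) (g a))"
  using polytime_comp[OF assms(1) polytime_Pair[OF assms(2,3)]] by simp

text \<open>Iterating a polynomial-time step could square the accumulator each time, so a bound on
  the accumulator is a hypothesis of its own. It is asked for every list \<open>xs\<close> because
  the recursion passes through all suffixes of \<open>l a\<close>.\<close>

lemma polytime_foldr:
  assumes g: "polytime (enc_pair (enc_pair ea ex) es) es (\<lambda>p. g (fst (fst p)) (snd (fst p)) (snd p))"
    and s: "polytime ea es s" and l: "polytime ea (enc_list ex) l"
    and H: "\<And>a xs. size (es (foldr (g a) xs (s a))) \<le> H (size (ea a) + size (enc_list ex xs))"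
      "poly_bounded H"
  shows "polytime ea es (\<lambda>a. foldr (g a) (l a) (s a))"
proof -
  let ?e = "enc_pair ea (enc_list ex)"
  obtain k where k: "H n \<le> (n + 2) ^ k" for n
    using H(2) unfolding poly_bounded_def by blast
  let ?f = "\<lambda>p. foldr (g (fst p)) (snd p) (s (fst p))"
  let ?d = "\<lambda>p. (fst p, tl (snd p))"
  let ?g = "\<lambda>q. case snd (fst q) of [] \<Rightarrow> snd q | x # xs \<Rightarrow> g (fst (fst q)) x (snd q)"
  have "polytime ?e es ?f"
  proof (rule polytime_linear_recursion[where M = "\<lambda>p. size (?e p)" and Hi = "\<lambda>n. n" and d = ?d and g = ?g
        and Ho = "\<lambda>n. (n + 2) ^ k" and b = "\<lambda>p. snd p = []" and h = "\<lambda>p. s (fst p)"])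
    show "polytime ?e enc_bool (\<lambda>p. snd p = [])"
      by (rule polytime_is_Nil, (rule polytime_proj)+)
    show "polytime ?e es (\<lambda>p. s (fst p))"
      by (rule polytime_comp[OF s], (rule polytime_proj)+)
    show "polytime ?e ?e ?d"
      by (intro polytime_Pair polytime_tl; (rule polytime_proj)+)
    have "polytime (enc_pair (enc_pair ?e es) ex) es
        (\<lambda>p. (\<lambda>p. g (fst (fst p)) (snd (fst p)) (snd p)) ((fst (fst (fst p)), snd p), snd (fst p)))"
      by (rule polytime_comp[OF g], intro polytime_Pair; (rule polytime_proj)+)
    then have "polytime (enc_pair (enc_pair ?e es) ex) es
        (\<lambda>p. g (fst (fst (fst p))) (snd p) (snd (fst p)))" by simp
    then show "polytime (enc_pair ?e es) es ?g"
      by (intro polytime_case_list[where g = "\<lambda>q x. g (fst (fst q)) x (snd q)" and ex = ex])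
        (rule polytime_proj | assumption)+
    show "?f p = (if snd p = [] then s (fst p) else ?g (p, ?f (?d p)))" for p
      by (cases "snd p") auto
    show "size (?e (?d p)) < size (?e p)" if "\<not> snd p = []" for p
      using that by (cases "snd p") (auto simp: size_enc_pair)
    show "size (es (?f p)) \<le> (size (?e p) + 2) ^ k" for p
    proof -
      let ?n = "size (ea (fst p)) + size (enc_list ex (snd p))"
      have "size (es (?f p)) \<le> H ?n" by (rule H(1))
      also have "\<dots> \<le> (?n + 2) ^ k" by (rule k)
      also have "\<dots> \<le> (size (?e p) + 2) ^ k" by (rule power_mono) (auto simp: size_enc_pair)
      finally show ?thesis .
    qed
  qed (auto intro!: poly_bounded_intros simp del: add_2_eq_Suc')
  from polytime_comp[OF this polytime_Pair[OF polytime_id l]] show ?thesis by simp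
qed

lemma polytime_append:
  assumes "polytime ea (enc_list ex) f" "polytime ea (enc_list ex) g"
  shows "polytime ea (enc_list ex) (\<lambda>a. f a @ g a)"
proof -
  let ?e = "enc_pair (enc_list ex) (enc_list ex)"
  have eq: "foldr (\<lambda>x ys. x # ys) xs ys = xs @ ys" for xs ys :: "'b list"
    by (induction xs) auto
  have "polytime ?e (enc_list ex) (\<lambda>p. foldr (\<lambda>x ys. x # ys) (fst p) (snd p))"
    by (rule polytime_foldr[where H = "\<lambda>n. n" and ex = ex])
      (auto simp: eq size_enc_pair size_enc_list intro!: polytime_Cons poly_bounded_intros polytime_id
        intro: polytime_fst[of _ _ "enc_list ex"] polytime_snd[of _ "enc_list ex"]
        polytime_snd[of _ "enc_pair ?e ex"] polytime_snd[of _ "?e"] polytime_fst[of _ _ "enc_list ex"])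
  from polytime_comp2[OF this[unfolded eq] assms] show ?thesis .
qed

lemma polytime_rev:
  assumes "polytime ea (enc_list ex) f"
  shows "polytime ea (enc_list ex) (\<lambda>a. rev (f a))"
proof -
  have eq: "foldr (\<lambda>x ys. ys @ [x]) xs [] = rev xs" for xs :: "'b list"
    by (induction xs) auto
  have "polytime (enc_list ex) (enc_list ex) (\<lambda>p. foldr (\<lambda>x ys. ys @ [x]) p [])"
    by (rule polytime_foldr[where H = "\<lambda>n. n" and ex = ex])
      (auto simp: eq size_enc_list rev_map[symmetric] intro!: polytime_append polytime_Cons poly_bounded_intros polytime_id
       polytime_const intro: polytime_snd[of _ "enc_pair (enc_list ex) ex"] polytime_snd[of _ "enc_list ex"]
        polytime_fst[of _ _ "enc_list ex"])
  from polytime_comp[OF this[unfolded eq] assms] show ?thesis .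
qed

lemma polytime_foldl:
  assumes g: "polytime (enc_pair (enc_pair ea ex) es) es (\<lambda>p. g (fst (fst p)) (snd p) (snd (fst p)))"
    and s: "polytime ea es s" and l: "polytime ea (enc_list ex) l"
    and H: "\<And>a xs. size (es (foldl (g a) (s a) xs)) \<le> H (size (ea a) + size (enc_list ex xs))"
      "poly_bounded H"
  shows "polytime ea es (\<lambda>a. foldl (g a) (s a) (l a))"
proof -
  have eq: "foldl f s xs = foldr (\<lambda>x y. f y x) (rev xs) s" for f and s :: 'd and xs :: "'b list"
    by (simp add: foldl_conv_foldr)
  have sz: "size (enc_list ex (rev xs)) = size (enc_list ex xs)" for xs
    by (simp add: size_enc_list rev_map[symmetric])
  show ?thesis
    unfolding eq
    by (rule polytime_foldr[where g = "\<lambda>a x y. g a y x", OF g s polytime_rev[OF l] _ H(2)])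
      (use H(1)[of _ "rev _"] in \<open>simp add: eq sz\<close>)
qed

lemma polytime_map:
  assumes h: "polytime (enc_pair ea ex) ey (\<lambda>p. h (fst p) (snd p))" and l: "polytime ea (enc_list ex) l"
  shows "polytime ea (enc_list ey) (\<lambda>a. map (h a) (l a))"
proof -
  have eq: "foldr (\<lambda>x ys. h a x # ys) xs [] = map (h a) xs" for xs a
    by (induction xs) auto
  obtain k where k: "size (ey (h (fst p) (snd p))) \<le> (size (enc_pair ea ex p) + 2) ^ k" for p
    using polytime_size[OF h] by blast
  have "polytime ea (enc_list ey) (\<lambda>a. foldr (\<lambda>x ys. h a x # ys) (l a) [])"
  proof (rule polytime_foldr[where H = "\<lambda>n. n * ((n + 3) ^ k + 1)" and ex = ex])
    show "polytime (enc_pair (enc_pair ea ex) (enc_list ey)) (enc_list ey)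
        (\<lambda>p. h (fst (fst p)) (snd (fst p)) # snd p)"
      by (intro polytime_Cons polytime_comp2[OF h])
        (rule polytime_proj)+
    show "size (enc_list ey (foldr (\<lambda>x ys. h a x # ys) xs [])) \<le>
      (size (ea a) + size (enc_list ex xs)) * ((size (ea a) + size (enc_list ex xs) + 3) ^ k + 1)" for a xs
      unfolding eq
    proof (rule size_enc_list_le)
      fix y assume "y \<in> set (map (h a) xs)"
      then obtain x where x: "x \<in> set xs" "y = h a x" by auto
      have "size (ey y) \<le> (size (enc_pair ea ex (a, x)) + 2) ^ k"
        using k[of "(a, x)"] x(2) by simp
      also have "\<dots> \<le> (size (ea a) + size (enc_list ex xs) + 3) ^ k"
        using size_enc_list_mem[OF x(1), of ex] by (intro power_mono) (auto simp: size_enc_pair)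
      finally show "size (ey y) \<le> (size (ea a) + size (enc_list ex xs) + 3) ^ k" .
    next
      show "length (map (h a) xs) \<le> size (ea a) + size (enc_list ex xs)"
        using length_le_size_enc_list[of xs ex] by simp
    qed
  qed (intro poly_bounded_intros polytime_const l)+
  then show ?thesis unfolding eq .
qed

lemma polytime_filter:
  assumes h: "polytime (enc_pair ea ex) enc_bool (\<lambda>p. q (fst p) (snd p))" and l: "polytime ea (enc_list ex) l"
  shows "polytime ea (enc_list ex) (\<lambda>a. filter (q a) (l a))"
proof -
  have eq: "foldr (\<lambda>x ys. if q a x then x # ys else ys) xs [] = filter (q a) xs" for xs a
    by (induction xs) auto
  have "polytime ea (enc_list ex) (\<lambda>a. foldr (\<lambda>x ys. if q a x then x # ys else ys) (l a) [])"
  proof (rule polytime_foldr[where H = "\<lambda>n. n" and ex = ex])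
    show "polytime (enc_pair (enc_pair ea ex) (enc_list ex)) (enc_list ex)
        (\<lambda>p. if q (fst (fst p)) (snd (fst p)) then snd (fst p) # snd p else snd p)"
      by (intro polytime_If polytime_Cons polytime_comp2[OF h])
        (rule polytime_proj)+
    have "size (enc_list ex (filter (q a) xs)) \<le> size (enc_list ex xs)" for a xs
      by (induction xs) auto
    then show "size (enc_list ex (foldr (\<lambda>x ys. if q a x then x # ys else ys) xs [])) \<le>
      size (ea a) + size (enc_list ex xs)" for a xs
      unfolding eq by (meson le_add2 le_trans)
  qed (intro poly_bounded_intros polytime_const l)+
  then show ?thesis unfolding eq .
qed

lemma polytime_list_all:
  assumes h: "polytime (enc_pair ea ex) enc_bool (\<lambda>p. q (fst p) (snd p))" and l: "polytime ea (enc_list ex) l"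
  shows "polytime ea enc_bool (\<lambda>a. list_all (q a) (l a))"
proof -
  have eq: "list_all (q a) xs = (filter (\<lambda>x. \<not> q a x) xs = [])" for a xs
    by (simp add: list_all_iff filter_empty_conv)
  show ?thesis unfolding eq
    by (rule polytime_is_Nil, rule polytime_filter[OF _ l], rule polytime_Not, rule h)
qed

subsection \<open>Numbers\<close>

lemma enc_nat_0: "enc_nat 0 = Leaf"
  by (simp add: enc_nat.simps)

lemma enc_nat_pos: "n > 0 \<Longrightarrow> enc_nat n = Node (enc_bool (odd n)) (enc_nat (n div 2))"
  by (simp add: enc_nat.simps[of n])

lemma less_power_size_enc_nat: "n < 2 ^ size (enc_nat n)"
proof (induction n rule: less_induct)
  case (less n)
  show ?case
  proof (cases "n = 0")
    case False
    have "n < 2 * 2 ^ size (enc_nat (n div 2))"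
      using less[of "n div 2"] False by linarith
    also have "\<dots> \<le> 2 ^ size (enc_nat n)"
      using False power_increasing[of "Suc (size (enc_nat (n div 2)))" "size (enc_nat n)" "2::nat"]
      by (simp add: enc_nat_pos)
    finally show ?thesis .
  qed (simp add: enc_nat_0)
qed

lemma size_enc_nat_le: "n < 2 ^ m \<Longrightarrow> size (enc_nat n) \<le> 2 * m"
proof (induction m arbitrary: n)
  case (Suc m)
  show ?case
  proof (cases "n = 0")
    case False
    have "size (enc_nat (n div 2)) \<le> 2 * m" using Suc by auto
    then show ?thesis using False size_enc_bool[of "odd n"] by (simp add: enc_nat_pos)
  qed (simp add: enc_nat_0)
qed (simp add: enc_nat_0)

lemma size_enc_nat_mono_le: "m \<le> n \<Longrightarrow> size (enc_nat m) \<le> 2 * n"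
  using less_exp[of n] by (intro size_enc_nat_le) linarith

lemma size_enc_nat_div2: "n > 0 \<Longrightarrow> size (enc_nat (n div 2)) < size (enc_nat n)"
  by (simp add: enc_nat_pos)

lemma size_enc_nat_div2_le: "size (enc_nat (n div 2)) \<le> size (enc_nat n)"
  by (cases "n = 0") (auto simp: enc_nat_pos)

lemma polytime_div2: "polytime ea enc_nat f \<Longrightarrow> polytime ea enc_nat (\<lambda>a. f a div 2)"
proof (erule polytime_right)
  show "enc_nat (f a div 2) = right (enc_nat (f a))" for a
    by (cases "f a = 0") (auto simp: enc_nat_0 enc_nat_pos)
qed

lemma polytime_odd: "polytime ea enc_nat f \<Longrightarrow> polytime ea enc_bool (\<lambda>a. odd (f a))"
proof (erule polytime_left)
  show "enc_bool (odd (f a)) = left (enc_nat (f a))" for a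
    by (cases "f a = 0") (auto simp: enc_nat_0 enc_nat_pos enc_bool_def)
qed

lemma polytime_eq_0: "polytime ea enc_nat f \<Longrightarrow> polytime ea enc_bool (\<lambda>a. f a = 0)"
  by (erule polytime_test[of _ _ _ _ "\<lambda>a. False" "\<lambda>a. True"])
    (auto intro: polytime_const simp: enc_nat.simps split: if_splits)

lemma polytime_bit_Cons:
  assumes "polytime ea enc_bool b" "polytime ea enc_nat f"
  shows "polytime ea enc_nat (\<lambda>a. of_bool (b a) + 2 * f a)"
proof -
  \<comment> \<open>Codes of numbers have no leading zeros: a \<open>False\<close> bit in front of 0
    must again give \<open>Leaf\<close>.\<close>
  let ?g = "\<lambda>a. if f a = 0 \<and> \<not> b a then Leaf else Node (enc_bool (b a)) (enc_nat (f a))"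
  have "polytime ea (\<lambda>x. x) ?g"
    by (intro polytime_If polytime_conj polytime_Not polytime_eq_0 polytime_const assms
        polytime_Node[OF assms]) simp
  then show ?thesis
  proof (rule polytime_cong)
    show "?g a = enc_nat (of_bool (b a) + 2 * f a)" for a
    proof (cases "f a = 0 \<and> \<not> b a")
      case False
      then have "of_bool (b a) + 2 * f a > (0::nat)" by auto
      from enc_nat_pos[OF this] False show ?thesis by auto
    qed (simp add: enc_nat_0)
  qed
qed

text \<open>Shared by addition and comparison, which halve both operands. The third component, a bit
  whose code may grow, is left out of the potential; the constant 3 added there covers this bit and
  the two pairing nodes.\<close>

lemma carry_potential_decreases:
  fixes p :: "(nat \<times> nat) \<times> bool"
  assumes "\<not> (fst (fst p) = 0 \<and> snd (fst p) = 0)"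
  shows "size (enc_nat (fst (fst p) div 2)) + size (enc_nat (snd (fst p) div 2))
    < size (enc_nat (fst (fst p))) + size (enc_nat (snd (fst p)))"
  using assms size_enc_nat_div2[of "fst (fst p)"] size_enc_nat_div2[of "snd (fst p)"]
    size_enc_nat_div2_le[of "fst (fst p)"] size_enc_nat_div2_le[of "snd (fst p)"] by fastforce

lemma polytime_add:
  assumes "polytime ea enc_nat f" "polytime ea enc_nat g"
  shows "polytime ea enc_nat (\<lambda>a. f a + g a)"
proof -
  let ?e = "enc_pair (enc_pair enc_nat enc_nat) enc_bool"
  let ?f = "\<lambda>p. fst (fst p) + snd (fst p) + of_bool (snd p) :: nat"
  let ?M = "\<lambda>p. size (enc_nat (fst (fst p))) + size (enc_nat (snd (fst p))) + 3"
  let ?b = "\<lambda>p. fst (fst p) = 0 \<and> snd (fst p) = (0::nat)"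
  let ?h = "\<lambda>p. if snd p then 1 else 0 :: nat"
  let ?d = "\<lambda>p. ((fst (fst p) div 2, snd (fst p) div 2),
    odd (fst (fst p)) \<and> odd (snd (fst p)) \<or> snd p \<and> odd (fst (fst p)) \<or> snd p \<and> odd (snd (fst p)))"
  \<comment> \<open>\<open>a = (b = c)\<close> holds exactly if an odd number of the three bits is
    set, which makes it the sum bit; the carry passed on by \<open>?d\<close> is their
    majority.\<close>
  let ?g = "\<lambda>q. of_bool (odd (fst (fst (fst q))) = (odd (snd (fst (fst q))) = snd (fst q))) + 2 * snd q"
  have "polytime ?e enc_nat ?f"
  proof (rule polytime_linear_recursion[where M = ?M and Hi = "\<lambda>n. n + 3" and Ho = "\<lambda>n. 2 * n"
        and b = ?b and h = ?h and d = ?d and g = ?g])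
    show "polytime ?e enc_bool ?b"
      by (intro polytime_conj polytime_eq_0; (rule polytime_proj)+)
    show "polytime ?e enc_nat ?h"
      by (intro polytime_If polytime_const; (rule polytime_proj)+)
    show "polytime ?e ?e ?d"
      by (intro polytime_conj polytime_disj polytime_Pair polytime_div2 polytime_odd; (rule polytime_proj)+)
    show "polytime (enc_pair ?e enc_nat) enc_nat ?g"
      by (intro polytime_bit_Cons polytime_bool_eq polytime_odd; (rule polytime_proj)+)
    show "?M (?d p) < ?M p" if "\<not> ?b p" for p
      using carry_potential_decreases[OF that] by simp
    show "size (?e p) \<le> ?M p" for p
      using size_enc_bool[of "snd p"] by (simp add: size_enc_pair)
    show "?M p \<le> size (?e p) + 3" for p
      by (simp add: size_enc_pair)
    show "size (enc_nat (?f p)) \<le> 2 * ?M p" for p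
    proof (rule size_enc_nat_le)
      let ?i = "size (enc_nat (fst (fst p)))" and ?j = "size (enc_nat (snd (fst p)))"
      have "?f p \<le> 2 ^ ?i + 2 ^ ?j"
        using less_power_size_enc_nat[of "fst (fst p)"] less_power_size_enc_nat[of "snd (fst p)"] by auto
      also have "\<dots> \<le> 2 ^ (?i + ?j) + 2 ^ (?i + ?j)"
        by (intro add_mono power_increasing) auto
      also have "\<dots> < 2 ^ ?M p" by (simp add: power_add)
      finally show "?f p < 2 ^ ?M p" .
    qed
    show "?f p = (if ?b p then ?h p else ?g (p, ?f (?d p)))" for p
      by (cases "odd (fst (fst p))"; cases "odd (snd (fst p))"; cases "snd p") (auto elim!: oddE evenE)
  qed (intro poly_bounded_intros)+
  from polytime_comp[OF this polytime_Pair[OF polytime_Pair[OF assms] polytime_const[of _ _ False]]]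
  show ?thesis by simp
qed

lemma polytime_Suc: "polytime ea enc_nat f \<Longrightarrow> polytime ea enc_nat (\<lambda>a. Suc (f a))"
  using polytime_add[of ea f "\<lambda>a. 1", OF _ polytime_const] by simp

lemma less_iff_div2: "x < y \<longleftrightarrow> x div 2 < y div 2 \<or> x div 2 = y div 2 \<and> even x \<and> odd y"
  for x y :: nat
  by presburger

text \<open>The bits arrive least significant first, so the flag carries the verdict on the bits
  already consumed, and any later difference overrides it. It starts as \<open>False\<close>, the
  verdict for equal numbers.\<close>

lemma polytime_less:
  assumes "polytime ea enc_nat f" "polytime ea enc_nat g"
  shows "polytime ea enc_bool (\<lambda>a. f a < g a)"
proof -
  let ?e = "enc_pair (enc_pair enc_nat enc_nat) enc_bool"
  let ?f = "\<lambda>p. fst (fst p) < snd (fst p) \<or> \<not> snd (fst p) < fst (fst p) \<and> snd p"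
  let ?M = "\<lambda>p. size (enc_nat (fst (fst p))) + size (enc_nat (snd (fst p))) + 3"
  let ?b = "\<lambda>p. fst (fst p) = 0 \<and> snd (fst p) = (0::nat)"
  let ?d = "\<lambda>p. ((fst (fst p) div 2, snd (fst p) div 2),
    if odd (fst (fst p)) = odd (snd (fst p)) then snd p else odd (snd (fst p)))"
  have "polytime ?e enc_bool ?f"
  proof (rule polytime_linear_recursion[where M = ?M and Hi = "\<lambda>n. n + 3" and Ho = "\<lambda>n. n"
        and b = ?b and h = "\<lambda>p. snd p" and d = ?d and g = "\<lambda>q. snd q"])
    show "polytime ?e enc_bool ?b"
      by (intro polytime_conj polytime_eq_0; (rule polytime_proj)+)
    show "polytime ?e enc_bool (\<lambda>p. snd p)" "polytime (enc_pair ?e enc_bool) enc_bool (\<lambda>p. snd p)"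
      by (rule polytime_proj)+
    show "polytime ?e ?e ?d"
      by (intro polytime_If polytime_bool_eq polytime_Pair polytime_div2 polytime_odd; (rule polytime_proj)+)
    show "?M (?d p) < ?M p" if "\<not> ?b p" for p
      using carry_potential_decreases[OF that] by simp
    show "size (?e p) \<le> ?M p" for p
      using size_enc_bool[of "snd p"] by (simp add: size_enc_pair)
    show "?M p \<le> size (?e p) + 3" for p
      by (simp add: size_enc_pair)
    show "size (enc_bool (?f p)) \<le> ?M p" for p
      using size_enc_bool[of "?f p"] by linarith
    show "?f p = (if ?b p then snd p else snd (p, ?f (?d p)))" for p :: "(nat \<times> nat) \<times> bool"
    proof -
      obtain x y c where p: "p = ((x, y), c)" by (metis prod.exhaust)
      show ?thesis
        unfolding p using less_iff_div2[of x y] less_iff_div2[of y x] by auto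
    qed
  qed (intro poly_bounded_intros)+
  from polytime_comp[OF this polytime_Pair[OF polytime_Pair[OF assms] polytime_const[of _ _ False]]]
  show ?thesis by simp
qed

lemma polytime_le:
  assumes "polytime ea enc_nat f" "polytime ea enc_nat g"
  shows "polytime ea enc_bool (\<lambda>a. f a \<le> g a)"
  using polytime_Not[OF polytime_less[OF assms(2,1)]] by (simp add: not_less)

lemma polytime_nat_eq:
  assumes "polytime ea enc_nat f" "polytime ea enc_nat g"
  shows "polytime ea enc_bool (\<lambda>a. f a = g a)"
  using polytime_conj[OF polytime_le[OF assms] polytime_le[OF assms(2,1)]]
  by (simp add: order_eq_iff)

lemma polytime_mult:
  assumes "polytime ea enc_nat f" "polytime ea enc_nat g"
  shows "polytime ea enc_nat (\<lambda>a. f a * g a)"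
proof -
  let ?e = "enc_pair enc_nat enc_nat"
  let ?M = "\<lambda>p. size (?e p)"
  let ?d = "\<lambda>p. (fst p div 2, snd p)"
  let ?g = "\<lambda>q. if odd (fst (fst q)) then snd q + snd q + snd (fst q) else snd q + snd q"
  have "polytime ?e enc_nat (\<lambda>p. fst p * snd p)"
  proof (rule polytime_linear_recursion[where M = ?M and Hi = "\<lambda>n. n" and Ho = "\<lambda>n. 2 * n"
        and b = "\<lambda>p. fst p = 0" and h = "\<lambda>p. 0" and d = ?d and g = ?g])
    show "polytime ?e enc_bool (\<lambda>p. fst p = 0)"
      by (intro polytime_eq_0; (rule polytime_proj)+)
    show "polytime ?e ?e ?d"
      by (intro polytime_Pair polytime_div2; (rule polytime_proj)+)
    show "polytime (enc_pair ?e enc_nat) enc_nat ?g"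
      by (intro polytime_If polytime_add polytime_odd; (rule polytime_proj)+)
    show "?M (?d p) < ?M p" if "\<not> fst p = 0" for p
      using that size_enc_nat_div2[of "fst p"] by (simp add: size_enc_pair)
    show "size (enc_nat (fst p * snd p)) \<le> 2 * ?M p" for p
    proof (rule size_enc_nat_le)
      have "fst p * snd p \<le> 2 ^ size (enc_nat (fst p)) * 2 ^ size (enc_nat (snd p))"
        using less_power_size_enc_nat[of "fst p"] less_power_size_enc_nat[of "snd p"]
        by (intro mult_mono) auto
      also have "\<dots> < 2 ^ ?M p" by (simp add: size_enc_pair power_add)
      finally show "fst p * snd p < 2 ^ ?M p" .
    qed
    show "fst p * snd p = (if fst p = 0 then 0 else ?g (p, fst (?d p) * snd (?d p)))" for p :: "nat \<times> nat"
      by (cases "odd (fst p)") (auto elim!: oddE evenE simp: algebra_simps)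
  qed (auto intro: poly_bounded_intros polytime_const)
  from polytime_comp2[OF this assms] show ?thesis .
qed

lemma polytime_nat_mem:
  assumes "polytime ea enc_nat f" "polytime ea (enc_list enc_nat) l"
  shows "polytime ea enc_bool (\<lambda>a. f a \<in> set (l a))"
proof -
  have eq: "x \<in> set xs \<longleftrightarrow> \<not> list_all (\<lambda>y. \<not> y = x) xs" for x and xs :: "nat list"
    by (auto simp: list_all_iff)
  have "polytime (enc_pair ea enc_nat) enc_bool (\<lambda>p. \<not> snd p = f (fst p))"
    by (intro polytime_Not polytime_nat_eq polytime_comp[OF assms(1)];
        (rule polytime_proj)+)
  from polytime_Not[OF polytime_list_all[where q = "\<lambda>a y. \<not> y = f a", OF this assms(2)]]
  show ?thesis unfolding eq .
qed

lemma polytime_count_list: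
  assumes "polytime ea (enc_list enc_nat) l" "polytime ea enc_nat f"
  shows "polytime ea enc_nat (\<lambda>a. count_list (l a) (f a))"
proof -
  have eq: "foldr (\<lambda>y c. if y = x then Suc c else c) xs 0 = count_list xs x" for x and xs :: "nat list"
    by (induction xs) auto
  have "polytime ea enc_nat (\<lambda>a. foldr (\<lambda>y c. if y = f a then Suc c else c) (l a) 0)"
  proof (rule polytime_foldr[where H = "\<lambda>n. 2 * n" and ex = enc_nat])
    show "polytime (enc_pair (enc_pair ea enc_nat) enc_nat) enc_nat
        (\<lambda>p. if snd (fst p) = f (fst (fst p)) then Suc (snd p) else snd p)"
      by (intro polytime_If polytime_nat_eq polytime_Suc polytime_comp[OF assms(2)];
        (rule polytime_proj)+)
    show "size (enc_nat (foldr (\<lambda>y c. if y = f a then Suc c else c) xs 0))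
        \<le> 2 * (size (ea a) + size (enc_list enc_nat xs))" for a xs
      unfolding eq
      using count_le_length[of xs "f a"] length_le_size_enc_list[of xs enc_nat]
      by (intro size_enc_nat_mono_le) linarith
  qed (intro poly_bounded_intros polytime_const assms)+
  then show ?thesis unfolding eq .
qed

subsection \<open>Rational numbers\<close>

text \<open>The greedy algorithm only compares positive coefficients. Absolute numerators and
  cross-multiplication of naturals then suffice, and no signed arithmetic has to be
  programmed.\<close>

definition rat_num :: "rat \<Rightarrow> nat" where
  "rat_num r = nat \<bar>fst (quotient_of r)\<bar>"

definition rat_den :: "rat \<Rightarrow> nat" where
  "rat_den r = nat (snd (quotient_of r))"

lemma polytime_rat_num:
  assumes "polytime ea enc_rat f"
  shows "polytime ea enc_nat (\<lambda>a. rat_num (f a))"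
proof -
  have "polytime ea (\<lambda>x. x) (\<lambda>a. left (enc_rat (f a)))"
    by (rule polytime_left[OF assms]) simp
  then show ?thesis
    by (rule polytime_right) (simp add: enc_rat_def enc_int_def rat_num_def split: prod.split)
qed

lemma polytime_rat_den:
  assumes "polytime ea enc_rat f"
  shows "polytime ea enc_nat (\<lambda>a. rat_den (f a))"
proof -
  have "polytime ea (\<lambda>x. x) (\<lambda>a. right (enc_rat (f a)))"
    by (rule polytime_right[OF assms]) simp
  then show ?thesis
  proof (rule polytime_right)
    show "enc_nat (rat_den (f a)) = right (right (enc_rat (f a)))" for a
      using quotient_of_denom_pos'[of "f a"]
      by (auto simp: enc_rat_def enc_int_def rat_den_def split: prod.split)
  qed
qed

lemma rat_pos_code: "0 < r \<longleftrightarrow> \<not> fst (quotient_of r) < 0 \<and> rat_num r \<noteq> 0"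
proof -
  obtain p q where pq: "quotient_of r = (p, q)" by fastforce
  have "r = of_int p / of_int q" "q > 0"
    using quotient_of_div[OF pq] quotient_of_denom_pos[OF pq] by auto
  then have "0 < r \<longleftrightarrow> 0 < p" by (simp add: zero_less_divide_iff)
  then show ?thesis using pq by (auto simp: rat_num_def)
qed

lemma polytime_rat_pos:
  assumes "polytime ea enc_rat f"
  shows "polytime ea enc_bool (\<lambda>a. 0 < f a)"
proof -
  have "polytime ea (\<lambda>x. x) (\<lambda>a. left (enc_rat (f a)))"
    by (rule polytime_left[OF assms]) simp
  then have "polytime ea enc_bool (\<lambda>a. fst (quotient_of (f a)) < 0)"
    by (rule polytime_left) (simp add: enc_rat_def enc_int_def split: prod.split)
  then show ?thesis unfolding rat_pos_code
    by (intro polytime_conj polytime_Not polytime_eq_0 polytime_rat_num assms)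
qed

lemma rat_less_code:
  assumes "0 < r" "0 < s"
  shows "r < s \<longleftrightarrow> rat_num r * rat_den s < rat_num s * rat_den r"
proof -
  obtain p q where pq: "quotient_of r = (p, q)" by fastforce
  obtain p' q' where pq': "quotient_of s = (p', q')" by fastforce
  have r: "r = of_int p / of_int q" "q > 0" "p > 0"
    using quotient_of_div[OF pq] quotient_of_denom_pos[OF pq] assms(1) by (auto simp: zero_less_divide_iff)
  have s: "s = of_int p' / of_int q'" "q' > 0" "p' > 0"
    using quotient_of_div[OF pq'] quotient_of_denom_pos[OF pq'] assms(2) by (auto simp: zero_less_divide_iff)
  have "r < s \<longleftrightarrow> (of_int (p * q') :: rat) < of_int (p' * q)"
    unfolding r(1) s(1) using r(2) s(2) by (simp add: divide_less_eq less_divide_eq field_simps)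
  also have "\<dots> \<longleftrightarrow> p * q' < p' * q" by (simp only: of_int_less_iff)
  also have "\<dots> \<longleftrightarrow> nat (p * q') < nat (p' * q)"
    using r s by (simp add: nat_less_eq_zless)
  finally show ?thesis
    using r(2,3) s(2,3) by (simp add: rat_num_def rat_den_def pq pq' nat_mult_distrib)
qed

lemma polytime_rat_of_nat:
  assumes "polytime ea enc_nat f"
  shows "polytime ea enc_rat (\<lambda>a. of_nat (f a))"
proof -
  have q: "quotient_of (of_nat n) = (int n, 1)" for n
    using quotient_of_int[of "int n"] by simp
  have "polytime ea enc_int (\<lambda>a. int (f a))"
    by (rule polytime_Node[OF polytime_const[of _ enc_bool False] assms]) (simp add: enc_int_def)
  then show ?thesis
    by (rule polytime_Node[OF _ polytime_const[of _ enc_int 1]]) (simp add: enc_rat_def q)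
qed

section \<open>The algorithms\<close>

text \<open>An orientation is a list of pairs (tail, head). A search state \<open>(K, T, R)\<close> consists of the
  reached vertices, the edges through which they were reached, latest first and directed away from
  the start, and the remaining edges. With \<open>und\<close> edges may be traversed backwards.\<close>

type_synonym 'v search_state = "'v list \<times> ('v \<times> 'v) list \<times> ('v \<times> 'v) list"

definition scan_edge :: "bool \<Rightarrow> 'v search_state \<Rightarrow> 'v \<times> 'v \<Rightarrow> 'v search_state" where
  "scan_edge und st e =
     (if fst e \<in> set (fst st) \<and> snd e \<notin> set (fst st)
      then (snd e # fst st, e # fst (snd st), snd (snd st))
      else if und \<and> snd e \<in> set (fst st) \<and> fst e \<notin> set (fst st)
      then (fst e # fst st, (snd e, fst e) # fst (snd st), snd (snd st))
      else (fst st, fst (snd st), e # snd (snd st)))"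

definition scan :: "bool \<Rightarrow> 'v search_state \<Rightarrow> 'v search_state" where
  "scan und st = foldl (scan_edge und) (fst st, fst (snd st), []) (snd (snd st))"

text \<open>The list under the fold is only a clock. A pass moves at least one edge out of the
  remainder unless no edge crosses any more, so \<open>length L\<close> passes reach
  closure.\<close>

definition search :: "bool \<Rightarrow> 'v \<Rightarrow> ('v \<times> 'v) list \<Rightarrow> 'v search_state" where
  "search und s L = foldl (\<lambda>st _. scan und st) ([s], [], L) L"

text \<open>The first component is the current end of the path still to be reversed: the edge
  entering it is flipped and its tail becomes the new end, while all other edges are copied.\<close>

definition redirect_edge :: "'v \<times> ('v \<times> 'v) list \<Rightarrow> 'v \<times> 'v \<Rightarrow> 'v \<times> ('v \<times> 'v) list" where
  "redirect_edge st e =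
     (if snd e = fst st then (fst e, (snd e, fst e) # snd st) else (fst st, e # snd st))"

text \<open>Since \<open>T\<close> lists the latest edges first, one pass reverses the whole path of \<open>T\<close> that ends in \<open>w\<close>.\<close>

definition redirect :: "'v \<Rightarrow> ('v \<times> 'v) list \<Rightarrow> ('v \<times> 'v) list \<Rightarrow> ('v \<times> 'v) list" where
  "redirect w T R = snd (foldl redirect_edge (w, R) T)"

text \<open>The root \<open>r\<close> gets an additional virtual entering edge.\<close>

definition load :: "'v \<Rightarrow> ('v \<times> 'v) list \<Rightarrow> 'v \<Rightarrow> nat" where
  "load r D v = count_list (r # map snd D) v"

text \<open>A target lists vertices with the number of splits requested there. The load also accounts for
  the main copy of a vertex, hence the strict inequality.\<close>

definition met :: "'v \<Rightarrow> ('v \<times> nat) list \<Rightarrow> ('v \<times> 'v) list \<Rightarrow> bool" where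
  "met r t D = list_all (\<lambda>p. snd p < load r D (fst p)) t"

definition rooted :: "'v \<Rightarrow> ('v \<times> nat) list \<Rightarrow> ('v \<times> 'v) list \<Rightarrow> bool" where
  "rooted r t D = list_all (\<lambda>p. fst p \<in> set (fst (search False r D))) t"

text \<open>A unit is taken only from a vertex whose load exceeds its request and its main copy
  together, so no deficit arises there. All such vertices are tried because a reversal may cut some
  vertex off from the root.\<close>

definition exchanges :: "'v \<Rightarrow> ('v \<times> nat) list \<Rightarrow> ('v \<times> 'v) list \<Rightarrow> 'v \<Rightarrow> ('v \<times> 'v) list list" where
  "exchanges r t D u =
     (let st = search False u D in
      filter (rooted r t)
        (map (\<lambda>p. redirect (fst p) (fst (snd st)) (snd (snd st)))
          (filter (\<lambda>p. fst p \<in> set (fst st) \<and> Suc (snd p) < load r D (fst p)) t)))"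

text \<open>\<open>D\<close> is returned unchanged when all requests are met, but also when no
  exchange exists. For a rooted orientation with an unmet request the latter happens only if the
  target violates some bound.\<close>

definition improve :: "'v \<Rightarrow> ('v \<times> nat) list \<Rightarrow> ('v \<times> 'v) list \<Rightarrow> ('v \<times> 'v) list" where
  "improve r t D =
     (case filter (\<lambda>p. load r D (fst p) \<le> snd p) t of [] \<Rightarrow> D
      | p # _ \<Rightarrow> (case exchanges r t D (fst p) of [] \<Rightarrow> D | D' # _ \<Rightarrow> D'))"

definition initial :: "'v \<Rightarrow> ('v \<times> 'v) list \<Rightarrow> ('v \<times> 'v) list" where
  "initial r L = (let st = search True r L in fst (snd st) @ snd (snd st))"

text \<open>Again \<open>L\<close> is a clock: each round removes a unit of deficit, and a target
  within the bounds starts with a deficit of at most the number of edges.\<close>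

definition solve :: "'v \<Rightarrow> ('v \<times> 'v) list \<Rightarrow> ('v \<times> nat) list \<Rightarrow> ('v \<times> 'v) list" where
  "solve r L t = foldl (\<lambda>D _. improve r t D) (initial r L) L"

definition bump :: "'v \<Rightarrow> ('v \<times> nat) list \<Rightarrow> ('v \<times> nat) list" where
  "bump u t = map (\<lambda>p. (fst p, if fst p = u then Suc (snd p) else snd p)) t"

text \<open>The comparison with the result of \<open>solve\<close> is a membership test for the
  polymatroid, made precise in \<open>met_solve_iff\<close>.\<close>

definition try_bump :: "'v \<Rightarrow> ('v \<times> 'v) list \<Rightarrow> 'v \<Rightarrow> ('v \<times> nat) list \<Rightarrow> ('v \<times> nat) list" where
  "try_bump r L u t = (if met r (bump u t) (solve r L (bump u t)) then bump u t else t)"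

definition saturate :: "'v \<Rightarrow> ('v \<times> 'v) list \<Rightarrow> ('v \<times> nat) list \<Rightarrow> 'v \<Rightarrow> ('v \<times> nat) list" where
  "saturate r L t u = foldl (\<lambda>t _. try_bump r L u t) t L"

definition rat_less :: "rat \<Rightarrow> rat \<Rightarrow> bool" where
  "rat_less r s \<longleftrightarrow> rat_num r * rat_den s < rat_num s * rat_den r"

text \<open>Two filters replace a recursive insertion, so that the running time follows from the
  closure properties. On a descending list the larger or equal entries form a prefix.\<close>

definition insert_desc :: "('v \<times> rat) list \<Rightarrow> 'v \<times> rat \<Rightarrow> ('v \<times> rat) list" where
  "insert_desc l e = filter (\<lambda>f. \<not> rat_less (snd f) (snd e)) l @ e # filter (\<lambda>f. rat_less (snd f) (snd e)) l"

definition sort_desc :: "('v \<times> rat) list \<Rightarrow> ('v \<times> rat) list" where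
  "sort_desc l = foldl insert_desc [] l"

text \<open>Vertices with a coefficient of at most 0 are dropped and keep the value 0, which is
  optimal for them because all points are nonnegative.\<close>

definition greedy :: "'v \<Rightarrow> ('v \<times> 'v) list \<Rightarrow> ('v \<times> rat) list \<Rightarrow> ('v \<times> nat) list" where
  "greedy r L c = foldl (saturate r L) (map (\<lambda>p. (fst p, 0)) c)
     (map fst (sort_desc (filter (\<lambda>p. 0 < snd p) c)))"

definition optimize :: "graph_code \<times> rat list \<Rightarrow> rat list" where
  "optimize i = map (\<lambda>p. of_nat (snd p)) (greedy 0 (snd (fst i)) (List.enumerate 0 (snd i)))"

text \<open>Positions in the first list are the vertices of \<open>H\<close>, the entries their
  images. The \<open>list_all\<close> is a lookup of the request for the head. While copies are
  missing, the edge is rehung to a fresh vertex named by the current length; afterwards it joins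
  main copies, whose positions equal their own numbers.\<close>

definition attach_edge ::
  "(nat \<times> nat) list \<Rightarrow> nat list \<times> (nat \<times> nat) list \<Rightarrow> nat \<times> nat \<Rightarrow> nat list \<times> (nat \<times> nat) list" where
  "attach_edge t st e =
     (if list_all (\<lambda>p. fst p = snd e \<longrightarrow> snd p < count_list (fst st) (snd e)) t
      then (fst st, e # snd st)
      else (fst st @ [snd e], (fst e, length (fst st)) # snd st))"

definition attach :: "(nat \<times> nat) list \<Rightarrow> nat search_state \<Rightarrow> nat list \<times> (nat \<times> nat) list" where
  "attach t st = foldl (attach_edge t) (map fst t, fst (snd st)) (snd (snd st))"

definition split_graph :: "graph_code \<times> nat list \<Rightarrow> graph_code \<times> nat list" where
  "split_graph i =
     (let t = List.enumerate 0 (snd i); st = attach t (search False 0 (solve 0 (snd (fst i)) t))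
      in ((length (fst st), snd st), fst st))"

subsection \<open>Running times\<close>

abbreviation enc_edges :: "(nat \<times> nat) list \<Rightarrow> tree" where
  "enc_edges \<equiv> enc_list (enc_pair enc_nat enc_nat)"

abbreviation enc_state :: "nat search_state \<Rightarrow> tree" where
  "enc_state \<equiv> enc_pair (enc_list enc_nat) (enc_pair enc_edges enc_edges)"

lemmas polytime_basic =
  polytime_proj polytime_If polytime_Not polytime_conj polytime_disj
  polytime_Pair polytime_Cons polytime_append polytime_is_Nil polytime_Suc polytime_less polytime_le
  polytime_nat_eq polytime_nat_mem polytime_count_list polytime_mult polytime_map[rotated]
  polytime_filter[rotated] polytime_list_all[rotated] polytime_case_list polytime_const

text \<open>Steps that add at most a constant make the total growth linear in the number of rounds.
  The invariant, such as a fixed list length, is what makes that constant independent of the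
  state.\<close>

lemma foldl_measure_le:
  fixes sz :: "'s \<Rightarrow> nat"
  assumes "I s" "\<And>s x. I s \<Longrightarrow> I (f s x)" "\<And>s x. I s \<Longrightarrow> x \<in> set xs \<Longrightarrow> sz (f s x) \<le> sz s + c"
  shows "sz (foldl f s xs) \<le> sz s + length xs * c"
proof -
  have "sz (foldl f s ys) \<le> sz s + length ys * c \<and> I (foldl f s ys)" if "set ys \<subseteq> set xs" for ys
    using that
  proof (induction ys rule: rev_induct)
    case (snoc y ys)
    then have "sz (foldl f s ys) \<le> sz s + length ys * c" "I (foldl f s ys)" "y \<in> set xs" by auto
    then show ?case using assms(3)[of "foldl f s ys" y] assms(2) by auto
  qed (use assms(1) in auto)
  then show ?thesis by blast
qed

lemma polytime_scan_edge:
  "polytime ea enc_state f \<Longrightarrow> polytime ea (enc_pair enc_nat enc_nat) g \<Longrightarrow>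
    polytime ea enc_state (\<lambda>a. scan_edge und (f a) (g a))"
  unfolding scan_edge_def by (rule polytime_basic | assumption)+

text \<open>The weights pay for a move: an edge leaving the remainder frees three times its size, of
  which two parts pay for its entry in the tree and one for the newly reached vertex.\<close>

definition state_size :: "nat search_state \<Rightarrow> nat" where
  "state_size st = size (enc_list enc_nat (fst st)) + 2 * size (enc_edges (fst (snd st)))
     + 3 * size (enc_edges (snd (snd st)))"

lemma size_enc_state_le: "size (enc_state st) \<le> state_size st + 2"
  by (simp add: state_size_def size_enc_pair)

lemma state_size_scan_edges:
  "state_size (foldl (scan_edge und) st xs) \<le> state_size st + 3 * size (enc_edges xs)"
proof (induction xs arbitrary: st)
  case (Cons x xs)
  have "state_size (scan_edge und st x) \<le> state_size st + 3 * (size (enc_pair enc_nat enc_nat x) + 1)"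
    by (auto simp: scan_edge_def state_size_def size_enc_pair)
  then show ?case using Cons[of "scan_edge und st x"] by simp
qed simp

lemma polytime_scan:
  assumes "polytime ea enc_state f"
  shows "polytime ea enc_state (\<lambda>a. scan und (f a))"
proof -
  have "polytime enc_state enc_state (\<lambda>st. scan und st)"
    unfolding scan_def
  proof (rule polytime_foldl[where H = "\<lambda>n. 3 * n + 2" and ex = "enc_pair enc_nat enc_nat"])
    show "size (enc_state (foldl (scan_edge und) (fst st, fst (snd st), []) xs))
        \<le> 3 * (size (enc_state st) + size (enc_edges xs)) + 2" for st xs
      using state_size_scan_edges[of und "(fst st, fst (snd st), [])" xs]
        size_enc_state_le[of "foldl (scan_edge und) (fst st, fst (snd st), []) xs"]
      by (simp add: state_size_def size_enc_pair)
  qed ((rule polytime_scan_edge polytime_basic)+, intro poly_bounded_intros)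
  from polytime_comp[OF this assms] show ?thesis .
qed

lemma state_size_scan: "state_size (scan und st) \<le> state_size st"
  using state_size_scan_edges[of und "(fst st, fst (snd st), [])" "snd (snd st)"]
  by (simp add: scan_def state_size_def)

lemma polytime_search:
  assumes "polytime ea enc_nat f" "polytime ea enc_edges g"
  shows "polytime ea enc_state (\<lambda>a. search und (f a) (g a))"
proof -
  let ?e = "enc_pair enc_nat enc_edges"
  have "polytime ?e enc_state (\<lambda>p. search und (fst p) (snd p))"
    unfolding search_def
  proof (rule polytime_foldl[where H = "\<lambda>n. 3 * n + 3" and ex = "enc_pair enc_nat enc_nat"])
    fix p and xs :: "(nat \<times> nat) list"
    have "state_size (foldl (\<lambda>st _. scan und st) ([fst p], [], snd p) xs)
        \<le> state_size ([fst p], [], snd p) + length xs * 0"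
      by (rule foldl_measure_le[where I = "\<lambda>_. True"]) (auto simp: state_size_scan)
    then show "size (enc_state (foldl (\<lambda>st _. scan und st) ([fst p], [], snd p) xs))
        \<le> 3 * (size (?e p) + size (enc_edges xs)) + 3"
      using size_enc_state_le[of "foldl (\<lambda>st _. scan und st) ([fst p], [], snd p) xs"]
      by (simp add: state_size_def size_enc_pair)
  qed ((rule polytime_scan polytime_basic)+, intro poly_bounded_intros)
  from polytime_comp2[OF this assms] show ?thesis .
qed

lemma size_search:
  "size (enc_edges (fst (snd (search und s L)))) + size (enc_edges (snd (snd (search und s L))))
     = size (enc_edges L)"
proof -
  let ?s = "\<lambda>st. size (enc_edges (fst (snd st))) + size (enc_edges (snd (snd st)))"
  have *: "?s (foldl (scan_edge und) st xs) = ?s st + size (enc_edges xs)" for st xs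
  proof (induction xs arbitrary: st)
    case (Cons x xs)
    show ?case using Cons[of "scan_edge und st x"] by (auto simp: scan_edge_def size_enc_pair)
  qed simp
  have "?s (scan und st) = ?s st" for st
    unfolding scan_def * by simp
  then have "?s (foldl (\<lambda>st _. scan und st) st xs) = ?s st" for st and xs :: "(nat \<times> nat) list"
    by (induction xs arbitrary: st) auto
  then show ?thesis unfolding search_def by simp
qed

lemma size_redirect_edges:
  "size (enc_edges (snd (foldl redirect_edge st xs))) = size (enc_edges (snd st)) + size (enc_edges xs)"
proof (induction xs arbitrary: st)
  case (Cons x xs)
  show ?case using Cons[of "redirect_edge st x"] by (auto simp: redirect_edge_def size_enc_pair)
qed simp

lemma size_redirect: "size (enc_edges (redirect w T R)) = size (enc_edges T) + size (enc_edges R)"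
  unfolding redirect_def size_redirect_edges by simp

lemma polytime_redirect:
  assumes "polytime ea enc_nat f" "polytime ea enc_edges g" "polytime ea enc_edges h"
  shows "polytime ea enc_edges (\<lambda>a. redirect (f a) (g a) (h a))"
proof -
  let ?p = "enc_pair enc_nat enc_nat" and ?e = "enc_pair (enc_pair enc_nat enc_edges) enc_edges"
  let ?g = "enc_pair enc_nat enc_edges"
  have e: "polytime (enc_pair (enc_pair ?e ?p) ?g) ?g (\<lambda>p. redirect_edge (snd p) (snd (fst p)))"
    unfolding redirect_edge_def by (rule polytime_basic)+
  have "polytime ?e enc_edges (\<lambda>q. redirect (fst (fst q)) (snd (fst q)) (snd q))"
    unfolding redirect_def
  proof (rule polytime_snd, rule polytime_foldl[where H = "\<lambda>n. 2 * n + 2" and ex = ?p])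
    fix q :: "(nat \<times> (nat \<times> nat) list) \<times> (nat \<times> nat) list" and xs :: "(nat \<times> nat) list"
    have fst_le: "size (enc_nat (fst (foldl redirect_edge st xs))) \<le> size (enc_nat (fst st)) + size (enc_edges xs)" for st
    proof (induction xs arbitrary: st)
      case (Cons x xs)
      show ?case using Cons[of "redirect_edge st x"] by (auto simp: redirect_edge_def size_enc_pair)
    qed simp
    let ?r = "foldl redirect_edge (fst (fst q), snd q) xs"
    have "size (enc_nat (fst ?r)) \<le> size (enc_nat (fst (fst q))) + size (enc_edges xs)"
      using fst_le[of "(fst (fst q), snd q)"] by simp
    moreover have "size (enc_edges (snd ?r)) = size (enc_edges (snd q)) + size (enc_edges xs)"
      using size_redirect_edges[of "(fst (fst q), snd q)" xs] by simp
    moreover have "a' \<le> a + x \<Longrightarrow> s' = r + x \<Longrightarrow> a' + s' + 1 \<le> 2 * (a + t + 1 + r + 1 + x) + 2"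
      for a a' x s' r t :: nat
      by simp
    ultimately show "size (?g ?r) \<le> 2 * (size (?e q) + size (enc_edges xs)) + 2"
      unfolding size_enc_pair by blast
    show "polytime (enc_pair (enc_pair ?e ?p) ?g) ?g (\<lambda>p. redirect_edge (snd p) (snd (fst p)))"
      by (rule e)
  qed ((rule polytime_basic)+, intro poly_bounded_intros)
  from polytime_comp[OF this polytime_Pair[OF polytime_Pair[OF assms(1,2)] assms(3)]]
  show ?thesis by simp
qed

abbreviation enc_target :: "(nat \<times> nat) list \<Rightarrow> tree" where
  "enc_target \<equiv> enc_edges"

lemma polytime_load:
  "polytime ea enc_nat f \<Longrightarrow> polytime ea enc_edges g \<Longrightarrow> polytime ea enc_nat h \<Longrightarrow>
    polytime ea enc_nat (\<lambda>a. load (f a) (g a) (h a))"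
  unfolding load_def by (rule polytime_basic | assumption)+

lemma polytime_met_base:
  "polytime (enc_pair enc_nat (enc_pair enc_target enc_edges)) enc_bool
    (\<lambda>p. met (fst p) (fst (snd p)) (snd (snd p)))"
  unfolding met_def by (rule polytime_load polytime_basic)+

lemma polytime_comp3:
  assumes "polytime (enc_pair eb (enc_pair ec ed)) ee (\<lambda>p. h (fst p) (fst (snd p)) (snd (snd p)))"
    and "polytime ea eb f" "polytime ea ec g" "polytime ea ed k"
  shows "polytime ea ee (\<lambda>a. h (f a) (g a) (k a))"
  using polytime_comp[OF assms(1) polytime_Pair[OF assms(2) polytime_Pair[OF assms(3,4)]]] by simp

lemmas polytime_met = polytime_comp3[OF polytime_met_base]

lemma polytime_rooted_base:
  "polytime (enc_pair enc_nat (enc_pair enc_target enc_edges)) enc_bool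
    (\<lambda>p. rooted (fst p) (fst (snd p)) (snd (snd p)))"
  unfolding rooted_def by (rule polytime_search polytime_basic)+

lemmas polytime_rooted = polytime_comp3[OF polytime_rooted_base]

lemma polytime_improve_base:
  "polytime (enc_pair enc_nat (enc_pair enc_target enc_edges)) enc_edges
    (\<lambda>p. improve (fst p) (fst (snd p)) (snd (snd p)))"
  unfolding improve_def exchanges_def Let_def
  by (rule polytime_load polytime_search polytime_rooted polytime_redirect polytime_basic)+

lemmas polytime_improve = polytime_comp3[OF polytime_improve_base]

lemma size_exchanges: "D' \<in> set (exchanges r t D u) \<Longrightarrow> size (enc_edges D') = size (enc_edges D)"
  by (auto simp: exchanges_def Let_def size_redirect size_search)

text \<open>Edges are only permuted and flipped, so the size of the code is preserved exactly and
  does not build up over the rounds of \<open>solve\<close>.\<close>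

lemma size_improve: "size (enc_edges (improve r t D)) = size (enc_edges D)"
proof -
  have "size (enc_edges D') = size (enc_edges D)" if "exchanges r t D u = D' # Ds" for u D' Ds
    using that by (intro size_exchanges[of D' r t D u]) simp
  then show ?thesis by (simp add: improve_def split: list.split)
qed

lemma size_initial: "size (enc_edges (initial r L)) = size (enc_edges L)"
  using size_search[of True r L] by (simp add: initial_def Let_def size_enc_list)

lemma polytime_initial:
  "polytime ea enc_nat f \<Longrightarrow> polytime ea enc_edges g \<Longrightarrow> polytime ea enc_edges (\<lambda>a. initial (f a) (g a))"
  unfolding initial_def Let_def by (rule polytime_search polytime_basic | assumption)+

lemma polytime_solve_base:
  "polytime (enc_pair enc_nat (enc_pair enc_edges enc_target)) enc_edges
    (\<lambda>p. solve (fst p) (fst (snd p)) (snd (snd p)))"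
  unfolding solve_def
proof (rule polytime_foldl[where H = "\<lambda>n. n" and ex = "enc_pair enc_nat enc_nat"])
  fix p :: "nat \<times> (nat \<times> nat) list \<times> (nat \<times> nat) list" and xs :: "(nat \<times> nat) list"
  have "size (enc_edges (foldl (\<lambda>D _. improve (fst p) (snd (snd p)) D) D xs)) = size (enc_edges D)"
    for D and xs :: "(nat \<times> nat) list"
    by (induction xs arbitrary: D) (auto simp: size_improve)
  then show "size (enc_edges (foldl (\<lambda>D _. improve (fst p) (snd (snd p)) D)
      (initial (fst p) (fst (snd p))) xs)) \<le>
    size (enc_pair enc_nat (enc_pair enc_edges enc_target) p) + size (enc_edges xs)"
    by (simp add: size_initial size_enc_pair)
qed ((rule polytime_improve polytime_initial polytime_basic)+, intro poly_bounded_intros)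

lemmas polytime_solve = polytime_comp3[OF polytime_solve_base]

lemma polytime_bump:
  assumes "polytime ea enc_nat f" "polytime ea enc_target g"
  shows "polytime ea enc_target (\<lambda>a. bump (f a) (g a))"
proof -
  have "polytime (enc_pair enc_nat enc_target) enc_target (\<lambda>p. bump (fst p) (snd p))"
    unfolding bump_def by (rule polytime_basic)+
  from polytime_comp2[OF this assms] show ?thesis .
qed

text \<open>The worst case is a new leading bit, whose cell and code of \<open>True\<close> take one
  node each; a carry turns ones into zeros, which shortens the code.\<close>

lemma size_enc_nat_Suc: "size (enc_nat (Suc n)) \<le> size (enc_nat n) + 2"
proof (induction n rule: less_induct)
  case (less n)
  show ?case
  proof (cases "even n")
    case True
    then have "Suc n div 2 = n div 2" by simp
    then show ?thesis
      using enc_nat_pos[of "Suc n"] enc_nat_pos[of n] True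
      by (cases "n = 0") (auto simp: enc_nat_0 enc_bool_def)
  next
    case False
    then have "n div 2 < n" "Suc n div 2 = Suc (n div 2)" "n > 0" by (auto elim: oddE)
    then show ?thesis
      using enc_nat_pos[of "Suc n"] enc_nat_pos[of n] False less[of "n div 2"]
      by (auto simp: enc_bool_def)
  qed
qed

lemma length_bump: "length (bump u t) = length t"
  by (simp add: bump_def)

lemma size_bump: "size (enc_target (bump u t)) \<le> size (enc_target t) + 2 * length t"
proof (induction t)
  case (Cons p t)
  then show ?case using size_enc_nat_Suc[of "snd p"] by (auto simp: bump_def size_enc_pair)
qed (simp add: bump_def)

lemma length_try_bump: "length (try_bump r L u t) = length t"
  by (simp add: try_bump_def length_bump)

lemma size_try_bump: "size (enc_target (try_bump r L u t)) \<le> size (enc_target t) + 2 * length t"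
  using size_bump[of u t] by (simp add: try_bump_def)

lemma polytime_try_bump_base:
  "polytime (enc_pair enc_nat (enc_pair enc_edges (enc_pair enc_nat enc_target))) enc_target
    (\<lambda>p. try_bump (fst p) (fst (snd p)) (fst (snd (snd p))) (snd (snd (snd p))))"
  unfolding try_bump_def by (rule polytime_met polytime_solve polytime_bump polytime_basic)+

lemma polytime_try_bump:
  assumes "polytime ea enc_nat f" "polytime ea enc_edges g" "polytime ea enc_nat h" "polytime ea enc_target k"
  shows "polytime ea enc_target (\<lambda>a. try_bump (f a) (g a) (h a) (k a))"
  using polytime_comp[OF polytime_try_bump_base
      polytime_Pair[OF assms(1) polytime_Pair[OF assms(2) polytime_Pair[OF assms(3,4)]]]] by simp

lemma length_saturate: "length (foldl (\<lambda>t _. try_bump r L u t) t xs) = length t"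
  by (induction xs arbitrary: t) (auto simp: length_try_bump)

lemma size_saturate:
  "size (enc_target (foldl (\<lambda>t _. try_bump r L u t) t xs)) \<le> size (enc_target t) + length xs * (2 * length t)"
proof (rule foldl_measure_le[where I = "\<lambda>s. length s = length t"])
  show "size (enc_target (try_bump r L u s)) \<le> size (enc_target s) + 2 * length t"
    if "length s = length t" for s
    using size_try_bump[of r L u s] that by simp
qed (auto simp: length_try_bump)

lemma polytime_saturate:
  assumes "polytime ea enc_nat f" "polytime ea enc_edges g" "polytime ea enc_target h" "polytime ea enc_nat k"
  shows "polytime ea enc_target (\<lambda>a. saturate (f a) (g a) (h a) (k a))"
proof -
  let ?e = "enc_pair enc_nat (enc_pair enc_edges (enc_pair enc_target enc_nat))"
  have "polytime ?e enc_target
      (\<lambda>p. saturate (fst p) (fst (snd p)) (fst (snd (snd p))) (snd (snd (snd p))))"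
    unfolding saturate_def
  proof (rule polytime_foldl[where H = "\<lambda>n. n + n * (2 * n)" and ex = "enc_pair enc_nat enc_nat"])
    fix p and xs :: "(nat \<times> nat) list"
    let ?n = "size (?e p) + size (enc_edges xs)"
    have "length xs * (2 * length (fst (snd (snd p)))) \<le> ?n * (2 * ?n)"
      using length_le_size_enc_list[of xs "enc_pair enc_nat enc_nat"]
        length_le_size_enc_list[of "fst (snd (snd p))" "enc_pair enc_nat enc_nat"]
      by (intro mult_mono) (auto simp: size_enc_pair)
    moreover have "size (enc_target (fst (snd (snd p)))) \<le> ?n"
      by (simp add: size_enc_pair)
    ultimately show "size (enc_target (foldl (\<lambda>t _. try_bump (fst p) (fst (snd p)) (snd (snd (snd p))) t)
        (fst (snd (snd p))) xs)) \<le> ?n + ?n * (2 * ?n)"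
      using size_saturate[of "fst p" "fst (snd p)" "snd (snd (snd p))" "fst (snd (snd p))" xs] by linarith
  qed ((rule polytime_try_bump polytime_basic)+, intro poly_bounded_intros)
  from polytime_comp[OF this
      polytime_Pair[OF assms(1) polytime_Pair[OF assms(2) polytime_Pair[OF assms(3,4)]]]]
  show ?thesis by simp
qed

section \<open>Running times of sorting, of the greedy algorithm and of the construction of
  \<open>H\<close>\<close>

abbreviation enc_costs :: "(nat \<times> rat) list \<Rightarrow> tree" where
  "enc_costs \<equiv> enc_list (enc_pair enc_nat enc_rat)"

lemma polytime_rat_less:
  "polytime ea enc_rat f \<Longrightarrow> polytime ea enc_rat g \<Longrightarrow> polytime ea enc_bool (\<lambda>a. rat_less (f a) (g a))"
  unfolding rat_less_def by (intro polytime_less polytime_mult polytime_rat_num polytime_rat_den)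

lemma size_insert_desc:
  "size (enc_costs (insert_desc l e)) = size (enc_costs l) + size (enc_pair enc_nat enc_rat e) + 1"
proof -
  have "size (enc_costs (filter (\<lambda>x. \<not> q x) l)) + size (enc_costs (filter q l)) = size (enc_costs l)" for q
    by (induction l) auto
  from this[of "\<lambda>f. rat_less (snd f) (snd e)"] show ?thesis
    by (simp add: insert_desc_def size_enc_list)
qed

lemma size_foldl_insert_desc: "size (enc_costs (foldl insert_desc l xs)) = size (enc_costs l) + size (enc_costs xs)"
  by (induction xs arbitrary: l) (auto simp: size_insert_desc)

lemma polytime_sort_desc:
  assumes "polytime ea enc_costs f"
  shows "polytime ea enc_costs (\<lambda>a. sort_desc (f a))"
proof -
  let ?p = "enc_pair enc_nat enc_rat"
  have i: "polytime (enc_pair (enc_pair enc_costs ?p) enc_costs) enc_costs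
      (\<lambda>p. insert_desc (snd p) (snd (fst p)))"
    unfolding insert_desc_def by (rule polytime_rat_less polytime_basic)+
  have "polytime enc_costs enc_costs (\<lambda>l. sort_desc l)"
    unfolding sort_desc_def
    by (rule polytime_foldl[where H = "\<lambda>n. n" and ex = ?p])
      (auto intro: i polytime_id polytime_const poly_bounded_intros simp: size_foldl_insert_desc)
  from polytime_comp[OF this assms] show ?thesis .
qed

lemma polytime_enumerate:
  assumes "polytime ea (enc_list ex) f"
  shows "polytime ea (enc_list (enc_pair enc_nat ex)) (\<lambda>a. List.enumerate 0 (f a))"
proof -
  let ?f = "\<lambda>st x. (Suc (fst st), (fst st, x) # snd st)"
  let ?e = "enc_list (enc_pair enc_nat ex)"
  have eq: "foldl ?f (n, ys) xs = (n + length xs, rev (List.enumerate n xs) @ ys)" for n ys and xs :: "'b list"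
    by (induction xs arbitrary: n ys) auto
  have "polytime ea ?e (\<lambda>a. rev (snd (foldl ?f (0, []) (f a))))"
  proof (rule polytime_rev, rule polytime_snd, rule polytime_foldl[where H = "\<lambda>n. 2 * n + n * (2 * n + 1 + n + 1) + 1" and ex = ex])
    show "polytime (enc_pair (enc_pair ea ex) (enc_pair enc_nat ?e)) (enc_pair enc_nat ?e)
        (\<lambda>p. (Suc (fst (snd p)), (fst (snd p), snd (fst p)) # snd (snd p)))"
      by (rule polytime_basic)+
    fix a xs
    let ?n = "size (ea a) + size (enc_list ex xs)"
    have len: "length xs \<le> ?n" using length_le_size_enc_list[of xs ex] by simp
    have "size (?e (rev (List.enumerate 0 xs))) \<le> ?n * (2 * ?n + 1 + ?n + 1)"
    proof (rule size_enc_list_le)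
      fix p assume "p \<in> set (rev (List.enumerate 0 xs))"
      then have p: "fst p < length xs" "snd p \<in> set xs"
        by (auto simp: in_set_enumerate_eq intro: nth_mem elim!: subst)
      then have "size (enc_nat (fst p)) \<le> 2 * ?n" using len by (intro size_enc_nat_mono_le) simp
      moreover have "size (ex (snd p)) \<le> ?n" using size_enc_list_mem[OF p(2), of ex] by simp
      ultimately show "size (enc_pair enc_nat ex p) \<le> 2 * ?n + 1 + ?n"
        by (simp add: size_enc_pair)
    qed (use len in simp)
    moreover have "size (enc_nat (length xs)) \<le> 2 * ?n" using len by (rule size_enc_nat_mono_le)
    ultimately show "size (enc_pair enc_nat ?e (foldl ?f (0, []) xs)) \<le> 2 * ?n + ?n * (2 * ?n + 1 + ?n + 1) + 1"
      by (simp add: eq size_enc_pair)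
  qed (intro assms polytime_const poly_bounded_intros)+
  then show ?thesis by (simp add: eq)
qed

lemma polytime_greedy:
  assumes "polytime ea enc_nat f" "polytime ea enc_edges g" "polytime ea enc_costs h"
  shows "polytime ea enc_target (\<lambda>a. greedy (f a) (g a) (h a))"
proof -
  let ?e = "enc_pair enc_nat (enc_pair enc_edges enc_costs)"
  have "polytime ?e enc_target (\<lambda>p. greedy (fst p) (fst (snd p)) (snd (snd p)))"
    unfolding greedy_def
  proof (rule polytime_foldl[where H = "\<lambda>n. n + n * (n * (2 * n))" and ex = enc_nat])
    fix p :: "nat \<times> (nat \<times> nat) list \<times> (nat \<times> rat) list" and xs :: "nat list"
    let ?t = "map (\<lambda>p. (fst p, 0)) (snd (snd p)) :: (nat \<times> nat) list"
    let ?n = "size (?e p) + size (enc_list enc_nat xs)"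
    have "size (enc_target (foldl (saturate (fst p) (fst (snd p))) ?t xs))
        \<le> size (enc_target ?t) + length xs * (length (fst (snd p)) * (2 * length ?t))"
    proof (rule foldl_measure_le[where I = "\<lambda>s. length s = length ?t"])
      show "size (enc_target (saturate (fst p) (fst (snd p)) s x))
          \<le> size (enc_target s) + length (fst (snd p)) * (2 * length ?t)" if "length s = length ?t" for s x
        using size_saturate[of "fst p" "fst (snd p)" x s "fst (snd p)"] that
        by (simp add: saturate_def)
    qed (auto simp: saturate_def length_saturate)
    moreover have "length xs * (length (fst (snd p)) * (2 * length ?t)) \<le> ?n * (?n * (2 * ?n))"
      using length_le_size_enc_list[of xs enc_nat]
        length_le_size_enc_list[of "fst (snd p)" "enc_pair enc_nat enc_nat"]
        length_le_size_enc_list[of "snd (snd p)" "enc_pair enc_nat enc_rat"]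
      by (intro mult_mono) (auto simp: size_enc_pair)
    moreover have "size (enc_target ?t) \<le> size (enc_costs (snd (snd p)))"
      unfolding size_enc_list map_map by (rule sum_list_mono) (auto simp: size_enc_pair enc_nat_0)
    then have "size (enc_target ?t) \<le> ?n" by (simp add: size_enc_pair)
    ultimately show "size (enc_target (foldl (saturate (fst p) (fst (snd p))) ?t xs)) \<le> ?n + ?n * (?n * (2 * ?n))"
      by linarith
  qed ((rule polytime_saturate polytime_sort_desc polytime_rat_pos polytime_basic)+, intro poly_bounded_intros)
  from polytime_comp3[OF this assms] show ?thesis .
qed

lemma polytime_optimize:
  "polytime (enc_pair enc_graph (enc_list enc_rat)) (enc_list enc_rat) optimize"
  unfolding optimize_def enc_graph_def
  by (rule polytime_greedy polytime_enumerate polytime_rat_of_nat polytime_basic)+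

lemma polytime_length: "polytime ea (enc_list ex) f \<Longrightarrow> polytime ea enc_nat (\<lambda>a. length (f a))"
proof -
  assume f: "polytime ea (enc_list ex) f"
  have eq: "foldr (\<lambda>x n. Suc n) xs 0 = length xs" for xs :: "'b list" by (induction xs) auto
  have "polytime ea enc_nat (\<lambda>a. foldr (\<lambda>x n. Suc n) (f a) 0)"
  proof (rule polytime_foldr[where H = "\<lambda>n. 2 * n" and ex = ex])
    show "size (enc_nat (foldr (\<lambda>x n. Suc n) xs 0)) \<le> 2 * (size (ea a) + size (enc_list ex xs))" for a xs
      unfolding eq using length_le_size_enc_list[of xs ex] by (intro size_enc_nat_mono_le) simp
  qed ((rule polytime_basic f)+, intro poly_bounded_intros)
  then show ?thesis unfolding eq .
qed

lemma polytime_attach: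
  assumes "polytime ea enc_target f" "polytime ea enc_state g"
  shows "polytime ea (enc_pair (enc_list enc_nat) enc_edges) (\<lambda>a. attach (f a) (g a))"
proof -
  let ?p = "enc_pair enc_nat enc_nat" and ?e = "enc_pair enc_target enc_state"
    and ?s = "enc_pair (enc_list enc_nat) enc_edges"
  have imp: "(\<lambda>p. fst p = snd e \<longrightarrow> snd p < count_list K (snd e)) =
      (\<lambda>p. \<not> fst p = snd e \<or> snd p < count_list K (snd e))" for e and K :: "nat list"
    by auto
  have step: "polytime (enc_pair (enc_pair ?e ?p) ?s) ?s (\<lambda>p. attach_edge (fst (fst (fst p))) (snd p) (snd (fst p)))"
    unfolding attach_edge_def imp by (rule polytime_length polytime_basic)+
  have "polytime ?e ?s (\<lambda>p. attach (fst p) (snd p))"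
    unfolding attach_def
  proof (rule polytime_foldl[where H = "\<lambda>n. n + n * (2 * n + 2 * (2 * n) + 3)" and ex = ?p])
    fix p xs
    let ?n = "size (?e p) + size (enc_edges xs)"
    let ?st = "(map fst (fst p), fst (snd (snd p)))"
    have "size (?s (foldl (attach_edge (fst p)) ?st xs)) \<le> size (?s ?st) + length xs * (2 * ?n + 2 * (2 * ?n) + 3)"
    proof -
      \<comment> \<open>A fresh vertex is named by the current number of copies, so that number has
        to be bounded before the code of its name can be.\<close>
      have len: "length (fst (foldl (attach_edge (fst p)) st ys)) \<le> length (fst st) + length ys" for st ys
      proof (induction ys arbitrary: st)
        case (Cons y ys)
        have "length (fst (attach_edge (fst p) st y)) \<le> Suc (length (fst st))" by (simp add: attach_edge_def)
        then show ?case using Cons[of "attach_edge (fst p) st y"] by simp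
      qed simp
      have "size (?s (foldl (attach_edge (fst p)) ?st ys)) \<le> size (?s ?st) + length ys * (2 * ?n + 2 * (2 * ?n) + 3)"
        if "set ys \<subseteq> set xs" "length ys \<le> length xs" for ys
        using that
      proof (induction ys rule: rev_induct)
        case (snoc y ys)
        let ?r = "foldl (attach_edge (fst p)) ?st ys"
        have "length (fst ?r) \<le> length (fst p) + length xs" using len[of ?st ys] snoc.prems by simp
        also have "\<dots> \<le> 2 * ?n"
          using length_le_size_enc_list[of xs ?p] length_le_size_enc_list[of "fst p" ?p]
          by (simp add: size_enc_pair)
        finally have l: "size (enc_nat (length (fst ?r))) \<le> 2 * (2 * ?n)" by (rule size_enc_nat_mono_le)
        have "size (?p y) \<le> ?n" using size_enc_list_mem[of y xs ?p] snoc.prems by simp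
        then have y: "size (enc_nat (fst y)) + size (enc_nat (snd y)) + 1 \<le> ?n" by (simp add: size_enc_pair)
        have "size (?s (attach_edge (fst p) ?r y)) \<le> size (?s ?r) + (2 * ?n + 2 * (2 * ?n) + 3)"
          using l y by (auto simp: attach_edge_def size_enc_pair size_enc_list[of _ "_ @ _"] size_enc_list)
        then show ?case using snoc by auto
      qed simp
      then show ?thesis by blast
    qed
    moreover have "length xs * (2 * ?n + 2 * (2 * ?n) + 3) \<le> ?n * (2 * ?n + 2 * (2 * ?n) + 3)"
      using length_le_size_enc_list[of xs ?p] by (intro mult_right_mono) auto
    moreover have "size (enc_list enc_nat (map fst (fst p))) \<le> size (enc_target (fst p))"
      unfolding size_enc_list map_map by (rule sum_list_mono) (auto simp: size_enc_pair)
    then have "size (?s ?st) \<le> ?n" by (simp add: size_enc_pair)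
    ultimately show "size (?s (foldl (attach_edge (fst p)) ?st xs)) \<le> ?n + ?n * (2 * ?n + 2 * (2 * ?n) + 3)"
      by linarith
    show "polytime (enc_pair (enc_pair ?e ?p) ?s) ?s (\<lambda>p. attach_edge (fst (fst (fst p))) (snd p) (snd (fst p)))"
      by (rule step)
  qed ((rule polytime_basic)+, intro poly_bounded_intros)
  from polytime_comp2[OF this assms] show ?thesis .
qed

lemma polytime_split_graph:
  "polytime (enc_pair enc_graph (enc_list enc_nat)) (enc_pair enc_graph (enc_list enc_nat)) split_graph"
  unfolding split_graph_def Let_def enc_graph_def
  by (rule polytime_length polytime_attach polytime_search polytime_solve polytime_enumerate polytime_basic)+

lemma polytime_solvableI:
  assumes "polytime ea eb f" "\<And>a. a \<in> I \<Longrightarrow> R a (f a)"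
  shows "polytime_solvable ea eb I R"
proof -
  obtain P e k where r: "runs P e ea eb f k"
    using assms(1) unfolding polytime_def by blast
  have "poly ([:2, 1:] ^ k) n = (n + 2) ^ k" for n :: nat
    by (simp add: poly_power)
  then have "\<forall>i\<in>I. \<exists>y t. evaluates P [ea i] e (eb y) t \<and> t \<le> poly ([:2, 1:] ^ k) (size (ea i)) \<and> R i y"
    using r assms(2) unfolding runs_def by metis
  then show ?thesis unfolding polytime_solvable_def by blast
qed

section \<open>Connectivity and the rank function\<close>

definition conn :: "('v \<times> 'v) set \<Rightarrow> ('v \<times> 'v) set" where
  "conn r = (r \<union> r\<inverse>)\<^sup>*"

lemma conn_refl: "(x, x) \<in> conn r"
  by (simp add: conn_def)

lemma conn_sym: "(x, y) \<in> conn r \<Longrightarrow> (y, x) \<in> conn r"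
proof -
  have "sym (conn r)" unfolding conn_def by (intro sym_rtrancl) (auto simp: sym_def)
  then show "(x, y) \<in> conn r \<Longrightarrow> (y, x) \<in> conn r" by (rule symD)
qed

lemma conn_trans: "(x, y) \<in> conn r \<Longrightarrow> (y, z) \<in> conn r \<Longrightarrow> (x, z) \<in> conn r"
  unfolding conn_def by (rule rtrancl_trans)

lemma conn_base: "(x, y) \<in> r \<Longrightarrow> (x, y) \<in> conn r"
  unfolding conn_def by auto

lemma conn_mono: "r \<subseteq> s \<Longrightarrow> conn r \<subseteq> conn s"
  unfolding conn_def by (intro rtrancl_mono) auto

lemma conn_subsetI:
  assumes "\<And>x. (x, x) \<in> E" "\<And>x y. (x, y) \<in> E \<Longrightarrow> (y, x) \<in> E"
    "\<And>x y z. (x, y) \<in> E \<Longrightarrow> (y, z) \<in> E \<Longrightarrow> (x, z) \<in> E" "r \<subseteq> E"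
  shows "conn r \<subseteq> E"
proof -
  have "(x, y) \<in> (r \<union> r\<inverse>)\<^sup>* \<Longrightarrow> (x, y) \<in> E" for x y
  proof (induction rule: rtrancl_induct)
    case (step y z)
    then have "(y, z) \<in> E" using assms(2,4) by blast
    with step.IH show ?case by (rule assms(3))
  qed (rule assms(1))
  then show ?thesis unfolding conn_def by auto
qed

lemma conn_subset_conn: "r \<subseteq> conn s \<Longrightarrow> conn r \<subseteq> conn s"
  by (rule conn_subsetI; (assumption | rule conn_refl | erule conn_sym | erule (1) conn_trans))

lemma conn_class_eq: "conn r `` {x} = conn r `` {y} \<longleftrightarrow> (x, y) \<in> conn r"
  using conn_refl[of y r] conn_sym[of _ _ r] conn_trans[of _ _ r] by blast

text \<open>\<open>conn r\<close> is reflexive on the whole type, so a vertex that no pair touches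
  is a class of its own. After deletion of the edges touching S the count is therefore |S| + c(G -
  S), both terms of the rank formula at once.\<close>

definition ncls :: "'v set \<Rightarrow> ('v \<times> 'v) set \<Rightarrow> nat" where
  "ncls V r = card ((\<lambda>v. conn r `` {v}) ` V)"

lemma conn_insert_redundant:
  assumes "(a, b) \<in> conn r"
  shows "conn (insert (a, b) r) = conn r"
proof
  show "conn (insert (a, b) r) \<subseteq> conn r"
    using assms conn_base by (intro conn_subset_conn) fastforce
qed (auto intro!: conn_mono)

lemma conn_insert:
  fixes a b :: 'v and r
  defines "C \<equiv> conn r `` {a} \<union> conn r `` {b}"
  shows "conn (insert (a, b) r) = conn r \<union> C \<times> C"
proof
  have C: "x \<in> C \<Longrightarrow> (x, y) \<in> conn r \<Longrightarrow> y \<in> C" for x y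
    unfolding C_def using conn_trans[of a x r y] conn_trans[of b x r y] by auto
  show "conn (insert (a, b) r) \<subseteq> conn r \<union> C \<times> C"
  proof (rule conn_subsetI)
    show "insert (a, b) r \<subseteq> conn r \<union> C \<times> C"
      unfolding C_def using conn_base conn_refl by fastforce
    show "(x, z) \<in> conn r \<union> C \<times> C" if "(x, y) \<in> conn r \<union> C \<times> C" "(y, z) \<in> conn r \<union> C \<times> C" for x y z
      using that C conn_trans[of x y r z] conn_sym[of x y r] by blast
  qed (auto intro: conn_refl conn_sym)
  let ?c = "conn (insert (a, b) r)"
  have r: "conn r \<subseteq> ?c" by (rule conn_mono) auto
  have ab: "(a, b) \<in> ?c" by (rule conn_base) simp
  have "(a, x) \<in> ?c" if "x \<in> C" for x
    using that r ab conn_trans[of a b] unfolding C_def by blast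
  then have "(x, y) \<in> ?c" if "x \<in> C" "y \<in> C" for x y
    using that conn_sym[of a x] conn_trans[of x a _ y] by blast
  with r show "conn r \<union> C \<times> C \<subseteq> ?c" by auto
qed

lemma ncls_insert:
  assumes "finite V" "a \<in> V" "b \<in> V"
  shows "ncls V r = ncls V (insert (a, b) r) + (if (a, b) \<in> conn r then 0 else 1)"
proof (cases "(a, b) \<in> conn r")
  case True
  then show ?thesis by (simp add: ncls_def conn_insert_redundant)
next
  case False
  define A where "A = conn r `` {a}"
  define B where "B = conn r `` {b}"
  let ?I = "(\<lambda>v. conn r `` {v}) ` V"
  have AB: "A \<noteq> B" "A \<in> ?I" "B \<in> ?I"
    using False assms conn_class_eq[of r a b] by (auto simp: A_def B_def)
  have cls: "conn (insert (a, b) r) `` {v} = (if v \<in> A \<union> B then A \<union> B else conn r `` {v})" for v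
  proof -
    have "conn r `` {v} \<subseteq> A \<union> B" if "v \<in> A \<union> B"
      using that conn_trans[of a v r] conn_trans[of b v r] unfolding A_def B_def by auto
    then show ?thesis unfolding conn_insert A_def B_def by auto
  qed
  have mem: "v \<in> A \<union> B \<longleftrightarrow> conn r `` {v} = A \<or> conn r `` {v} = B" for v
    unfolding A_def B_def conn_class_eq using conn_sym[of v a r] conn_sym[of a v r] conn_sym[of v b r] conn_sym[of b v r] by blast
  have "(\<lambda>v. conn (insert (a, b) r) `` {v}) ` V = insert (A \<union> B) (?I - {A, B})"
  proof
    show "(\<lambda>v. conn (insert (a, b) r) `` {v}) ` V \<subseteq> insert (A \<union> B) (?I - {A, B})"
      using mem by (auto simp: cls)
    have "a \<in> A" by (simp add: A_def conn_refl)
    then have "A \<union> B = conn (insert (a, b) r) `` {a}" by (simp add: cls)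
    then have "A \<union> B \<in> (\<lambda>v. conn (insert (a, b) r) `` {v}) ` V"
      using assms(2) by blast
    moreover have "X \<in> (\<lambda>v. conn (insert (a, b) r) `` {v}) ` V" if X: "X \<in> ?I" "X \<noteq> A" "X \<noteq> B" for X
    proof -
      obtain v where v: "v \<in> V" "X = conn r `` {v}" using X(1) by blast
      then have "v \<notin> A \<union> B" using X(2,3) mem[of v] by blast
      then have "conn (insert (a, b) r) `` {v} = X" using cls[of v] v(2) by simp
      then show ?thesis using v(1) by blast
    qed
    ultimately show "insert (A \<union> B) (?I - {A, B}) \<subseteq> (\<lambda>v. conn (insert (a, b) r) `` {v}) ` V"
      by blast
  qed
  moreover have "A \<union> B \<notin> ?I"
  proof
    assume "A \<union> B \<in> ?I"
    then obtain v where v: "A \<union> B = conn r `` {v}" by auto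
    have "a \<in> conn r `` {v}" "b \<in> conn r `` {v}"
      unfolding v[symmetric] by (simp_all add: A_def B_def conn_refl)
    then show False using False conn_sym[of v a r] conn_trans[of a v r b] by auto
  qed
  moreover have "card (?I - {A, B}) = card ?I - 2" "2 \<le> card ?I"
    using AB assms(1) card_Diff_subset[of "{A, B}" ?I] card_mono[of ?I "{A, B}"] by auto
  ultimately show ?thesis
    using False assms(1) unfolding ncls_def by simp
qed

text \<open>Submodularity of the graphic rank, which is |V| minus the number of classes. An edge
  that merges two classes of the larger relation also merges two classes of the smaller one, so
  adding the edges of \<open>C\<close> one by one lowers the count for \<open>A\<close> at least as
  much.\<close>

lemma ncls_submodular:
  assumes "finite V" "finite C" "C \<subseteq> V \<times> V" "A \<subseteq> B"
  shows "ncls V B + ncls V (A \<union> C) \<le> ncls V A + ncls V (B \<union> C)"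
  using assms(2,3)
proof (induction C)
  case (insert e C)
  obtain a b where e: "e = (a, b)" by fastforce
  have ab: "a \<in> V" "b \<in> V" using insert.prems e by auto
  have "conn (A \<union> C) \<subseteq> conn (B \<union> C)" using assms(4) by (intro conn_mono) auto
  then show ?case
    using insert ncls_insert[OF assms(1) ab, of "A \<union> C"] ncls_insert[OF assms(1) ab, of "B \<union> C"]
    by (auto simp: e split: if_splits)
qed simp

lemma ncls_connected:
  assumes "V \<noteq> {}" "\<And>u v. u \<in> V \<Longrightarrow> v \<in> V \<Longrightarrow> (u, v) \<in> conn r"
  shows "ncls V r = 1"
proof -
  obtain u where u: "u \<in> V" using assms(1) by blast
  have "conn r `` {v} = conn r `` {u}" if "v \<in> V" for v
    unfolding conn_class_eq using assms(2) u that by blast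
  then have "(\<lambda>v. conn r `` {v}) ` V = (\<lambda>v. conn r `` {u}) ` V" by (rule image_cong[OF refl])
  also have "\<dots> = {conn r `` {u}}" using u by (rule image_constant)
  finally show ?thesis by (simp add: ncls_def)
qed

lemma conn_isolated:
  assumes "\<And>x y. (x, y) \<in> r \<Longrightarrow> x \<notin> S \<and> y \<notin> S" "s \<in> S"
  shows "conn r `` {s} = {s}"
proof -
  have "(s, y) \<in> (r \<union> r\<inverse>)\<^sup>* \<Longrightarrow> y = s" for y
    by (induction rule: rtrancl_induct) (use assms in auto)
  then show ?thesis by (auto simp: conn_def)
qed

lemma ncls_isolated:
  assumes "finite V" "S \<subseteq> V" "\<And>x y. (x, y) \<in> r \<Longrightarrow> x \<notin> S \<and> y \<notin> S"
  shows "ncls V r = card S + ncls (V - S) r"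
proof -
  let ?c = "\<lambda>v. conn r `` {v}"
  have s: "?c s = {s}" if "s \<in> S" for s
    using assms(3) that by (rule conn_isolated)
  have "?c v \<noteq> ?c s" if "s \<in> S" "v \<notin> S" for s v
    using s[OF that(1)] that conn_refl[of v r] by auto
  then have "?c ` S \<inter> ?c ` (V - S) = {}" by blast
  moreover have "?c ` V = ?c ` S \<union> ?c ` (V - S)" using assms(2) by auto
  moreover have "finite S" using assms(1,2) finite_subset by blast
  moreover have "card (?c ` S) = card S"
    by (rule card_image) (auto simp: inj_on_def s)
  ultimately show ?thesis
    using assms(1) unfolding ncls_def by (simp add: card_Un_disjoint)
qed

lemma ncls_pos: "finite V \<Longrightarrow> V \<noteq> {} \<Longrightarrow> 0 < ncls V r"
  by (simp add: ncls_def card_gt_0_iff)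

text \<open>The class of an image depends only on the class of the preimage, so an onto map that
  sends edges to connected pairs can only merge classes. The identity gives antitonicity in the
  relation; the homomorphism \<open>\<phi>\<close> gives the comparison of \<open>G\<close> with
  \<open>H\<close>.\<close>

lemma ncls_le_image:
  assumes "finite V" "\<phi> ` V = U" "\<And>x y. (x, y) \<in> r \<Longrightarrow> (\<phi> x, \<phi> y) \<in> conn s"
  shows "ncls U s \<le> ncls V r"
proof -
  have *: "(\<phi> x, \<phi> y) \<in> conn s" if "(x, y) \<in> conn r" for x y
  proof -
    have "conn r \<subseteq> {(x, y). (\<phi> x, \<phi> y) \<in> conn s}"
    proof (rule conn_subsetI)
      show "(x, z) \<in> {(x, y). (\<phi> x, \<phi> y) \<in> conn s}"
        if "(x, y) \<in> {(x, y). (\<phi> x, \<phi> y) \<in> conn s}" "(y, z) \<in> {(x, y). (\<phi> x, \<phi> y) \<in> conn s}" for x y z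
        using that conn_trans[of "\<phi> x" "\<phi> y" s "\<phi> z"] by simp
    qed (use assms(3) in \<open>auto intro: conn_refl dest: conn_sym\<close>)
    then show ?thesis using that by auto
  qed
  have "conn s `` {\<phi> x} = conn s `` (\<phi> ` (conn r `` {x}))" for x
  proof
    show "conn s `` {\<phi> x} \<subseteq> conn s `` \<phi> ` conn r `` {x}" using conn_refl by fastforce
    show "conn s `` \<phi> ` conn r `` {x} \<subseteq> conn s `` {\<phi> x}" using * conn_trans[of "\<phi> x" _ s] by auto
  qed
  then have "(\<lambda>v. conn s `` {v}) ` U = (\<lambda>C. conn s `` (\<phi> ` C)) ` ((\<lambda>v. conn r `` {v}) ` V)"
    unfolding assms(2)[symmetric] image_image by simp
  then show ?thesis
    unfolding ncls_def using assms(1) by (simp add: card_image_le)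
qed

subsection \<open>The polymatroid function\<close>

definition touching :: "'v uprod multiset \<Rightarrow> 'v set \<Rightarrow> nat" where
  "touching M S = size {#e \<in># M. set_uprod e \<inter> S \<noteq> {}#}"

definition avoiding :: "'v uprod multiset \<Rightarrow> 'v set \<Rightarrow> ('v \<times> 'v) set" where
  "avoiding M S = {(u, v). Upair u v \<in># M \<and> u \<notin> S \<and> v \<notin> S}"

text \<open>\<open>split_bound G S\<close> is the corank of the edges touching \<open>S\<close> in the graphic matroid of \<open>G\<close>, that
  is, their rank in the dual matroid; a connected \<open>G\<close> keeps the subtraction from truncating.\<close>

definition split_bound :: "'v mgraph \<Rightarrow> 'v set \<Rightarrow> nat" where
  "split_bound G S = touching (edges G) S + 1 - ncls (verts G) (avoiding (edges G) S)"

lemma avoiding_Un: "avoiding M (S \<union> T) = avoiding M S \<inter> avoiding M T"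
  by (auto simp: avoiding_def)

lemma avoiding_subset: "(\<And>e. e \<in># M \<Longrightarrow> set_uprod e \<subseteq> V) \<Longrightarrow> avoiding M S \<subseteq> V \<times> V"
  by (fastforce simp: avoiding_def)

lemma adj_rel_eq_avoiding: "adj_rel G = avoiding (edges G) {}"
  by (simp add: adj_rel_def avoiding_def)

lemma ncls_antimono: "finite V \<Longrightarrow> r \<subseteq> s \<Longrightarrow> ncls V s \<le> ncls V r"
  by (rule ncls_le_image[of V id]) (auto intro: conn_base)

text \<open>Every edge merges at most two classes, and its reverse pair is redundant. The three uses
  are: the bound does not truncate, it is submodular, and it dominates the loads.\<close>

lemma ncls_le_add_edges:
  assumes V: "finite V" and N: "\<And>e. e \<in># N \<Longrightarrow> set_uprod e \<subseteq> V"
    and s: "s \<subseteq> r \<union> {(u, v). Upair u v \<in># N}"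
  shows "ncls V r \<le> ncls V s + size N"
proof -
  have "ncls V r \<le> ncls V (r \<union> {(u, v). Upair u v \<in># N}) + size N"
    using N
  proof (induction N)
    case (add e N)
    obtain a b where e: "e = Upair a b" by (cases e) auto
    let ?r = "r \<union> {(u, v). Upair u v \<in># N}"
    have ab: "a \<in> V" "b \<in> V" using add.prems[of e] e by auto
    have "r \<union> {(u, v). Upair u v \<in># add_mset e N} = insert (b, a) (insert (a, b) ?r)"
      by (auto simp: e)
    moreover have "(b, a) \<in> conn (insert (a, b) ?r)"
      by (rule conn_sym, rule conn_base) simp
    ultimately have "ncls V (r \<union> {(u, v). Upair u v \<in># add_mset e N}) = ncls V (insert (a, b) ?r)"
      by (simp add: ncls_def conn_insert_redundant)
    then show ?case
      using add ncls_insert[OF V ab, of ?r] by (auto split: if_splits)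
  qed simp
  also have "ncls V (r \<union> {(u, v). Upair u v \<in># N}) \<le> ncls V s"
    using V s by (rule ncls_antimono)
  finally show ?thesis by simp
qed

lemma ncls_adj_rel:
  assumes "graph G"
  shows "ncls (verts G) (avoiding (edges G) {}) = 1"
proof -
  have sub: "(adj_rel G)\<^sup>* \<subseteq> conn (avoiding (edges G) {})"
    unfolding adj_rel_eq_avoiding conn_def by (rule rtrancl_mono) auto
  have "verts G \<noteq> {}" using assms by (auto simp: graph_def)
  then show ?thesis
    by (rule ncls_connected) (use assms sub in \<open>auto simp: graph_def connected_graph_def\<close>)
qed

text \<open>Restoring the touching edges gives back the connected \<open>G\<close> with its single
  class, so there can be at most \<open>touching + 1\<close> classes. This additive form is the one
  used in calculations.\<close>

lemma split_bound_eq: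
  assumes "graph G"
  shows "split_bound G S + ncls (verts G) (avoiding (edges G) S) = touching (edges G) S + 1"
proof -
  have "ncls (verts G) (avoiding (edges G) S) \<le> ncls (verts G) (avoiding (edges G) {}) + touching (edges G) S"
    unfolding touching_def
    by (rule ncls_le_add_edges) (use assms in \<open>auto simp: graph_def avoiding_def\<close>)
  then show ?thesis
    using ncls_adj_rel[OF assms] by (simp add: split_bound_def)
qed

text \<open>The defect consists of the edges between S - T and T - S, which count once for the
  union, not for the intersection, but for both S and T.\<close>

lemma touching_submodular:
  "touching M (S \<union> T) + touching M (S \<inter> T) +
     size {#e \<in># M. set_uprod e \<inter> S \<noteq> {} \<and> set_uprod e \<inter> T \<noteq> {} \<and> set_uprod e \<inter> (S \<inter> T) = {}#}
   = touching M S + touching M T"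
  unfolding touching_def by (induction M) (auto simp: Int_Un_distrib)

text \<open>Submodularity of the graphic rank speaks of the union of the edge sets avoiding S and
  avoiding T. This union misses from the edges avoiding the intersection just those in
  \<open>?N\<close>, which costs at most \<open>size ?N\<close> classes and is paid for by the
  defect in \<open>touching_submodular\<close>.\<close>

lemma submodular_split_bound:
  assumes "graph G"
  shows "submodular (verts G) (split_bound G)"
  unfolding submodular_def
proof (intro allI impI)
  fix S T assume "S \<subseteq> verts G" "T \<subseteq> verts G"
  let ?V = "verts G" and ?M = "edges G"
  let ?a = "avoiding (edges G)"
  have V: "finite ?V" and M: "\<And>e. e \<in># ?M \<Longrightarrow> set_uprod e \<subseteq> ?V"
    using assms by (auto simp: graph_def)
  let ?N = "{#e \<in># ?M. set_uprod e \<inter> S \<noteq> {} \<and> set_uprod e \<inter> T \<noteq> {} \<and> set_uprod e \<inter> (S \<inter> T) = {}#}"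
  have sub: "?a R \<subseteq> ?V \<times> ?V" for R using M by (rule avoiding_subset)
  have "finite (?a T)" using sub[of T] V finite_subset by blast
  then have 1: "ncls ?V (?a S) + ncls ?V ((?a S \<inter> ?a T) \<union> ?a T) \<le> ncls ?V (?a S \<inter> ?a T) + ncls ?V (?a S \<union> ?a T)"
    using ncls_submodular[OF V, of "?a T" "?a S \<inter> ?a T" "?a S"] sub by auto
  have 2: "ncls ?V (?a S \<union> ?a T) \<le> ncls ?V (?a (S \<inter> T)) + size ?N"
  proof -
    show ?thesis
      by (rule ncls_le_add_edges[OF V]) (use M in \<open>auto simp: avoiding_def\<close>)
  qed
  show "split_bound G (S \<union> T) + split_bound G (S \<inter> T) \<le> split_bound G S + split_bound G T"
    using 1 2 split_bound_eq[OF assms, of S] split_bound_eq[OF assms, of T]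
      split_bound_eq[OF assms, of "S \<union> T"] split_bound_eq[OF assms, of "S \<inter> T"]
      touching_submodular[of ?M S T]
    by (simp add: avoiding_Un Un_absorb1 Un_commute Int_commute)
qed

section \<open>Correctness of the search\<close>

abbreviation undirected :: "('v \<times> 'v) list \<Rightarrow> 'v uprod multiset" where
  "undirected L \<equiv> image_mset (\<lambda>e. Upair (fst e) (snd e)) (mset L)"

text \<open>\<open>T\<close> is a tree directed away from \<open>s\<close>, kept in order of growth.
  Removing edges from the front always leaves a smaller tree, and this is what lets one pass over
  \<open>T\<close> follow a path back to \<open>s\<close>.\<close>

inductive grown :: "'v \<Rightarrow> ('v \<times> 'v) list \<Rightarrow> 'v list \<Rightarrow> bool" for s where
  grown_Nil: "grown s [] [s]"
| grown_Cons: "grown s T K \<Longrightarrow> a \<in> set K \<Longrightarrow> b \<notin> set K \<Longrightarrow> grown s ((a, b) # T) (b # K)"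

definition crossing :: "bool \<Rightarrow> 'v list \<Rightarrow> 'v \<times> 'v \<Rightarrow> bool" where
  "crossing und K e \<longleftrightarrow> fst e \<in> set K \<and> snd e \<notin> set K \<or> und \<and> snd e \<in> set K \<and> fst e \<notin> set K"

lemma Upair_swap: "Upair a b = Upair b a"
  by (rule Upair_inject[THEN iffD2]) simp

lemma scan_edge_cases:
  obtains (stay) "\<not> crossing und (fst st) e" "scan_edge und st e = (fst st, fst (snd st), e # snd (snd st))"
  | (reach) a b where "crossing und (fst st) e" "a \<in> set (fst st)" "b \<notin> set (fst st)"
      "Upair a b = Upair (fst e) (snd e)" "\<not> und \<Longrightarrow> (a, b) = e"
      "scan_edge und st e = (b # fst st, (a, b) # fst (snd st), snd (snd st))"
proof (cases "fst e \<in> set (fst st) \<and> snd e \<notin> set (fst st)")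
  case True
  then show thesis by (intro reach[of "fst e" "snd e"]) (auto simp: crossing_def scan_edge_def)
next
  case F: False
  show thesis
  proof (cases "und \<and> snd e \<in> set (fst st) \<and> fst e \<notin> set (fst st)")
    case True
    then show thesis using F by (intro reach[of "snd e" "fst e"]) (auto simp: crossing_def scan_edge_def)
  next
    case False
    then show thesis using F by (intro stay) (auto simp: crossing_def scan_edge_def)
  qed
qed

lemma scan_edges_invariants:
  assumes "grown s (fst (snd st)) (fst st)"
  shows "grown s (fst (snd (foldl (scan_edge und) st xs))) (fst (foldl (scan_edge und) st xs))"
    and "undirected (fst (snd (foldl (scan_edge und) st xs)) @ snd (snd (foldl (scan_edge und) st xs)))
      = undirected (fst (snd st) @ snd (snd st) @ xs)"
    and "\<not> und \<Longrightarrow> mset (fst (snd (foldl (scan_edge und) st xs)) @ snd (snd (foldl (scan_edge und) st xs)))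
      = mset (fst (snd st) @ snd (snd st) @ xs)"
  using assms
proof (induction xs arbitrary: st)
  case (Cons x xs)
  {
    case 1
    have "grown s (fst (snd (scan_edge und st x))) (fst (scan_edge und st x))"
      by (cases rule: scan_edge_cases[of und st x]) (use 1 in \<open>auto intro: grown_Cons\<close>)
    then show ?case using Cons.IH(1) by simp
  next
    case 2
    have "grown s (fst (snd (scan_edge und st x))) (fst (scan_edge und st x))"
      by (cases rule: scan_edge_cases[of und st x]) (use 2 in \<open>auto intro: grown_Cons\<close>)
    moreover have "undirected (fst (snd (scan_edge und st x)) @ snd (snd (scan_edge und st x)) @ xs)
        = undirected (fst (snd st) @ snd (snd st) @ x # xs)"
      by (cases rule: scan_edge_cases[of und st x]) auto
    ultimately show ?case using Cons.IH(2) by simp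
  next
    case 3
    have "grown s (fst (snd (scan_edge und st x))) (fst (scan_edge und st x))"
      by (cases rule: scan_edge_cases[of und st x]) (use 3 in \<open>auto intro: grown_Cons\<close>)
    moreover have "mset (fst (snd (scan_edge und st x)) @ snd (snd (scan_edge und st x)) @ xs)
        = mset (fst (snd st) @ snd (snd st) @ x # xs)"
      by (cases rule: scan_edge_cases[of und st x]) (use 3 in auto)
    ultimately show ?case using Cons.IH(3) 3 by simp
  }
qed auto

lemma scan_edges_no_crossing:
  assumes "\<forall>e\<in>set xs. \<not> crossing und (fst st) e"
  shows "foldl (scan_edge und) st xs = (fst st, fst (snd st), rev xs @ snd (snd st))"
  using assms
proof (induction xs arbitrary: st)
  case (Cons x xs)
  have "scan_edge und st x = (fst st, fst (snd st), x # snd (snd st))"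
    by (cases rule: scan_edge_cases[of und st x]) (use Cons.prems in auto)
  then show ?case using Cons by simp
qed simp

lemma scan_edges_length:
  "length (snd (snd (foldl (scan_edge und) st xs))) \<le> length (snd (snd st)) + length xs"
proof (induction xs arbitrary: st)
  case (Cons x xs)
  have "length (snd (snd (scan_edge und st x))) \<le> Suc (length (snd (snd st)))"
    by (simp add: scan_edge_def)
  then show ?case using Cons[of "scan_edge und st x"] by simp
qed simp

text \<open>Up to the first crossing edge the reached set does not change, so that edge still
  crosses when its turn comes and leaves the remainder.\<close>

lemma scan_edges_crossing:
  assumes "e \<in> set xs" "crossing und (fst st) e"
  shows "length (snd (snd (foldl (scan_edge und) st xs))) < length (snd (snd st)) + length xs"
proof -
  obtain ys x zs where xs: "xs = ys @ x # zs" "crossing und (fst st) x" "\<forall>y\<in>set ys. \<not> crossing und (fst st) y"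
    using split_list_first_prop[of xs "crossing und (fst st)"] assms by blast
  let ?st = "foldl (scan_edge und) st ys"
  have st: "?st = (fst st, fst (snd st), rev ys @ snd (snd st))"
    using xs(3) by (rule scan_edges_no_crossing)
  have "snd (snd (scan_edge und ?st x)) = snd (snd ?st)"
    by (cases rule: scan_edge_cases[of und ?st x]) (use xs(2) st in auto)
  then show ?thesis
    using scan_edges_length[of und "scan_edge und ?st x" zs] st by (simp add: xs(1))
qed

lemma search_invariants:
  shows "grown s (fst (snd (search und s L))) (fst (search und s L))"
    and "undirected (fst (snd (search und s L)) @ snd (snd (search und s L))) = undirected L"
    and "\<not> und \<Longrightarrow> mset (fst (snd (search und s L)) @ snd (snd (search und s L))) = mset L"
    and "\<forall>e\<in>set (snd (snd (search und s L))). \<not> crossing und (fst (search und s L)) e"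
proof -
  define st where "st k = foldl (\<lambda>st _. scan und st) ([s], [], L) (replicate k ())" for k
  have st_Suc: "st (Suc k) = scan und (st k)" for k
  proof -
    have "replicate (Suc k) () = replicate k () @ [()]" by (simp add: replicate_append_same)
    then show ?thesis unfolding st_def by (simp only: foldl_append foldl_Cons foldl_Nil)
  qed
  have "foldl (\<lambda>st _. scan und st) c xs = foldl (\<lambda>st _. scan und st) c (replicate (length xs) ())" for c and xs :: "('a \<times> 'a) list"
    by (induction xs arbitrary: c) auto
  then have search: "search und s L = st (length L)"
    by (simp add: search_def st_def)
  \<comment> \<open>After \<open>k\<close> rounds the search is closed or has used up
    \<open>k\<close> edges. For \<open>k = length L\<close> the second case leaves no edge, so
    closure holds either way.\<close>
  have inv: "grown s (fst (snd (st k))) (fst (st k)) \<and>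
      undirected (fst (snd (st k)) @ snd (snd (st k))) = undirected L \<and>
      (\<not> und \<longrightarrow> mset (fst (snd (st k)) @ snd (snd (st k))) = mset L) \<and>
      ((\<forall>e\<in>set (snd (snd (st k))). \<not> crossing und (fst (st k)) e) \<or> length (snd (snd (st k))) + k \<le> length L)" for k
  proof (induction k)
    case 0
    show ?case by (auto simp: st_def intro: grown_Nil)
  next
    case (Suc k)
    let ?s = "(fst (st k), fst (snd (st k)), [])"
    have g: "grown s (fst (snd ?s)) (fst ?s)" using Suc by simp
    have eq: "st (Suc k) = foldl (scan_edge und) ?s (snd (snd (st k)))"
      by (simp add: st_Suc scan_def)
    have "(\<forall>e\<in>set (snd (snd (st (Suc k)))). \<not> crossing und (fst (st (Suc k))) e) \<or>
        length (snd (snd (st (Suc k)))) + Suc k \<le> length L"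
    proof (cases "\<forall>e\<in>set (snd (snd (st k))). \<not> crossing und (fst (st k)) e")
      case True
      then have "st (Suc k) = (fst (st k), fst (snd (st k)), rev (snd (snd (st k))) @ [])"
        unfolding eq using scan_edges_no_crossing[of "snd (snd (st k))" und ?s] by simp
      then show ?thesis using True by simp
    next
      case False
      then obtain e where "e \<in> set (snd (snd (st k)))" "crossing und (fst (st k)) e" by blast
      then show ?thesis
        using scan_edges_crossing[of e "snd (snd (st k))" und ?s] False Suc unfolding eq by auto
    qed
    then show ?case
      using scan_edges_invariants[OF g, of und "snd (snd (st k))"] Suc unfolding eq by auto
  qed
  show "grown s (fst (snd (search und s L))) (fst (search und s L))"
    and "undirected (fst (snd (search und s L)) @ snd (snd (search und s L))) = undirected L"
    and "\<not> und \<Longrightarrow> mset (fst (snd (search und s L)) @ snd (snd (search und s L))) = mset L"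
    using inv[of "length L"] unfolding search by blast+
  show "\<forall>e\<in>set (snd (snd (search und s L))). \<not> crossing und (fst (search und s L)) e"
    using inv[of "length L"] unfolding search by auto
qed

lemma grown_start: "grown s T K \<Longrightarrow> s \<in> set K"
  by (induction rule: grown.induct) auto

lemma grown_edges: "grown s T K \<Longrightarrow> e \<in> set T \<Longrightarrow> fst e \<in> set K \<and> snd e \<in> set K"
  by (induction rule: grown.induct) auto

lemma grown_reachable: "grown s T K \<Longrightarrow> v \<in> set K \<Longrightarrow> (s, v) \<in> (set T)\<^sup>*"
proof (induction arbitrary: v rule: grown.induct)
  case (grown_Cons T K a b)
  have "(set T)\<^sup>* \<subseteq> (set ((a, b) # T))\<^sup>*" by (rule rtrancl_mono) auto
  moreover have "(s, b) \<in> (set ((a, b) # T))\<^sup>*"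
    using grown_Cons.IH[OF grown_Cons.hyps(2)] calculation by (auto intro: rtrancl_into_rtrancl)
  ultimately show ?case using grown_Cons by auto
qed auto

text \<open>Together with the virtual edge at the start, the tree contributes exactly one unit of
  load to each reached vertex: the unit of its main copy.\<close>

lemma grown_heads: "grown s T K \<Longrightarrow> K = map snd T @ [s] \<and> distinct K"
  by (induction rule: grown.induct) auto

lemma set_search: "set (fst (search False s L)) = (set L)\<^sup>* `` {s}"
proof
  let ?st = "search False s L"
  let ?K = "set (fst ?st)"
  have g: "grown s (fst (snd ?st)) (fst ?st)" by (rule search_invariants)
  have m: "set L = set (fst (snd ?st)) \<union> set (snd (snd ?st))"
    using search_invariants(3)[of False s L] by (metis set_append set_mset_mset)
  have "(set (fst (snd ?st)))\<^sup>* \<subseteq> (set L)\<^sup>*" using m by (intro rtrancl_mono) auto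
  then show "?K \<subseteq> (set L)\<^sup>* `` {s}" using grown_reachable[OF g] by auto
  have closed: "b \<in> ?K" if "(a, b) \<in> set L" "a \<in> ?K" for a b
    using that grown_edges[OF g, of "(a, b)"] m search_invariants(4)[of False s L]
    by (auto simp: crossing_def)
  have "(s, v) \<in> (set L)\<^sup>* \<Longrightarrow> v \<in> ?K" for v
    by (induction rule: rtrancl_induct) (auto intro: closed grown_start[OF g])
  then show "(set L)\<^sup>* `` {s} \<subseteq> ?K" by auto
qed

lemma set_search_undirected: "set (fst (search True s L)) = conn (set L) `` {s}"
proof
  let ?st = "search True s L"
  let ?K = "set (fst ?st)"
  let ?T = "fst (snd ?st)" and ?R = "snd (snd ?st)"
  have g: "grown s ?T (fst ?st)" by (rule search_invariants)
  have m: "undirected (?T @ ?R) = undirected L" by (rule search_invariants)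
  have sub: "(a, b) \<in> set L \<or> (b, a) \<in> set L" if "(a, b) \<in> set (?T @ ?R)" for a b
  proof -
    have "Upair a b \<in># undirected (?T @ ?R)" using that by force
    then have "Upair a b \<in># undirected L" unfolding m .
    then show ?thesis by auto
  qed
  have sub': "(a, b) \<in> set (?T @ ?R) \<or> (b, a) \<in> set (?T @ ?R)" if "(a, b) \<in> set L" for a b
  proof -
    have "Upair a b \<in># undirected L" using that by force
    then have "Upair a b \<in># undirected (?T @ ?R)" unfolding m .
    then show ?thesis by auto
  qed
  have "set ?T \<subseteq> set L \<union> (set L)\<inverse>" using sub by auto
  then have "(set ?T)\<^sup>* \<subseteq> conn (set L)" unfolding conn_def by (rule rtrancl_mono)
  then show "?K \<subseteq> conn (set L) `` {s}" using grown_reachable[OF g] by auto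
  have closed: "a \<in> ?K \<longleftrightarrow> b \<in> ?K" if "(a, b) \<in> set (?T @ ?R)" for a b
    using that grown_edges[OF g, of "(a, b)"] search_invariants(4)[of True s L]
    by (auto simp: crossing_def)
  have "(s, v) \<in> (set L \<union> (set L)\<inverse>)\<^sup>* \<Longrightarrow> v \<in> ?K" for v
  proof (induction rule: rtrancl_induct)
    case (step y z)
    then show ?case using sub' closed by blast
  qed (rule grown_start[OF g])
  then show "conn (set L) `` {s} \<subseteq> ?K" by (auto simp: conn_def)
qed

section \<open>Reversing a path: underlying graph and loads\<close>

lemma undirected_redirect_edges:
  "undirected (snd (foldl redirect_edge st T)) = undirected (T @ snd st)"
proof (induction T arbitrary: st)
  case (Cons e T)
  have "undirected (snd (redirect_edge st e)) = add_mset (Upair (fst e) (snd e)) (undirected (snd st))"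
    by (auto simp: redirect_edge_def)
  then show ?case using Cons[of "redirect_edge st e"] by simp
qed simp

lemma undirected_redirect: "undirected (redirect w T R) = undirected (T @ R)"
  unfolding redirect_def undirected_redirect_edges by simp

lemma count_list_eq_mset: "count_list xs x = count (mset xs) x"
  by (induction xs) auto

lemma load_eq_mset: "load r D v = count (add_mset r (image_mset snd (mset D))) v"
  by (simp add: load_def count_list_eq_mset)

text \<open>Each flip takes one unit from the current end and gives it to the next one; the
  \<open>of_bool\<close> terms record the two ends and telescope along the path.\<close>

lemma load_redirect_edges:
  "load r (snd (foldl redirect_edge st T)) v + of_bool (v = fst st) =
   load r (T @ snd st) v + of_bool (v = fst (foldl redirect_edge st T))"
proof (induction T arbitrary: st)
  case (Cons e T)
  have "load r (T @ snd (redirect_edge st e)) v + of_bool (v = fst st) =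
      load r (e # T @ snd st) v + of_bool (v = fst (redirect_edge st e))"
    by (auto simp: redirect_edge_def load_eq_mset)
  then show ?case using Cons[of "redirect_edge st e"] by simp
qed simp

text \<open>The current end is either the newest vertex, and then its tree edge comes first and
  leads into the older tree, or it already lies there. Once the list is exhausted only
  \<open>s\<close> is left.\<close>

lemma redirect_edges_start:
  "grown s T K \<Longrightarrow> fst st \<in> set K \<Longrightarrow> fst (foldl redirect_edge st T) = s"
proof (induction arbitrary: st rule: grown.induct)
  case (grown_Cons T K a b)
  have "fst (redirect_edge st (a, b)) \<in> set K"
    using grown_Cons by (auto simp: redirect_edge_def)
  then show ?case using grown_Cons.IH[of "redirect_edge st (a, b)"] by simp
qed auto

lemma load_redirect:
  assumes "grown s T K" "w \<in> set K"
  shows "load r (redirect w T R) v + of_bool (v = w) = load r (T @ R) v + of_bool (v = s)"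
  using load_redirect_edges[of r "(w, R)" T v] redirect_edges_start[OF assms(1), of "(w, R)"] assms(2)
  by (simp add: redirect_def)

section \<open>Correctness of the augmentation\<close>

definition spans :: "'v mgraph \<Rightarrow> 'v \<Rightarrow> ('v \<times> 'v) list \<Rightarrow> bool" where
  "spans G r D \<longleftrightarrow> undirected D = edges G \<and> (\<forall>v\<in>verts G. (r, v) \<in> (set D)\<^sup>*)"

lemma orientation_verts:
  assumes "graph G" "undirected D = edges G" "(a, b) \<in> set D"
  shows "a \<in> verts G" "b \<in> verts G"
proof -
  have "Upair a b \<in># undirected D" using assms(3) by force
  then have "set_uprod (Upair a b) \<subseteq> verts G" using assms(1,2) unfolding graph_def by auto
  then show "a \<in> verts G" "b \<in> verts G" by auto
qed

lemma reachable_verts: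
  assumes "graph G" "undirected D = edges G" "u \<in> verts G" "(u, v) \<in> (set D)\<^sup>*"
  shows "v \<in> verts G"
  using assms(4)
proof (induction rule: rtrancl_induct)
  case (step y z)
  then show ?case using orientation_verts(2)[OF assms(1,2)] by simp
qed (rule assms(3))

lemma sum_count_eq_size:
  assumes "finite S"
  shows "(\<Sum>v\<in>S. count (image_mset f M) v) = size {#e \<in># M. f e \<in> S#}"
proof (induction M)
  case (add e M)
  have "(\<Sum>v\<in>S. count (image_mset f (add_mset e M)) v)
      = (\<Sum>v\<in>S. count (image_mset f M) v + (if f e = v then 1 else 0))"
    by (rule sum.cong) auto
  also have "\<dots> = (\<Sum>v\<in>S. count (image_mset f M) v) + (if f e \<in> S then 1 else 0)"
    unfolding sum.distrib sum.delta'[OF assms] by simp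
  finally show ?case using add by simp
qed simp

lemma sum_load:
  assumes "finite S"
  shows "(\<Sum>v\<in>S. load r D v) = size {#e \<in># mset D. snd e \<in> S#} + of_bool (r \<in> S)"
proof -
  have "load r D v = count (image_mset snd (mset D)) v + (if v = r then 1 else 0)" for v
    by (simp add: load_eq_mset)
  then show ?thesis
    using assms by (simp add: sum.distrib sum_count_eq_size)
qed

text \<open>Edges touching S either enter or stay in S, and then count for its load, or leave it.
  All comparisons of loads with the bound rest on this split.\<close>

lemma touching_undirected:
  "touching (undirected D) S = size {#e \<in># mset D. snd e \<in> S#} + size {#e \<in># mset D. fst e \<in> S \<and> snd e \<notin> S#}"
  unfolding touching_def by (induction D) auto

text \<open>To the edges avoiding S add those leaving S and an artificial edge from \<open>r\<close>
  to each vertex of S - {r}. Everything reachable from \<open>r\<close> is then connected, so at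
  most 1 + out(S) + |S - {r}| classes existed before. The out-edges cancel against their share of
  \<open>touching\<close>.\<close>

lemma load_le_split_bound:
  assumes G: "graph G" and D: "spans G r D" and S: "S \<subseteq> verts G"
  shows "(\<Sum>v\<in>S. load r D v) \<le> split_bound G S + card S"
proof -
  let ?V = "verts G"
  have und: "undirected D = edges G" and reach: "\<And>v. v \<in> ?V \<Longrightarrow> (r, v) \<in> (set D)\<^sup>*"
    using D by (auto simp: spans_def)
  have fin: "finite ?V" "finite S" and ne: "?V \<noteq> {}"
    using G S finite_subset by (auto simp: graph_def)
  show ?thesis
  proof (cases "S = {}")
    case False
    have r: "r \<in> ?V"
    proof (rule ccontr)
      assume r: "r \<notin> ?V"
      obtain v where v: "v \<in> ?V" using ne by blast
      have "(r, v) \<in> (set D)\<^sup>*" "r \<noteq> v" using reach[OF v] r v by auto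
      then obtain y where "(r, y) \<in> set D" by (meson converse_rtranclE)
      then show False using orientation_verts[OF G und] r by blast
    qed
    let ?N = "image_mset (\<lambda>e. Upair (fst e) (snd e)) {#e \<in># mset D. fst e \<in> S \<and> snd e \<notin> S#}
        + image_mset (\<lambda>s. Upair r s) (mset_set (S - {r}))"
    let ?a = "avoiding (edges G) S"
    let ?X = "?a \<union> {(u, v). Upair u v \<in># ?N}"
    have "(r, v) \<in> (set D)\<^sup>* \<Longrightarrow> (r, v) \<in> conn ?X" for v
    proof (induction rule: rtrancl_induct)
      case (step y z)
      show ?case
      proof (cases "z \<in> S")
        case True
        then show ?thesis using fin by (cases "z = r") (auto intro: conn_refl conn_base)
      next
        case F: False
        have "(y, z) \<in> ?X"
        proof (cases "y \<in> S")
          case True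
          then have "Upair y z \<in># ?N" using F step.hyps(2) by force
          then show ?thesis by simp
        next
          case False
          have "Upair y z \<in># undirected D" using step.hyps(2) by force
          then show ?thesis using F False unfolding und by (auto simp: avoiding_def)
        qed
        then show ?thesis using step.IH conn_trans[of r y ?X z] conn_base[of y z ?X] by blast
      qed
    qed (rule conn_refl)
    then have r_conn: "(r, v) \<in> conn ?X" if "v \<in> ?V" for v using reach that by blast
    have "ncls ?V ?X = 1"
    proof (rule ncls_connected[OF ne])
      fix a b assume "a \<in> ?V" "b \<in> ?V"
      then show "(a, b) \<in> conn ?X" using conn_trans[OF conn_sym[OF r_conn] r_conn] by simp
    qed
    moreover have "ncls ?V ?a \<le> ncls ?V ?X + size ?N"
    proof (rule ncls_le_add_edges[OF fin(1)])
      show "set_uprod e \<subseteq> ?V" if "e \<in># ?N" for e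
        using that S r fin orientation_verts[OF G und] by auto
    qed simp
    moreover have "card (S - {r}) + of_bool (r \<in> S) = card S"
      using fin card_Suc_Diff1[of S r] by (cases "r \<in> S") auto
    ultimately show ?thesis
      using split_bound_eq[OF G, of S] touching_undirected[of D S] sum_load[OF fin(2), of r D]
      unfolding und by simp
  qed simp
qed

text \<open>No edge leaves S, so all touching edges count for its load, and the nonempty rest of the
  graph has at least one class. If S contains \<open>r\<close>, the load exceeds the bound by one;
  this excess exposes an orientation that is no longer rooted.\<close>

lemma split_bound_le_load:
  assumes G: "graph G" and und: "undirected D = edges G" and S: "S \<subset> verts G"
    and closed: "\<And>a b. (a, b) \<in> set D \<Longrightarrow> a \<in> S \<Longrightarrow> b \<in> S"
  shows "split_bound G S + card S + of_bool (r \<in> S) \<le> (\<Sum>v\<in>S. load r D v)"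
proof -
  have fin: "finite (verts G)" "finite S"
    using G S finite_subset[of S "verts G"] by (auto simp: graph_def)
  have "ncls (verts G) (avoiding (edges G) S) = card S + ncls (verts G - S) (avoiding (edges G) S)"
    using S by (intro ncls_isolated fin) (auto simp: avoiding_def)
  moreover have "0 < ncls (verts G - S) (avoiding (edges G) S)"
    using fin S by (intro ncls_pos) auto
  moreover have "{#e \<in># mset D. fst e \<in> S \<and> snd e \<notin> S#} = {#}"
    using closed by (auto simp: filter_mset_eq_conv)
  then have "size {#e \<in># mset D. fst e \<in> S \<and> snd e \<notin> S#} = 0" by (simp only: size_empty)
  ultimately show ?thesis
    using split_bound_eq[OF G, of S] touching_undirected[of D S] sum_load[OF fin(2), of r D]
    unfolding und by linarith
qed

text \<open>f(V) is the cyclomatic number |E| + 1 - |V|. Hence V is tight for the loads of any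
  orientation, which starts the intersection of tight sets, and f(V) is at most |E|, which justifies
  the edge list as a clock.\<close>

lemma split_bound_verts:
  assumes G: "graph G"
  shows "split_bound G (verts G) + card (verts G) = size (edges G) + 1"
proof -
  have fin: "finite (verts G)" using G by (simp add: graph_def)
  have t: "touching (edges G) (verts G) = size (edges G)"
  proof -
    have "{#e \<in># edges G. set_uprod e \<inter> verts G \<noteq> {}#} = edges G"
    proof -
      have "set_uprod e \<noteq> {}" for e :: "'a uprod" by (cases e) auto
      then have "set_uprod e \<inter> verts G \<noteq> {}" if "e \<in># edges G" for e
        using that G Int_absorb2[of "set_uprod e" "verts G"] by (simp add: graph_def)
      then show ?thesis by (auto simp: filter_mset_eq_conv)
    qed
    then show ?thesis by (simp add: touching_def)
  qed
  have "ncls (verts G) (avoiding (edges G) (verts G)) = card (verts G)"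
    using ncls_isolated[OF fin, of "verts G" "avoiding (edges G) (verts G)"]
    by (auto simp: avoiding_def ncls_def)
  then show ?thesis using split_bound_eq[OF G, of "verts G"] t by simp
qed

lemma sum_load_verts:
  assumes G: "graph G" and und: "undirected D = edges G" and r: "r \<in> verts G"
  shows "(\<Sum>v\<in>verts G. load r D v) = size (edges G) + 1"
proof -
  have "{#e \<in># mset D. snd e \<in> verts G#} = mset D"
    using orientation_verts(2)[OF G und] by (auto simp: filter_mset_eq_conv)
  then have "size {#e \<in># mset D. snd e \<in> verts G#} = size (edges G)"
    using arg_cong[OF und, of size] by simp
  then show ?thesis
    using sum_load[of "verts G" r D] G r by (simp add: graph_def)
qed

lemma load_mset_cong: "mset D = mset D' \<Longrightarrow> load r D v = load r D' v"
  by (simp add: load_eq_mset)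

text \<open>If no exchange works, then for every vertex \<open>w\<close> with a surplus there is a tight set
  that contains \<open>u\<close> but not \<open>w\<close>; the intersection of these sets is tight as well, and the target
  \<open>x\<close> exceeds the bound on it.\<close>

lemma exchange_exists:
  assumes G: "graph G" and D: "spans G r D" and r: "r \<in> verts G"
    and x: "\<And>S. S \<subseteq> verts G \<Longrightarrow> sum x S \<le> split_bound G S"
    and u: "u \<in> verts G" "load r D u \<le> x u"
  shows "\<exists>w\<in>verts G. Suc (x w) < load r D w \<and> (u, w) \<in> (set D)\<^sup>* \<and>
    spans G r (redirect w (fst (snd (search False u D))) (snd (snd (search False u D))))"
proof (rule ccontr)
  let ?V = "verts G"
  let ?T = "fst (snd (search False u D))" and ?R = "snd (snd (search False u D))"
  assume contra: "\<not> ?thesis"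
  have und: "undirected D = edges G" and fin: "finite ?V"
    using D G by (auto simp: spans_def graph_def)
  \<comment> \<open>One inequality suffices, since \<open>load_le_split_bound\<close> gives the
    other for the rooted \<open>D\<close>.\<close>
  define tight where "tight Z \<longleftrightarrow> Z \<subseteq> ?V \<and> split_bound G Z + card Z \<le> (\<Sum>v\<in>Z. load r D v)" for Z
  have tight_Int: "tight (S \<inter> T)" if "tight S" "tight T" for S T
  proof -
    have ST: "S \<subseteq> ?V" "T \<subseteq> ?V" "finite S" "finite T"
      using that fin finite_subset by (auto simp: tight_def)
    have "split_bound G (S \<union> T) + split_bound G (S \<inter> T) \<le> split_bound G S + split_bound G T"
      using submodular_split_bound[OF G] ST by (simp add: submodular_def)
    moreover have "(\<Sum>v\<in>S \<union> T. load r D v) \<le> split_bound G (S \<union> T) + card (S \<union> T)"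
      using ST by (intro load_le_split_bound[OF G D]) auto
    moreover have "card (S \<union> T) + card (S \<inter> T) = card S + card T"
      using card_Un_Int[OF ST(3,4)] by simp
    moreover have "(\<Sum>v\<in>S \<union> T. load r D v) + (\<Sum>v\<in>S \<inter> T. load r D v)
        = (\<Sum>v\<in>S. load r D v) + (\<Sum>v\<in>T. load r D v)"
      using ST(3,4) by (rule sum.union_inter)
    ultimately show ?thesis using that ST unfolding tight_def by auto
  qed
  have sep: "\<exists>Z. u \<in> Z \<and> w \<notin> Z \<and> tight Z" if w: "w \<in> ?V" "Suc (x w) < load r D w" for w
  proof (cases "(u, w) \<in> (set D)\<^sup>*")
    case False
    \<comment> \<open>The set reachable from \<open>u\<close> has no leaving edge and misses
      \<open>w\<close>, so it is a tight separator.\<close>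
    let ?Z = "(set D)\<^sup>* `` {u}"
    have "?Z \<subset> ?V" using reachable_verts[OF G und u(1)] False w(1) by auto
    then have "split_bound G ?Z + card ?Z + of_bool (r \<in> ?Z) \<le> (\<Sum>v\<in>?Z. load r D v)"
      by (rule split_bound_le_load[OF G und]) (auto intro: rtrancl_into_rtrancl)
    then show ?thesis using False \<open>?Z \<subset> ?V\<close> by (intro exI[of _ ?Z]) (auto simp: tight_def)
  next
    case True
    let ?D = "redirect w ?T ?R"
    have g: "grown u ?T (fst (search False u D))" and m: "mset (?T @ ?R) = mset D"
      using search_invariants[where und = False and s = u and L = D] by auto
    have "w \<in> set (fst (search False u D))" using True by (simp add: set_search)
    note ld = load_redirect[OF g this, of r ?R]
    have ld: "load r ?D v + of_bool (v = w) = load r D v + of_bool (v = u)" for v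
      using ld[of v] unfolding load_mset_cong[OF m] .
    have undD: "undirected ?D = edges G"
      unfolding undirected_redirect m by (rule und)
    \<comment> \<open>The part still reachable from \<open>r\<close> after the failed reversal
      exceeds its bound by one under the new loads, but not under the old ones. The reversal adds a
      unit only at \<open>u\<close> and removes one only at \<open>w\<close>, so the set contains
      \<open>u\<close>, misses \<open>w\<close>, and was tight before.\<close>
    let ?Z = "(set ?D)\<^sup>* `` {r}"
    have "\<not> spans G r ?D" using contra w True by blast
    then have "?Z \<subset> ?V"
      using reachable_verts[OF G undD r] undD by (auto simp: spans_def)
    then have "split_bound G ?Z + card ?Z + of_bool (r \<in> ?Z) \<le> (\<Sum>v\<in>?Z. load r ?D v)"
      by (rule split_bound_le_load[OF G undD]) (auto intro: rtrancl_into_rtrancl)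
    moreover have finZ: "finite ?Z" using \<open>?Z \<subset> ?V\<close> fin finite_subset by blast
    have "(\<Sum>v\<in>?Z. load r ?D v + of_bool (v = w)) = (\<Sum>v\<in>?Z. load r D v + of_bool (v = u))"
      using ld by simp
    then have "(\<Sum>v\<in>?Z. load r ?D v) + of_bool (w \<in> ?Z) = (\<Sum>v\<in>?Z. load r D v) + of_bool (u \<in> ?Z)"
      using finZ by (simp add: sum.distrib of_bool_def del: Image_singleton_iff)
    moreover have "(\<Sum>v\<in>?Z. load r D v) \<le> split_bound G ?Z + card ?Z"
      using \<open>?Z \<subset> ?V\<close> by (intro load_le_split_bound[OF G D]) auto
    ultimately have "u \<in> ?Z \<and> w \<notin> ?Z \<and> split_bound G ?Z + card ?Z \<le> (\<Sum>v\<in>?Z. load r D v)"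
      by (auto simp: of_bool_def split: if_splits)
    then show ?thesis using \<open>?Z \<subset> ?V\<close> unfolding tight_def by blast
  qed
  have "\<exists>Z. u \<in> Z \<and> Z \<inter> B = {} \<and> tight Z"
    if "finite B" "B \<subseteq> {w \<in> ?V. Suc (x w) < load r D w}" for B
    using that
  proof (induction B)
    case empty
    have "tight ?V"
      using split_bound_verts[OF G] sum_load_verts[OF G und r] by (simp add: tight_def)
    then show ?case using u(1) by blast
  next
    case (insert w B)
    then obtain Z where "u \<in> Z" "Z \<inter> B = {}" "tight Z" by auto
    moreover obtain Z' where "u \<in> Z'" "w \<notin> Z'" "tight Z'" using sep[of w] insert.prems by auto
    ultimately show ?case using tight_Int[of Z Z'] by (intro exI[of _ "Z \<inter> Z'"]) auto
  qed
  from this[of "{w \<in> ?V. Suc (x w) < load r D w}"] fin obtain Z where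
    Z: "u \<in> Z" "Z \<inter> {w \<in> ?V. Suc (x w) < load r D w} = {}" "tight Z" by auto
  have ZV: "Z \<subseteq> ?V" "finite Z" using Z(3) fin finite_subset by (auto simp: tight_def)
  \<comment> \<open>No vertex of \<open>Z\<close> has a surplus and \<open>u\<close> has a deficit,
    so a tight \<open>Z\<close> would make \<open>x\<close> exceed the bound on
    \<open>Z\<close>.\<close>
  have "(\<Sum>v\<in>Z. load r D v) < (\<Sum>v\<in>Z. x v + 1)"
  proof (rule sum_strict_mono_ex1)
    show "\<forall>v\<in>Z. load r D v \<le> x v + 1" using Z(2) ZV by fastforce
    show "\<exists>v\<in>Z. load r D v < x v + 1" using Z(1) u(2) by force
  qed (rule ZV)
  also have "\<dots> = sum x Z + card Z" unfolding sum.distrib by simp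
  also have "\<dots> \<le> split_bound G Z + card Z" using x[OF ZV(1)] by simp
  finally show False using Z(3) unfolding tight_def by simp
qed

lemma load_pos:
  assumes "spans G r D" "v \<in> verts G"
  shows "0 < load r D v"
proof (cases "v = r")
  case False
  have "(r, v) \<in> (set D)\<^sup>*" using assms by (simp add: spans_def)
  then have "\<exists>y. (y, v) \<in> set D" using False by cases auto
  then show ?thesis by (force simp: load_eq_mset)
qed (simp add: load_eq_mset)

lemma spans_initial:
  assumes G: "graph G" and L: "undirected L = edges G" and r: "r \<in> verts G"
  shows "spans G r (initial r L)"
proof -
  let ?st = "search True r L"
  have "undirected (initial r L) = edges G"
    unfolding initial_def Let_def using search_invariants(2)[of True r L] L by simp
  moreover have "(r, v) \<in> (set (initial r L))\<^sup>*" if v: "v \<in> verts G" for v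
  proof -
    have "adj_rel G \<subseteq> set L \<union> (set L)\<inverse>"
      unfolding adj_rel_def L[symmetric] by auto
    then have "(adj_rel G)\<^sup>* \<subseteq> conn (set L)" unfolding conn_def by (rule rtrancl_mono)
    then have "(r, v) \<in> conn (set L)" using G r v by (auto simp: graph_def connected_graph_def)
    then have "v \<in> set (fst ?st)" by (simp add: set_search_undirected)
    then have "(r, v) \<in> (set (fst (snd ?st)))\<^sup>*"
      by (rule grown_reachable[OF search_invariants(1)])
    moreover have "(set (fst (snd ?st)))\<^sup>* \<subseteq> (set (initial r L))\<^sup>*"
      by (rule rtrancl_mono) (auto simp: initial_def Let_def)
    ultimately show ?thesis by blast
  qed
  ultimately show ?thesis by (simp add: spans_def)
qed

abbreviation target :: "'v list \<Rightarrow> ('v \<Rightarrow> 'b) \<Rightarrow> ('v \<times> 'b) list" where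
  "target vs x \<equiv> map (\<lambda>v. (v, x v)) vs"

lemma rooted_target: "rooted r (target vs x) D \<longleftrightarrow> (\<forall>v\<in>set vs. (r, v) \<in> (set D)\<^sup>*)"
  by (auto simp: rooted_def list_all_iff set_search)

lemma met_target: "met r (target vs x) D \<longleftrightarrow> (\<forall>v\<in>set vs. x v < load r D v)"
  by (simp add: met_def list_all_iff)

lemma exchangesE:
  assumes "D' \<in> set (exchanges r (target vs x) D u)" and vs: "set vs = verts G" and D: "spans G r D"
  obtains w where "w \<in> verts G" "Suc (x w) < load r D w" "spans G r D'"
    "\<And>v. load r D' v + of_bool (v = w) = load r D v + of_bool (v = u)"
proof -
  let ?T = "fst (snd (search False u D))" and ?R = "snd (snd (search False u D))"
  obtain w where w: "w \<in> verts G" "w \<in> set (fst (search False u D))" "Suc (x w) < load r D w"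
      "D' = redirect w ?T ?R" and root: "rooted r (target vs x) D'"
    using assms(1) vs by (auto simp: exchanges_def Let_def)
  have g: "grown u ?T (fst (search False u D))" and m: "mset (?T @ ?R) = mset D"
    using search_invariants[where und = False and s = u and L = D] by auto
  have "undirected D' = edges G"
    unfolding w(4) undirected_redirect m using D by (simp add: spans_def)
  then have "spans G r D'" using root vs by (simp add: spans_def rooted_target)
  moreover have "load r D' v + of_bool (v = w) = load r D v + of_bool (v = u)" for v
    using load_redirect[OF g w(2), of r ?R v] unfolding w(4) load_mset_cong[OF m] .
  ultimately show thesis using that w(1,3) by blast
qed

lemma spans_improve:
  assumes "set vs = verts G" "spans G r D"
  shows "spans G r (improve r (target vs x) D)"
proof -
  have "spans G r D'" if "exchanges r (target vs x) D u = D' # Ds" for u D' Ds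
  proof -
    have "D' \<in> set (exchanges r (target vs x) D u)" using that by simp
    then show ?thesis using assms by (rule exchangesE)
  qed
  then show ?thesis using assms(2) by (auto simp: improve_def split: list.split)
qed

text \<open>Truncated subtraction is intended: a surplus at one vertex must not hide a shortage at
  another.\<close>

definition deficit :: "'v mgraph \<Rightarrow> 'v \<Rightarrow> ('v \<Rightarrow> nat) \<Rightarrow> ('v \<times> 'v) list \<Rightarrow> nat" where
  "deficit G r x D = (\<Sum>v\<in>verts G. Suc (x v) - load r D v)"

text \<open>The donor has a surplus before the exchange and still meets its request after it, so
  only the term of \<open>u\<close> changes. The truncated \<open>- 1\<close> includes the case of a
  target already met.\<close>

lemma deficit_improve:
  assumes G: "graph G" and vs: "set vs = verts G" and D: "spans G r D" and r: "r \<in> verts G"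
    and x: "\<And>S. S \<subseteq> verts G \<Longrightarrow> sum x S \<le> split_bound G S"
  shows "deficit G r x (improve r (target vs x) D) \<le> deficit G r x D - 1"
proof (cases "filter (\<lambda>p. load r D (fst p) \<le> snd p) (target vs x)")
  case Nil
  then have "\<forall>v\<in>verts G. x v < load r D v" using vs by (auto simp: filter_empty_conv)
  then have "deficit G r x D = 0" by (auto simp: deficit_def Suc_le_eq)
  then show ?thesis using Nil by (simp add: improve_def)
next
  case (Cons p ps)
  then have "p \<in> set (filter (\<lambda>p. load r D (fst p) \<le> snd p) (target vs x))" by simp
  then obtain u where p: "p = (u, x u)" and u: "u \<in> verts G" "load r D u \<le> x u" using vs by auto
  obtain w where w: "w \<in> verts G" "Suc (x w) < load r D w" "(u, w) \<in> (set D)\<^sup>*"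
    "spans G r (redirect w (fst (snd (search False u D))) (snd (snd (search False u D))))"
    using exchange_exists[OF G D r x u] by blast
  then have "redirect w (fst (snd (search False u D))) (snd (snd (search False u D)))
      \<in> set (exchanges r (target vs x) D u)"
    using vs by (auto simp: exchanges_def Let_def rooted_target set_search spans_def
        intro!: image_eqI[of _ _ "(w, x w)"])
  then obtain D' Ds where D': "exchanges r (target vs x) D u = D' # Ds"
    by (cases "exchanges r (target vs x) D u") auto
  then have imp: "improve r (target vs x) D = D'"
    using Cons by (simp add: improve_def p)
  have "D' \<in> set (exchanges r (target vs x) D u)" using D' by simp
  then obtain z where z: "z \<in> verts G" "Suc (x z) < load r D z"
    and ld: "\<And>v. load r D' v + of_bool (v = z) = load r D v + of_bool (v = u)"
    using exchangesE[OF _ vs D] by metis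
  have "u \<noteq> z" using z(2) u(2) by auto
  have "deficit G r x D' < deficit G r x D"
    unfolding deficit_def
  proof (rule sum_strict_mono_ex1)
    show "finite (verts G)" using G by (simp add: graph_def)
    show "\<forall>v\<in>verts G. Suc (x v) - load r D' v \<le> Suc (x v) - load r D v"
    proof
      fix v
      show "Suc (x v) - load r D' v \<le> Suc (x v) - load r D v"
        using ld[of v] z(2) by (cases "v = z"; cases "v = u") auto
    qed
    show "\<exists>v\<in>verts G. Suc (x v) - load r D' v < Suc (x v) - load r D v"
      using u ld[of u] \<open>u \<noteq> z\<close> by (intro bexI[of _ u]) auto
  qed
  then show ?thesis using imp by simp
qed

lemma solve_correct:
  assumes G: "graph G" and L: "undirected L = edges G" and vs: "set vs = verts G" and r: "r \<in> verts G"
  shows "spans G r (solve r L (target vs x))"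
    and "(\<And>S. S \<subseteq> verts G \<Longrightarrow> sum x S \<le> split_bound G S) \<Longrightarrow> met r (target vs x) (solve r L (target vs x))"
proof -
  define st where "st xs = foldl (\<lambda>D _. improve r (target vs x) D) (initial r L) xs" for xs :: "('a \<times> 'a) list"
  have solve: "solve r L (target vs x) = st L" by (simp add: st_def solve_def)
  have sp: "spans G r (st xs)" for xs
    by (induction xs rule: rev_induct) (auto simp: st_def spans_initial[OF G L r] spans_improve[OF vs])
  then show "spans G r (solve r L (target vs x))" by (simp add: solve)
  assume x: "\<And>S. S \<subseteq> verts G \<Longrightarrow> sum x S \<le> split_bound G S"
  have "deficit G r x (st xs) \<le> deficit G r x (initial r L) - length xs" for xs
  proof (induction xs rule: rev_induct)
    case (snoc e xs)
    have "deficit G r x (st (xs @ [e])) \<le> deficit G r x (st xs) - 1"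
      using deficit_improve[OF G vs sp r x, of xs] by (simp add: st_def)
    then show ?case using snoc by simp
  qed (simp add: st_def)
  \<comment> \<open>Every vertex already has load at least 1 in a rooted orientation, so the initial
    deficit is at most the sum of \<open>x\<close>, hence at most f(V) and |E|.\<close>
  moreover have "deficit G r x (initial r L) \<le> length L"
  proof -
    have "deficit G r x (initial r L) \<le> sum x (verts G)"
      unfolding deficit_def
    proof (rule sum_mono)
      fix v assume "v \<in> verts G"
      from load_pos[OF spans_initial[OF G L r] this]
      show "Suc (x v) - load r (initial r L) v \<le> x v" by simp
    qed
    also have "\<dots> \<le> split_bound G (verts G)" by (rule x) simp
    also have "\<dots> \<le> size (edges G)"
      using split_bound_verts[OF G] G by (simp add: graph_def)
    also have "\<dots> = length L" unfolding L[symmetric] by simp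
    finally show ?thesis .
  qed
  ultimately have "deficit G r x (st L) = 0" by (metis diff_is_0_eq le_zero_eq)
  then show "met r (target vs x) (solve r L (target vs x))"
    using G vs unfolding solve met_target by (auto simp: deficit_def graph_def Suc_le_eq)
qed

section \<open>Feasible split vectors\<close>

lemma image_set_uprod_eq_iff: "\<phi> ` set_uprod e = {u, v} \<longleftrightarrow> map_uprod \<phi> e = Upair u v"
  by (cases e) (auto simp: doubleton_eq_iff)

lemma size_filter_eq_count: "size {#e \<in># M. f e = x#} = count (image_mset f M) x"
  by (induction M) auto

text \<open>The counts for all pairs of vertices amount to one equation of multisets, loops being
  the case \<open>u = v\<close>; unordered pairs with an end outside \<open>verts G\<close> occur on
  neither side.\<close>

lemma homomorphic_image_edges:
  fixes G :: "'v mgraph"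
  assumes "graph G" "graph H" "homomorphic_image G H \<phi>"
  shows "edges G = image_mset (map_uprod \<phi>) (edges H)"
proof (rule multiset_eqI)
  fix e :: "'v uprod"
  obtain u v where e: "e = Upair u v" by (cases e) auto
  show "count (edges G) e = count (image_mset (map_uprod \<phi>) (edges H)) e"
  proof (cases "u \<in> verts G \<and> v \<in> verts G")
    case True
    then show ?thesis
      using assms(3) unfolding e homomorphic_image_def image_set_uprod_eq_iff size_filter_eq_count by blast
  next
    case False
    have "e \<notin># edges G" using assms(1) False e unfolding graph_def by fastforce
    moreover have "e \<notin># image_mset (map_uprod \<phi>) (edges H)"
    proof
      assume "e \<in># image_mset (map_uprod \<phi>) (edges H)"
      then obtain e' where e': "e' \<in># edges H" "map_uprod \<phi> e' = Upair u v" using e by auto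
      then have "\<phi> ` set_uprod e' = {u, v}" by (simp add: image_set_uprod_eq_iff)
      moreover have "\<phi> ` set_uprod e' \<subseteq> verts G"
        using e'(1) assms(2,3) unfolding graph_def homomorphic_image_def by blast
      ultimately show False using False by auto
    qed
    ultimately show ?thesis by (metis count_eq_zero_iff)
  qed
qed

lemma homomorphic_imageI:
  assumes "\<phi> ` verts H = verts G" "edges G = image_mset (map_uprod \<phi>) (edges H)"
  shows "homomorphic_image G H \<phi>"
  using assms(1) unfolding homomorphic_image_def image_set_uprod_eq_iff size_filter_eq_count
  by (simp add: assms(2))

text \<open>Let S' be the preimage of S. In \<open>H\<close> the number of classes after deletion,
  |S'| + c(H - S'), is at most \<open>touching + 1\<close>. The touched edges correspond under
  \<open>\<phi>\<close>, c(H - S') is at least c(G - S), and |S'| is the sum of \<open>\<mu>\<close>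
  over S plus |S|; subtracting leaves the bound for \<open>G\<close>.\<close>

lemma feasible_split_le_bound:
  assumes G: "graph G" and feas: "feasible_split G \<mu>" and S: "S \<subseteq> verts G"
  shows "sum \<mu> S \<le> split_bound G S"
proof -
  obtain H :: "nat mgraph" and \<phi> where H: "graph H" and hom: "homomorphic_image G H \<phi>"
    and c: "\<And>v. v \<in> verts G \<Longrightarrow> card {w \<in> verts H. \<phi> w = v} = \<mu> v + 1"
    using feas unfolding feasible_split_def feasible_multiplicity_def by blast
  note E = homomorphic_image_edges[OF G H hom]
  let ?W = "verts H" and ?V = "verts G"
  have \<phi>: "\<phi> ` ?W = ?V" using hom by (simp add: homomorphic_image_def)
  have fin: "finite ?W" "finite ?V" "finite S"
    using G H S finite_subset[of S ?V] by (auto simp: graph_def)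
  define S' where "S' = {w \<in> ?W. \<phi> w \<in> S}"
  have S': "S' \<subseteq> ?W" by (auto simp: S'_def)
  have HW: "set_uprod e \<subseteq> ?W" if "e \<in># edges H" for e
    using H that by (simp add: graph_def)
  have "card S' = (\<Sum>v\<in>S. card {w \<in> ?W. \<phi> w = v})"
  proof -
    have "S' = (\<Union>v\<in>S. {w \<in> ?W. \<phi> w = v})" by (auto simp: S'_def)
    then show ?thesis
      using fin by (simp add: card_UN_disjoint[of S "\<lambda>v. {w \<in> ?W. \<phi> w = v}"] disjoint_iff)
  qed
  also have "\<dots> = (\<Sum>v\<in>S. \<mu> v + 1)" using c S by (intro sum.cong) auto
  finally have card_S': "card S' = sum \<mu> S + card S" unfolding sum.distrib by simp
  have t: "touching (edges G) S = touching (edges H) S'"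
  proof -
    have "{#e \<in># edges H. set_uprod (map_uprod \<phi> e) \<inter> S \<noteq> {}#} = {#e \<in># edges H. set_uprod e \<inter> S' \<noteq> {}#}"
      by (rule filter_mset_cong) (use HW in \<open>fastforce simp: S'_def uprod.set_map\<close>)+
    then show ?thesis unfolding touching_def E by (simp add: filter_mset_image_mset)
  qed
  have "ncls (?V - S) (avoiding (edges G) S) \<le> ncls (?W - S') (avoiding (edges H) S')"
  proof (rule ncls_le_image)
    show "\<phi> ` (?W - S') = ?V - S" using \<phi> by (auto simp: S'_def)
    fix x y assume xy: "(x, y) \<in> avoiding (edges H) S'"
    then have "Upair x y \<in># edges H" by (simp add: avoiding_def)
    then have "x \<in> ?W" "y \<in> ?W" "Upair (\<phi> x) (\<phi> y) \<in># edges G"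
      using HW[of "Upair x y"] unfolding E by (auto intro!: image_eqI[of _ _ "Upair x y"])
    then show "(\<phi> x, \<phi> y) \<in> conn (avoiding (edges G) S)"
      using xy by (intro conn_base) (auto simp: avoiding_def S'_def)
  qed (use fin in simp)
  moreover have "ncls ?W (avoiding (edges H) S') = card S' + ncls (?W - S') (avoiding (edges H) S')"
    using S' by (intro ncls_isolated fin) (auto simp: avoiding_def)
  moreover have "ncls ?V (avoiding (edges G) S) = card S + ncls (?V - S) (avoiding (edges G) S)"
    using S by (intro ncls_isolated fin) (auto simp: avoiding_def)
  ultimately show ?thesis
    using split_bound_eq[OF H, of S'] split_bound_eq[OF G, of S] t card_S' by linarith
qed

section \<open>Concrete graphs and the construction of \<open>H\<close>\<close>

lemma verts_graph_of [simp]: "verts (graph_of (n, es)) = {..<n}"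
  by (simp add: graph_of_def)

lemma edges_graph_of [simp]: "edges (graph_of (n, es)) = undirected es"
  by (auto simp: graph_of_def intro!: image_mset_cong)

lemma graph_graph_ofI:
  assumes "2 \<le> n" "\<And>a b. (a, b) \<in> set es \<Longrightarrow> a < n \<and> b < n" "\<And>v. v < n \<Longrightarrow> (0, v) \<in> conn (set es)"
  shows "graph (graph_of (n, es))"
proof -
  have "conn (set es) \<subseteq> (adj_rel (graph_of (n, es)))\<^sup>*"
    unfolding conn_def
  proof (rule rtrancl_mono)
    show "set es \<union> (set es)\<inverse> \<subseteq> adj_rel (graph_of (n, es))"
      by (force simp: adj_rel_def Upair_swap image_iff)
  qed
  moreover have "(u, v) \<in> conn (set es)" if "u < n" "v < n" for u v
    using conn_trans[OF conn_sym[OF assms(3)] assms(3)] that by blast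
  ultimately show ?thesis
    using assms(1,2) by (auto simp: graph_def connected_graph_def)
qed

text \<open>The first \<open>n\<close> entries of the vertex list are the main copies, and edge tails stay there.\<close>

lemma attach_edges_invariants:
  fixes x :: "nat \<Rightarrow> nat" and n :: nat and T xs :: "(nat \<times> nat) list"
  defines "t \<equiv> target [0..<n] x"
  defines "st \<equiv> \<lambda>xs. foldl (attach_edge t) ([0..<n], T) xs"
  assumes T: "\<And>e. e \<in> set T \<Longrightarrow> fst e < n \<and> snd e < n"
    and xs: "\<And>e. e \<in> set xs \<Longrightarrow> fst e < n \<and> snd e < n"
    and reach: "\<And>v. v < n \<Longrightarrow> (0, v) \<in> conn (set T)"
  shows "n \<le> length (fst (st xs)) \<and> (\<forall>i<n. fst (st xs) ! i = i) \<and> set (fst (st xs)) \<subseteq> {..<n} \<and>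
    (\<forall>e\<in>set (snd (st xs)). fst e < length (fst (st xs)) \<and> snd e < length (fst (st xs))) \<and>
    undirected (map (\<lambda>e. (fst (st xs) ! fst e, fst (st xs) ! snd e)) (snd (st xs))) = undirected (T @ xs) \<and>
    (\<forall>w<length (fst (st xs)). (0, w) \<in> conn (set (snd (st xs)))) \<and>
    (\<forall>v<n. count_list (fst (st xs)) v = min (Suc (x v)) (Suc (count_list (map snd xs) v)))"
  using xs
proof (induction xs rule: rev_induct)
  case Nil
  have "map (\<lambda>e. ([0..<n] ! fst e, [0..<n] ! snd e)) T = T"
    by (rule map_idI) (use T in force)
  moreover have "count_list [0..<n] v = 1" if "v < n" for v
    using that by (simp add: count_list_eq_mset distinct_count_atmost_1)
  ultimately show ?case using T reach by (auto simp: st_def)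
next
  case (snoc e xs)
  obtain \<phi> E where s: "st xs = (\<phi>, E)" by fastforce
  have e: "fst e < n" "snd e < n" using snoc.prems by auto
  have IH: "n \<le> length \<phi>" "\<And>i. i < n \<Longrightarrow> \<phi> ! i = i" "set \<phi> \<subseteq> {..<n}"
    "\<And>e. e \<in> set E \<Longrightarrow> fst e < length \<phi> \<and> snd e < length \<phi>"
    "undirected (map (\<lambda>e. (\<phi> ! fst e, \<phi> ! snd e)) E) = undirected (T @ xs)"
    "\<And>w. w < length \<phi> \<Longrightarrow> (0, w) \<in> conn (set E)"
    "\<And>v. v < n \<Longrightarrow> count_list \<phi> v = min (Suc (x v)) (Suc (count_list (map snd xs) v))"
    using snoc.IH snoc.prems s by auto
  have st': "st (xs @ [e]) = attach_edge t (\<phi>, E) e"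
    using s by (simp add: st_def)
  have cond: "list_all (\<lambda>p. fst p = snd e \<longrightarrow> snd p < count_list \<phi> (snd e)) t \<longleftrightarrow> x (snd e) < count_list \<phi> (snd e)"
    using e(2) by (auto simp: t_def list_all_iff)
  show ?case
  proof (cases "x (snd e) < count_list \<phi> (snd e)")
    case True
    then have st'': "st (xs @ [e]) = (\<phi>, e # E)"
      using cond unfolding st' attach_edge_def by simp
    have "conn (set E) \<subseteq> conn (set (e # E))" by (rule conn_mono) auto
    moreover have "count_list \<phi> v = min (Suc (x v)) (Suc (count_list (map snd (xs @ [e])) v))" if "v < n" for v
      using IH(7)[OF that] True by (auto simp: count_list_append)
    ultimately show ?thesis
      unfolding st'' using IH e by auto
  next
    case False
    then have st'': "st (xs @ [e]) = (\<phi> @ [snd e], (fst e, length \<phi>) # E)"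
      using cond unfolding st' attach_edge_def by simp
    let ?\<phi> = "\<phi> @ [snd e]" and ?E = "(fst e, length \<phi>) # E"
    have mono: "conn (set E) \<subseteq> conn (set ?E)" by (rule conn_mono) auto
    have "(0, fst e) \<in> conn (set ?E)" using IH(6)[of "fst e"] IH(1) e mono by auto
    then have new: "(0, length \<phi>) \<in> conn (set ?E)"
      using conn_trans[of 0 "fst e" "set ?E" "length \<phi>"] conn_base[of "fst e" "length \<phi>" "set ?E"] by auto
    have old: "map (\<lambda>e. (?\<phi> ! fst e, ?\<phi> ! snd e)) E = map (\<lambda>e. (\<phi> ! fst e, \<phi> ! snd e)) E"
      using IH(4) by (auto simp: nth_append)
    have "undirected (map (\<lambda>e. (?\<phi> ! fst e, ?\<phi> ! snd e)) ?E)
        = add_mset (Upair (fst e) (snd e)) (undirected (map (\<lambda>e. (?\<phi> ! fst e, ?\<phi> ! snd e)) E))"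
      using e IH(1,2) by (simp add: nth_append)
    then have "undirected (map (\<lambda>e. (?\<phi> ! fst e, ?\<phi> ! snd e)) ?E) = undirected (T @ xs @ [e])"
      unfolding old IH(5) by simp
    moreover have "count_list ?\<phi> v = min (Suc (x v)) (Suc (count_list (map snd (xs @ [e])) v))" if "v < n" for v
      using IH(7)[OF that] False by (auto simp: count_list_append)
    moreover have "(0, w) \<in> conn (set ?E)" if "w < length ?\<phi>" for w
      using that new IH(6)[of w] mono by (cases "w = length \<phi>") auto
    moreover have "\<forall>i<n. ?\<phi> ! i = i" using IH(1,2) by (simp add: nth_append)
    moreover have "\<forall>e\<in>set ?E. fst e < length ?\<phi> \<and> snd e < length ?\<phi>"
      using IH(1,4) e by fastforce
    ultimately show ?thesis
      unfolding st'' fst_conv snd_conv using IH(1,3) e by auto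
  qed
qed

text \<open>A vertex v ends with one main copy and a fresh copy for each non-tree edge into it,
  capped at \<open>x v + 1\<close> copies. Since the tree gives v exactly one unit of load,
  \<open>met\<close> says that there are at least \<open>x v\<close> such edges, so the cap is
  reached.\<close>

lemma attach_correct:
  assumes G: "graph (graph_of (n, es))" and D: "spans (graph_of (n, es)) 0 D"
    and met: "met 0 (target [0..<n] x) D"
  defines "st \<equiv> attach (target [0..<n] x) (search False 0 D)"
  defines "H \<equiv> graph_of (length (fst st), snd st)"
  shows "graph H" "homomorphic_image (graph_of (n, es)) H ((!) (fst st))"
    "\<And>v. v < n \<Longrightarrow> card {w \<in> verts H. fst st ! w = v} = Suc (x v)"
proof -
  let ?s = "search False 0 D"
  let ?K = "fst ?s" and ?T = "fst (snd ?s)" and ?R = "snd (snd ?s)"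
  have g: "grown 0 ?T ?K" and m: "mset (?T @ ?R) = mset D"
    using search_invariants[where und = False and s = 0 and L = D] by auto
  have und: "undirected D = undirected es" using D by (simp add: spans_def)
  have reachD: "(0, v) \<in> (set D)\<^sup>*" if "v < n" for v using D that by (simp add: spans_def)
  have n: "2 \<le> n" using G by (simp add: graph_def)
  have K: "v \<in> set ?K" if "v < n" for v using reachD[OF that] by (simp add: set_search)
  have D_n: "fst e < n \<and> snd e < n" if "e \<in> set (?T @ ?R)" for e
  proof -
    have "e \<in> set D" using that m by (metis set_mset_mset)
    then show ?thesis
      using orientation_verts[OF G, of D "fst e" "snd e"] und by simp
  qed
  have reach: "(0, v) \<in> conn (set ?T)" if "v < n" for v
  proof -
    have "(set ?T)\<^sup>* \<subseteq> conn (set ?T)" unfolding conn_def by (rule rtrancl_mono) auto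
    then show ?thesis using grown_reachable[OF g K[OF that]] by blast
  qed
  have st: "st = foldl (attach_edge (target [0..<n] x)) ([0..<n], ?T) ?R"
    unfolding st_def attach_def by (simp add: comp_def)
  have inv: "n \<le> length (fst st)" "\<forall>i<n. fst st ! i = i" "set (fst st) \<subseteq> {..<n}"
    "\<forall>e\<in>set (snd st). fst e < length (fst st) \<and> snd e < length (fst st)"
    "undirected (map (\<lambda>e. (fst st ! fst e, fst st ! snd e)) (snd st)) = undirected (?T @ ?R)"
    "\<forall>w<length (fst st). (0, w) \<in> conn (set (snd st))"
    "\<forall>v<n. count_list (fst st) v = min (Suc (x v)) (Suc (count_list (map snd ?R) v))"
    using attach_edges_invariants[of ?T n ?R x] D_n reach unfolding st by auto
  show "graph H"
    unfolding H_def using inv(1,4,6) n by (intro graph_graph_ofI) auto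
  show "homomorphic_image (graph_of (n, es)) H ((!) (fst st))"
  proof (rule homomorphic_imageI)
    show "(!) (fst st) ` verts H = verts (graph_of (n, es))"
    proof
      have "fst st ! w < n" if "w < length (fst st)" for w
        using inv(3) nth_mem[OF that] by blast
      then show "(!) (fst st) ` verts H \<subseteq> verts (graph_of (n, es))"
        by (auto simp: H_def)
      have "v \<in> (!) (fst st) ` verts H" if "v < n" for v
        using inv(1,2) that by (intro image_eqI[of _ _ v]) (auto simp: H_def)
      then show "verts (graph_of (n, es)) \<subseteq> (!) (fst st) ` verts H"
        by auto
    qed
    have "edges (graph_of (n, es)) = undirected (?T @ ?R)"
      using und unfolding m edges_graph_of by simp
    also have "\<dots> = image_mset (map_uprod ((!) (fst st))) (edges H)"
      unfolding inv(5)[symmetric] H_def edges_graph_of by (simp add: image_mset.compositionality comp_def)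
    finally show "edges (graph_of (n, es)) = image_mset (map_uprod ((!) (fst st))) (edges H)" .
  qed
  fix v assume v: "v < n"
  have "x v < load 0 (?T @ ?R) v"
    using met v load_mset_cong[OF m] unfolding met_target by auto
  also have "load 0 (?T @ ?R) v = count_list ?K v + count_list (map snd ?R) v"
    using grown_heads[OF g] by (simp add: load_eq_mset count_list_eq_mset)
  also have "count_list ?K v = 1"
    using grown_heads[OF g, THEN conjunct2] K[OF v]
    by (simp add: count_list_eq_mset distinct_count_atmost_1)
  finally have "count_list (fst st) v = Suc (x v)" using inv(7) v by simp
  then show "card {w \<in> verts H. fst st ! w = v} = Suc (x v)"
    by (simp add: count_list_eq_length_filter length_filter_conv_card H_def eq_commute)
qed

lemma count_list_map: "count_list (map f xs) y = length (filter (\<lambda>x. f x = y) xs)"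
  by (induction xs) auto

text \<open>Sufficiency runs the augmentation and the construction of \<open>H\<close> as an
  existence proof. The augmentation works on vertices of any type; only the construction of
  \<open>H\<close> needs numbers, so the finished orientation is relabelled.\<close>

lemma feasible_split_iff:
  fixes G :: "'v mgraph"
  assumes G: "graph G"
  shows "feasible_split G \<mu> \<longleftrightarrow> (\<forall>S\<subseteq>verts G. sum \<mu> S \<le> split_bound G S)"
proof
  assume "feasible_split G \<mu>"
  then show "\<forall>S\<subseteq>verts G. sum \<mu> S \<le> split_bound G S"
    using feasible_split_le_bound[OF G] by blast
next
  assume bound: "\<forall>S\<subseteq>verts G. sum \<mu> S \<le> split_bound G S"
  let ?V = "verts G" and ?n = "card (verts G)"
  have fin: "finite ?V" and n: "2 \<le> ?n" using G by (auto simp: graph_def)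
  obtain \<beta> where \<beta>: "bij_betw \<beta> {..<?n} ?V"
    using ex_bij_betw_nat_finite[OF fin] by (auto simp: atLeast0LessThan)
  define \<gamma> where "\<gamma> = inv_into {..<?n} \<beta>"
  have \<gamma>: "\<gamma> v < ?n" "\<beta> (\<gamma> v) = v" if "v \<in> ?V" for v
    using \<beta> that bij_betw_inv_into_right[OF \<beta>] bij_betw_inv_into[OF \<beta>]
    by (auto simp: \<gamma>_def bij_betw_def)
  have \<beta>': "\<beta> i \<in> ?V" "\<gamma> (\<beta> i) = i" if "i < ?n" for i
    using \<beta> that bij_betw_inv_into_left[OF \<beta>] by (auto simp: \<gamma>_def bij_betw_def)
  obtain L where L: "undirected L = edges G"
  proof -
    obtain us where us: "mset us = edges G" using ex_mset by blast
    have "\<forall>e. \<exists>p. e = Upair (fst p) (snd p)" by (metis uprod_exhaust fst_conv snd_conv)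
    then obtain p where p: "\<And>e :: 'v uprod. e = Upair (fst (p e)) (snd (p e))" by metis
    have "undirected (map p us) = edges G"
      unfolding us[symmetric] by (simp add: image_mset.compositionality comp_def p[symmetric])
    then show thesis using that by blast
  qed
  define r where "r = \<beta> 0"
  have r: "r \<in> ?V" using \<beta>'(1)[of 0] n by (simp add: r_def)
  obtain vs where vs: "set vs = ?V" using finite_list[OF fin] by blast
  define D where "D = solve r L (target vs \<mu>)"
  have sp: "spans G r D" and met: "met r (target vs \<mu>) D"
    using solve_correct[OF G L vs r, of \<mu>] bound by (auto simp: D_def)
  have und: "undirected D = edges G" using sp by (simp add: spans_def)
  \<comment> \<open>The oriented edges themselves, renamed by \<open>\<gamma>\<close>, serve as the
    edge list of the concrete graph, which makes the spanning condition a statement about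
    reachability alone.\<close>
  define D' where "D' = map (\<lambda>e. (\<gamma> (fst e), \<gamma> (snd e))) D"
  have reach: "(0, i) \<in> (set D')\<^sup>*" if i: "i < ?n" for i
  proof -
    have "(r, v) \<in> (set D)\<^sup>* \<Longrightarrow> (\<gamma> r, \<gamma> v) \<in> (set D')\<^sup>*" for v
    proof (induction rule: rtrancl_induct)
      case (step y z)
      then have "(\<gamma> y, \<gamma> z) \<in> set D'" by (force simp: D'_def)
      then show ?case using step.IH by (rule rtrancl_into_rtrancl[rotated])
    qed simp
    moreover have "(r, \<beta> i) \<in> (set D)\<^sup>*" using sp \<beta>'(1)[OF i] by (simp add: spans_def)
    ultimately show ?thesis using \<beta>'(2)[OF i] \<beta>'(2)[of 0] n by (force simp: r_def)
  qed
  have G': "graph (graph_of (?n, D'))"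
  proof (rule graph_graph_ofI[OF n])
    have "a < ?n \<and> b < ?n" if "(a, b) \<in> set D'" for a b
      using that \<gamma>(1) orientation_verts[OF G und] by (auto simp: D'_def)
    then show "(a, b) \<in> set D' \<Longrightarrow> a < ?n \<and> b < ?n" for a b .
    have "(set D')\<^sup>* \<subseteq> conn (set D')" unfolding conn_def by (rule rtrancl_mono) auto
    then show "i < ?n \<Longrightarrow> (0, i) \<in> conn (set D')" for i using reach by blast
  qed
  have sp': "spans (graph_of (?n, D')) 0 D'"
    using reach by (simp add: spans_def)
  have met': "met 0 (target [0..<?n] (\<mu> \<circ> \<beta>)) D'"
    unfolding met_target
  proof
    fix i assume "i \<in> set [0..<?n]"
    then have i: "i < ?n" by simp
    have heads: "snd e = \<beta> i \<longleftrightarrow> \<gamma> (snd e) = i" if "e \<in> set D" for e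
      using orientation_verts(2)[OF G und, of "fst e" "snd e"] that \<gamma>(2)[of "snd e"] \<beta>'(2)[OF i] by auto
    have "filter (\<lambda>e. snd e = \<beta> i) D = filter (\<lambda>e. \<gamma> (snd e) = i) D"
      by (rule filter_cong) (simp_all add: heads)
    then have "count_list (map snd D) (\<beta> i) = count_list (map snd D') i"
      by (simp add: D'_def count_list_map comp_def)
    moreover have "r = \<beta> i \<longleftrightarrow> 0 = i" using \<beta>'(2)[OF i] \<beta>'(2)[of 0] n by (auto simp: r_def)
    ultimately have "load r D (\<beta> i) = load 0 D' i" by (cases "0 = i") (auto simp: load_def)
    then show "(\<mu> \<circ> \<beta>) i < load 0 D' i"
      using met vs \<beta>'(1)[OF i] unfolding met_target by auto
  qed
  let ?st = "attach (target [0..<?n] (\<mu> \<circ> \<beta>)) (search False 0 D')"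
  let ?H = "graph_of (length (fst ?st), snd ?st)" and ?\<phi> = "(!) (fst ?st)"
  note H = attach_correct[OF G' sp' met']
  have onto: "?\<phi> ` verts ?H = {..<?n}" using H(2) by (simp add: homomorphic_image_def)
  have "homomorphic_image G ?H (\<beta> \<circ> ?\<phi>)"
  proof (rule homomorphic_imageI)
    show "(\<beta> \<circ> ?\<phi>) ` verts ?H = ?V"
      unfolding image_comp[symmetric] onto using \<beta> by (simp add: bij_betw_def)
    have "edges G = image_mset (map_uprod \<beta>) (undirected D')"
    proof -
      have "image_mset (map_uprod \<beta>) (undirected D') = image_mset (\<lambda>e. Upair (\<beta> (\<gamma> (fst e))) (\<beta> (\<gamma> (snd e)))) (mset D)"
        by (simp add: D'_def image_mset.compositionality comp_def)
      also have "\<dots> = undirected D"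
        by (rule image_mset_cong) (use orientation_verts[OF G und] \<gamma>(2) in force)
      finally show ?thesis using und by simp
    qed
    also have "undirected D' = image_mset (map_uprod ?\<phi>) (edges ?H)"
      using homomorphic_image_edges[OF G' H(1,2)] by simp
    finally show "edges G = image_mset (map_uprod (\<beta> \<circ> ?\<phi>)) (edges ?H)"
      by (simp add: image_mset.compositionality comp_def uprod.map_comp)
  qed
  moreover have "card {w \<in> verts ?H. (\<beta> \<circ> ?\<phi>) w = v} = \<mu> v + 1" if v: "v \<in> ?V" for v
  proof -
    have "(\<beta> \<circ> ?\<phi>) w = v \<longleftrightarrow> ?\<phi> w = \<gamma> v" if "w \<in> verts ?H" for w
    proof -
      have "?\<phi> w < ?n" using that onto by blast
      then show ?thesis using \<beta>'(2) \<gamma>(2)[OF v] by auto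
    qed
    then have "{w \<in> verts ?H. (\<beta> \<circ> ?\<phi>) w = v} = {w \<in> verts ?H. ?\<phi> w = \<gamma> v}" by blast
    then show ?thesis using H(3)[OF \<gamma>(1)[OF v]] \<gamma>(2)[OF v] by simp
  qed
  ultimately show "feasible_split G \<mu>"
    using H(1) unfolding feasible_split_def feasible_multiplicity_def by fastforce
qed

lemma enumerate_eq_target: "List.enumerate 0 xs = target [0..<length xs] ((!) xs)"
  by (rule nth_equalityI) (auto simp: nth_enumerate_eq)

lemma split_graph_correct:
  assumes "i \<in> splitting_inputs"
  shows "splitting_solution i (split_graph i)"
proof -
  obtain n es \<mu> where i: "i = ((n, es), \<mu>)" by (metis prod.exhaust)
  have G: "graph (graph_of (n, es))" and len: "length \<mu> = n"
    and feas: "feasible_split (graph_of (n, es)) ((!) \<mu>)"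
    using assms by (auto simp: splitting_inputs_def i)
  have r: "0 \<in> verts (graph_of (n, es))" using G by (auto simp: graph_def)
  let ?t = "target [0..<n] ((!) \<mu>)"
  let ?D = "solve 0 es ?t"
  have vs: "set [0..<n] = verts (graph_of (n, es))" by auto
  have "spans (graph_of (n, es)) 0 ?D" "met 0 ?t ?D"
    using solve_correct[OF G edges_graph_of[symmetric] vs r, of "(!) \<mu>"] feasible_split_le_bound[OF G feas]
    by blast+
  note H = attach_correct[OF G this]
  have "split_graph i = ((length (fst (attach ?t (search False 0 ?D))), snd (attach ?t (search False 0 ?D))),
      fst (attach ?t (search False 0 ?D)))"
    by (simp add: split_graph_def Let_def i enumerate_eq_target len)
  then show ?thesis
    using H by (simp add: splitting_solution_def i)
qed

section \<open>Integrality of polymatroids\<close>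

abbreviation "lookup \<equiv> Poly_Mapping.lookup"
abbreviation "keys \<equiv> Poly_Mapping.keys"
abbreviation "single \<equiv> Poly_Mapping.single"

definition polymatroid_set :: "'v set \<Rightarrow> ('v set \<Rightarrow> nat) \<Rightarrow> ('v \<Rightarrow>\<^sub>0 real) set" where
  "polymatroid_set N f = {x. keys x \<subseteq> N \<and> (\<forall>v\<in>N. 0 \<le> lookup x v) \<and>
     (\<forall>S. S \<subseteq> N \<longrightarrow> (\<Sum>v\<in>S. lookup x v) \<le> real (f S))}"

lemma lookup_scaleR: "lookup (c *\<^sub>R x) v = c * lookup x v"
  for x :: "'v \<Rightarrow>\<^sub>0 real"
proof -
  have "finite {i. c * lookup x i \<noteq> 0}"
    by (rule finite_subset[OF _ finite_keys[of x]]) (auto simp: in_keys_iff)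
  then show ?thesis by (simp add: scaleR_poly_mapping_def)
qed

lemma keys_add_scaleR: "keys (x + c *\<^sub>R y) \<subseteq> keys x \<union> keys y"
  for x y :: "'v \<Rightarrow>\<^sub>0 real"
  by (auto simp: in_keys_iff lookup_add lookup_scaleR)

lemma convex_polymatroid_set: "convex (polymatroid_set N f)"
proof (rule convexI)
  fix x y and u v :: real
  assume x: "x \<in> polymatroid_set N f" and y: "y \<in> polymatroid_set N f" and uv: "0 \<le> u" "0 \<le> v" "u + v = 1"
  have "(\<Sum>w\<in>S. u * lookup x w + v * lookup y w) \<le> real (f S)" if "S \<subseteq> N" for S
  proof -
    have "(\<Sum>w\<in>S. u * lookup x w + v * lookup y w)
        = u * (\<Sum>w\<in>S. lookup x w) + v * (\<Sum>w\<in>S. lookup y w)"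
      by (simp add: sum.distrib sum_distrib_left)
    also have "\<dots> \<le> u * real (f S) + v * real (f S)"
      using x y uv that by (intro add_mono mult_left_mono) (auto simp: polymatroid_set_def)
    also have "\<dots> = real (f S)" using uv(3) by (simp add: distrib_right[symmetric])
    finally show ?thesis .
  qed
  moreover have "keys (u *\<^sub>R x + v *\<^sub>R y) \<subseteq> N"
    using x y keys_add_scaleR[of "u *\<^sub>R x" v y] keys_add_scaleR[of 0 u x]
    by (auto simp: polymatroid_set_def)
  moreover have "0 \<le> u * lookup x w + v * lookup y w" if "w \<in> N" for w
    using x y uv that by (simp add: polymatroid_set_def)
  ultimately show "u *\<^sub>R x + v *\<^sub>R y \<in> polymatroid_set N f"
    by (simp add: polymatroid_set_def lookup_add lookup_scaleR)
qed

text \<open>The ratio test of linear programming: \<open>a\<close> is the slack of a constraint and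
  \<open>b\<close> its rate of change along a direction. The minimum ratio is positive because
  constraints without slack are stationary.\<close>

lemma first_blocking_step:
  fixes K :: "(real \<times> real) set"
  assumes "finite K" "\<And>a b. (a, b) \<in> K \<Longrightarrow> 0 \<le> a" "\<And>a b. (a, b) \<in> K \<Longrightarrow> a = 0 \<Longrightarrow> b = 0"
    and "\<exists>(a, b)\<in>K. b < 0"
  obtains s where "0 < s" "\<And>a b. (a, b) \<in> K \<Longrightarrow> 0 \<le> a + s * b" "\<exists>(a, b)\<in>K. 0 < a \<and> a + s * b = 0"
proof -
  let ?J = "{p \<in> K. snd p < 0}"
  let ?q = "\<lambda>p. fst p / - snd p"
  define s where "s = Min (?q ` ?J)"
  have fin: "finite (?q ` ?J)" "?q ` ?J \<noteq> {}" using assms(1,4) by auto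
  have "s \<in> ?q ` ?J" unfolding s_def using fin by (rule Min_in)
  then obtain a b where ab: "(a, b) \<in> K" "b < 0" "s = a / - b" by auto
  have a: "0 < a" using assms(2,3)[OF ab(1)] ab(2) by linarith
  show thesis
  proof (rule that)
    show s: "0 < s" unfolding ab(3) using a ab(2) by (simp add: divide_pos_neg)
    show "\<exists>(a, b)\<in>K. 0 < a \<and> a + s * b = 0" using ab a by (intro bexI[of _ "(a, b)"]) auto
    fix c d assume cd: "(c, d) \<in> K"
    show "0 \<le> c + s * d"
    proof (cases "d < 0")
      case True
      then have "c / - d \<in> ?q ` ?J" using cd by force
      then have "s \<le> c / - d" unfolding s_def using fin(1) by (rule Min_le[rotated])
      then have "s * - d \<le> c" using True pos_le_divide_eq[of "- d" s c] by simp
      then show ?thesis by simp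
    next
      case False
      then show ?thesis using assms(2)[OF cd] s by simp
    qed
  qed
qed

definition fractional :: "('v \<Rightarrow>\<^sub>0 real) \<Rightarrow> 'v set" where
  "fractional x = {v. lookup x v \<notin> \<int>}"

definition slack_sets :: "'v set \<Rightarrow> ('v set \<Rightarrow> nat) \<Rightarrow> ('v \<Rightarrow>\<^sub>0 real) \<Rightarrow> 'v set set" where
  "slack_sets N f x = {S. S \<subseteq> N \<and> (\<Sum>v\<in>S. lookup x v) \<noteq> real (f S)}"

text \<open>The induction measure for integrality: a step along a direction fixing tight sets and
  integral coordinates creates neither slack sets nor fractional coordinates, and it ends when one
  of them disappears.\<close>

definition slackness :: "'v set \<Rightarrow> ('v set \<Rightarrow> nat) \<Rightarrow> ('v \<Rightarrow>\<^sub>0 real) \<Rightarrow> nat" where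
  "slackness N f x = card (slack_sets N f x) + card (fractional x)"

text \<open>Besides the set constraints, each coordinate is confined between its floor and its
  ceiling. These extra walls make a moving coordinate stop at an integer, and as \<open>d\<close> is
  not 0 one of them is approached, so the ratio test applies.\<close>

lemma move_in_polymatroid:
  fixes x d :: "'v \<Rightarrow>\<^sub>0 real"
  assumes N: "finite N" and x: "x \<in> polymatroid_set N f" and d: "keys d \<subseteq> N"
    and tight: "\<And>S. S \<subseteq> N \<Longrightarrow> S \<notin> slack_sets N f x \<Longrightarrow> (\<Sum>v\<in>S. lookup d v) = 0"
    and integral: "\<And>v. v \<notin> fractional x \<Longrightarrow> lookup d v = 0"
    and nz: "d \<noteq> 0"
  shows "\<exists>s>0. x + s *\<^sub>R d \<in> polymatroid_set N f \<and> slackness N f (x + s *\<^sub>R d) < slackness N f x"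
proof -
  define K where "K = (\<lambda>S. (real (f S) - (\<Sum>v\<in>S. lookup x v), - (\<Sum>v\<in>S. lookup d v))) ` Pow N
    \<union> (\<lambda>v. (lookup x v - real_of_int \<lfloor>lookup x v\<rfloor>, lookup d v)) ` N \<union> (\<lambda>v. (real_of_int \<lceil>lookup x v\<rceil> - lookup x v, - lookup d v)) ` N"
  have int: "lookup d v = 0" if "lookup x v \<in> \<int>" for v using integral[of v] that by (simp add: fractional_def)
  have KS: "(real (f S) - (\<Sum>v\<in>S. lookup x v), - (\<Sum>v\<in>S. lookup d v)) \<in> K" if "S \<subseteq> N" for S
    using that by (auto simp: K_def)
  have Kf: "(lookup x v - real_of_int \<lfloor>lookup x v\<rfloor>, lookup d v) \<in> K" "(real_of_int \<lceil>lookup x v\<rceil> - lookup x v, - lookup d v) \<in> K"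
    if "v \<in> N" for v using that by (auto simp: K_def)
  have xS: "(\<Sum>v\<in>S. lookup x v) \<le> real (f S)" if "S \<subseteq> N" for S
    using x that by (auto simp: polymatroid_set_def)
  obtain v0 where v0: "lookup d v0 \<noteq> 0"
    using nz by (metis lookup_zero poly_mapping_eqI)
  then have v0N: "v0 \<in> N" using d by (auto simp: in_keys_iff)
  obtain s where s: "0 < s" "\<And>a b. (a, b) \<in> K \<Longrightarrow> 0 \<le> a + s * b" "\<exists>(a, b)\<in>K. 0 < a \<and> a + s * b = 0"
  proof (rule first_blocking_step[of K])
    show "finite K" using N by (simp add: K_def)
    fix a b assume ab: "(a, b) \<in> K"
    show "0 \<le> a" using ab xS by (auto simp: K_def)
    assume "a = 0"
    then show "b = 0"
      using ab tight int by (auto simp: K_def slack_sets_def) (metis Ints_of_int)+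
  next
    show "\<exists>(a, b)\<in>K. b < 0"
    proof (cases "lookup d v0 < 0")
      case True
      then show ?thesis by (intro bexI[OF _ Kf(1)[OF v0N]]) simp
    next
      case False
      then show ?thesis using v0 by (intro bexI[OF _ Kf(2)[OF v0N]]) simp
    qed
  next
    fix s :: real
    assume "0 < s" "\<And>a b. (a, b) \<in> K \<Longrightarrow> 0 \<le> a + s * b" "\<exists>(a, b)\<in>K. 0 < a \<and> a + s * b = 0"
    then show thesis by (rule that)
  qed
  define y where "y = x + s *\<^sub>R d"
  have ly: "lookup y v = lookup x v + s * lookup d v" for v by (simp add: y_def lookup_add lookup_scaleR)
  have sy: "(\<Sum>v\<in>S. lookup y v) = (\<Sum>v\<in>S. lookup x v) + s * (\<Sum>v\<in>S. lookup d v)" for S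
    by (simp add: ly sum.distrib sum_distrib_left)
  have "y \<in> polymatroid_set N f"
  proof -
    have "keys y \<subseteq> N" using x d keys_add_scaleR[of x s d] by (auto simp: polymatroid_set_def y_def)
    moreover have "0 \<le> lookup y v" if "v \<in> N" for v
    proof -
      have "0 \<le> lookup x v" using x that by (simp add: polymatroid_set_def)
      \<comment> \<open>Nonnegativity needs no constraint of its own, as the floor of a nonnegative
        coordinate is nonnegative.\<close>
      then have "0 \<le> real_of_int \<lfloor>lookup x v\<rfloor>" by simp
      then show ?thesis using s(2)[OF Kf(1)[OF that]] ly[of v] by linarith
    qed
    moreover have "(\<Sum>v\<in>S. lookup y v) \<le> real (f S)" if "S \<subseteq> N" for S
      using s(2)[OF KS[OF that]] sy[of S] by simp
    ultimately show ?thesis by (simp add: polymatroid_set_def)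
  qed
  moreover have "slackness N f y < slackness N f x"
  proof -
    have frac: "fractional y \<subseteq> fractional x"
      by (auto simp: fractional_def ly int)
    have slack: "slack_sets N f y \<subseteq> slack_sets N f x"
      using tight by (auto simp: slack_sets_def sy)
    have fin: "finite (slack_sets N f x)" using N by (simp add: slack_sets_def)
    have "fractional x \<subseteq> N"
      using x by (auto simp: fractional_def polymatroid_set_def) (metis Ints_0 in_keys_iff subsetD)
    then have fin': "finite (fractional x)" using N finite_subset by blast
    obtain a b where ab: "(a, b) \<in> K" "0 < a" "a + s * b = 0" using s(3) by auto
    have "slack_sets N f y \<noteq> slack_sets N f x \<or> fractional y \<noteq> fractional x"
    proof -
      consider S where "S \<subseteq> N" "a = real (f S) - (\<Sum>v\<in>S. lookup x v)" "b = - (\<Sum>v\<in>S. lookup d v)"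
        | v where "v \<in> N" "a = lookup x v - real_of_int \<lfloor>lookup x v\<rfloor>" "b = lookup d v"
        | v where "v \<in> N" "a = real_of_int \<lceil>lookup x v\<rceil> - lookup x v" "b = - lookup d v"
        using ab(1) by (auto simp: K_def)
      then show ?thesis
      proof cases
        case 1
        then have "S \<in> slack_sets N f x" "S \<notin> slack_sets N f y"
          using ab(2,3) by (auto simp: slack_sets_def sy)
        then show ?thesis by blast
      next
        case 2
        then have "lookup y v = real_of_int \<lfloor>lookup x v\<rfloor>" using ab(3) by (simp add: ly)
        then have "v \<notin> fractional y" by (simp add: fractional_def)
        moreover have "v \<in> fractional x" using 2 ab(2) by (auto simp: fractional_def elim!: Ints_cases)
        ultimately show ?thesis by blast
      next
        case 3
        then have "lookup y v = real_of_int \<lceil>lookup x v\<rceil>" using ab(3) by (simp add: ly)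
        then have "v \<notin> fractional y" by (simp add: fractional_def)
        moreover have "v \<in> fractional x" using 3 ab(2) by (auto simp: fractional_def elim!: Ints_cases)
        ultimately show ?thesis by blast
      qed
    qed
    moreover have "card (slack_sets N f y) \<le> card (slack_sets N f x)" "card (fractional y) \<le> card (fractional x)"
      using frac slack fin fin' by (auto intro: card_mono)
    moreover have "card (slack_sets N f y) < card (slack_sets N f x)" if "slack_sets N f y \<noteq> slack_sets N f x"
      using that slack fin by (intro psubset_card_mono) auto
    moreover have "card (fractional y) < card (fractional x)" if "fractional y \<noteq> fractional x"
      using that frac fin' by (intro psubset_card_mono) auto
    ultimately show ?thesis unfolding slackness_def by fastforce
  qed
  ultimately show ?thesis using s(1) unfolding y_def by blast
qed

text \<open>If every fractional coordinate lies in a tight set, choose a tight set with a fractional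
  coordinate of minimum size: since \<open>f\<close> is integral it has two fractional coordinates, and by
  uncrossing every tight set contains both or none of them.\<close>

lemma direction_exists:
  fixes x :: "'v \<Rightarrow>\<^sub>0 real"
  assumes N: "finite N" and sub: "submodular N f" and x: "x \<in> polymatroid_set N f" and frac: "fractional x \<noteq> {}"
  shows "\<exists>d :: 'v \<Rightarrow>\<^sub>0 real. keys d \<subseteq> N \<and> d \<noteq> 0 \<and>
    (\<forall>S. S \<subseteq> N \<longrightarrow> S \<notin> slack_sets N f x \<longrightarrow> (\<Sum>v\<in>S. lookup d v) = 0) \<and>
    (\<forall>v. v \<notin> fractional x \<longrightarrow> lookup d v = 0)"
proof -
  define tight where "tight S \<longleftrightarrow> S \<subseteq> N \<and> (\<Sum>v\<in>S. lookup x v) = real (f S)" for S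
  have xS: "(\<Sum>v\<in>S. lookup x v) \<le> real (f S)" if "S \<subseteq> N" for S
    using x that by (auto simp: polymatroid_set_def)
  have tight_Int: "tight (S \<inter> T)" if "tight S" "tight T" for S T
  proof -
    have ST: "S \<subseteq> N" "T \<subseteq> N" "finite S" "finite T"
      using that N finite_subset by (auto simp: tight_def)
    have "f (S \<union> T) + f (S \<inter> T) \<le> f S + f T" using sub ST by (simp add: submodular_def)
    then have "real (f (S \<union> T)) + real (f (S \<inter> T)) \<le> real (f S) + real (f T)"
      by (simp only: of_nat_add[symmetric] of_nat_le_iff)
    moreover have "(\<Sum>v\<in>S \<union> T. lookup x v) + (\<Sum>v\<in>S \<inter> T. lookup x v) = (\<Sum>v\<in>S. lookup x v) + (\<Sum>v\<in>T. lookup x v)"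
      using ST(3,4) by (rule sum.union_inter)
    moreover have "S \<union> T \<subseteq> N" "S \<inter> T \<subseteq> N" using ST by auto
    ultimately show ?thesis
      using xS[of "S \<union> T"] xS[of "S \<inter> T"] that unfolding tight_def by linarith
  qed
  have fracN: "fractional x \<subseteq> N"
    using x by (auto simp: fractional_def polymatroid_set_def) (metis Ints_0 in_keys_iff subsetD)
  have single: "(\<Sum>w\<in>S. lookup (single v (1::real)) w) = (if v \<in> S then 1 else 0)" if "S \<subseteq> N" for v S
    using finite_subset[OF that N] by (simp add: lookup_single when_def)
  show ?thesis
  proof (cases "\<exists>v\<in>fractional x. \<forall>S. tight S \<longrightarrow> v \<notin> S")
    case True
    then obtain v where v: "v \<in> fractional x" "\<And>S. tight S \<Longrightarrow> v \<notin> S" by blast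
    show ?thesis
    proof (intro exI[of _ "single v 1"] conjI allI impI)
      show "single v (1::real) \<noteq> 0"
        by (metis lookup_single_eq lookup_zero zero_neq_one)
      show "(\<Sum>w\<in>S. lookup (single v (1::real)) w) = 0" if "S \<subseteq> N" "S \<notin> slack_sets N f x" for S
        using single[OF that(1)] v(2)[of S] that by (auto simp: slack_sets_def tight_def)
    qed (use v(1) fracN in \<open>auto simp: lookup_single when_def\<close>)
  next
    case False
    let ?F = "{S. tight S \<and> S \<inter> fractional x \<noteq> {}}"
    obtain S\<^sub>0 where "S\<^sub>0 \<in> ?F" using False frac by blast
    then obtain D where D: "D \<in> ?F" "\<And>S. S \<in> ?F \<Longrightarrow> card D \<le> card S"
      using ex_has_least_nat[of "\<lambda>S. S \<in> ?F" S\<^sub>0 card] by blast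
    have DN: "D \<subseteq> N" "finite D" using D(1) N finite_subset by (auto simp: tight_def)
    obtain v where v: "v \<in> D" "v \<in> fractional x" using D(1) by blast
    have "\<exists>u\<in>D. u \<noteq> v \<and> u \<in> fractional x"
    proof (rule ccontr)
      assume "\<not> ?thesis"
      then have "(\<Sum>u\<in>D - {v}. lookup x u) \<in> \<int>" by (intro Ints_sum) (auto simp: fractional_def)
      moreover have "lookup x v = real (f D) - (\<Sum>u\<in>D - {v}. lookup x u)"
        using D(1) sum.remove[OF DN(2) v(1), of "lookup x"] by (simp add: tight_def)
      ultimately have "lookup x v \<in> \<int>" by simp
      then show False using v(2) by (simp add: fractional_def)
    qed
    then obtain u where u: "u \<in> D" "u \<noteq> v" "u \<in> fractional x" by blast
    have both: "u \<in> S \<longleftrightarrow> v \<in> S" if "tight S" for S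
    proof (cases "S \<inter> D \<inter> fractional x = {}")
      case True
      then show ?thesis using u v by blast
    next
      case False
      then have "S \<inter> D \<in> ?F" using tight_Int[OF that, of D] D(1) by auto
      from D(2)[OF this] have "S \<inter> D = D" using DN(2) by (intro card_seteq) auto
      then show ?thesis using u(1) v(1) by blast
    qed
    let ?d = "single u 1 - single v (1::real)"
    have ld: "lookup ?d w = lookup (single u 1) w - lookup (single v 1) w" for w
      by (simp add: lookup_minus)
    show ?thesis
    proof (intro exI[of _ ?d] conjI allI impI)
      show "keys ?d \<subseteq> N"
        using u(3) v(2) fracN by (auto simp: in_keys_iff ld lookup_single when_def split: if_splits)
      have "lookup ?d u = 1" using u(2) by (simp add: ld lookup_single)
      then show "?d \<noteq> 0" by (metis lookup_zero zero_neq_one)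
      show "(\<Sum>w\<in>S. lookup ?d w) = 0" if "S \<subseteq> N" "S \<notin> slack_sets N f x" for S
        using both[of S] that single[OF that(1), of u] single[OF that(1), of v]
        by (simp add: ld sum_subtractf slack_sets_def tight_def)
      show "lookup ?d w = 0" if "w \<notin> fractional x" for w
        using that u v by (auto simp: ld lookup_single when_def)
    qed
  qed
qed

text \<open>A fractional point lies between two points of smaller slackness, reached along
  \<open>d\<close> and \<open>- d\<close>. With step lengths \<open>s\<close> and \<open>t\<close>
  the weights are t/(s+t) and s/(s+t), for which the displacements cancel.\<close>

lemma polymatroid_set_integral:
  fixes f :: "'v set \<Rightarrow> nat"
  assumes N: "finite N" and sub: "submodular N f"
  shows "polymatroid_set N f = convex hull {x \<in> polymatroid_set N f. fractional x = {}}"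
    (is "_ = convex hull ?I")
proof
  have "x \<in> convex hull ?I" if "x \<in> polymatroid_set N f" for x
    using that
  proof (induction "slackness N f x" arbitrary: x rule: less_induct)
    case less
    show ?case
    proof (cases "fractional x = {}")
      case True
      then show ?thesis using less.prems by (intro hull_inc) simp
    next
      case False
      from direction_exists[OF N sub less.prems False]
      obtain d :: "'v \<Rightarrow>\<^sub>0 real" where d: "keys d \<subseteq> N" "d \<noteq> 0"
        "\<forall>S. S \<subseteq> N \<longrightarrow> S \<notin> slack_sets N f x \<longrightarrow> (\<Sum>v\<in>S. lookup d v) = 0"
        "\<forall>v. v \<notin> fractional x \<longrightarrow> lookup d v = 0"
        by (elim exE conjE) (rule that)
      obtain s where s: "0 < s" "x + s *\<^sub>R d \<in> polymatroid_set N f" "slackness N f (x + s *\<^sub>R d) < slackness N f x"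
        using move_in_polymatroid[OF N less.prems d(1) d(3)[rule_format] d(4)[rule_format] d(2)] by blast
      have "\<exists>t>0. x + t *\<^sub>R (- d) \<in> polymatroid_set N f \<and> slackness N f (x + t *\<^sub>R (- d)) < slackness N f x"
      proof (rule move_in_polymatroid[OF N less.prems])
        show "keys (- d) \<subseteq> N" using d(1) by (auto simp: in_keys_iff)
      qed (use d in \<open>auto simp: sum_negf\<close>)
      then obtain t where t: "0 < t" "x + t *\<^sub>R (- d) \<in> polymatroid_set N f"
          "slackness N f (x + t *\<^sub>R (- d)) < slackness N f x"
        by blast
      let ?y = "x + s *\<^sub>R d" and ?z = "x + t *\<^sub>R (- d)"
      have "?y \<in> convex hull ?I" "?z \<in> convex hull ?I"
        using less.hyps s t by blast+
      then have "(t / (s + t)) *\<^sub>R ?y + (s / (s + t)) *\<^sub>R ?z \<in> convex hull ?I"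
        using s(1) t(1) by (intro convexD[OF convex_convex_hull]) (auto simp: add_divide_distrib[symmetric])
      moreover have "(t / (s + t)) *\<^sub>R ?y + (s / (s + t)) *\<^sub>R ?z = x"
      proof -
        have "(t / (s + t)) *\<^sub>R ?y + (s / (s + t)) *\<^sub>R ?z
            = (t / (s + t) + s / (s + t)) *\<^sub>R x + (t / (s + t) * s - s / (s + t) * t) *\<^sub>R d"
          by (simp add: algebra_simps)
        also have "t / (s + t) + s / (s + t) = 1" using s(1) t(1) by (simp add: add_divide_distrib[symmetric])
        finally show ?thesis by simp
      qed
      ultimately show ?thesis by simp
    qed
  qed
  then show "polymatroid_set N f \<subseteq> convex hull ?I" by blast
  show "convex hull ?I \<subseteq> polymatroid_set N f"
    by (rule hull_minimal) (auto simp: convex_polymatroid_set)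
qed

section \<open>The split polytope as an integral polymatroid\<close>

lemma split_vectors_eq:
  fixes G :: "'v mgraph"
  assumes G: "graph G"
  shows "split_vectors G = {x \<in> polymatroid_set (verts G) (split_bound G). fractional x = {}}"
proof (intro equalityI subsetI)
  fix x assume "x \<in> split_vectors G"
  then obtain \<mu> where x: "keys x \<subseteq> verts G" "feasible_split G \<mu>"
    "\<And>v. v \<in> verts G \<Longrightarrow> lookup x v = real (\<mu> v)" by (auto simp: split_vectors_def)
  have "(\<Sum>v\<in>S. lookup x v) \<le> real (split_bound G S)" if S: "S \<subseteq> verts G" for S
  proof -
    have "(\<Sum>v\<in>S. lookup x v) = real (sum \<mu> S)"
      unfolding of_nat_sum by (rule sum.cong) (use x(3) S in auto)
    then show ?thesis using feasible_split_le_bound[OF G x(2) S] by (simp only: of_nat_le_iff)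
  qed
  moreover have "lookup x v \<in> \<int>" for v
  proof (cases "v \<in> verts G")
    case False
    then have "v \<notin> keys x" using x(1) by blast
    then show ?thesis by (simp add: in_keys_iff)
  qed (simp add: x(3))
  ultimately show "x \<in> {x \<in> polymatroid_set (verts G) (split_bound G). fractional x = {}}"
    using x by (auto simp: polymatroid_set_def fractional_def)
next
  fix x assume "x \<in> {x \<in> polymatroid_set (verts G) (split_bound G). fractional x = {}}"
  then have x: "keys x \<subseteq> verts G" "\<And>v. v \<in> verts G \<Longrightarrow> 0 \<le> lookup x v"
    "\<And>S. S \<subseteq> verts G \<Longrightarrow> (\<Sum>v\<in>S. lookup x v) \<le> real (split_bound G S)"
    "\<And>v. lookup x v \<in> \<int>" by (auto simp: polymatroid_set_def fractional_def)
  define \<mu> where "\<mu> v = nat \<lfloor>lookup x v\<rfloor>" for v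
  have \<mu>: "lookup x v = real (\<mu> v)" if "v \<in> verts G" for v
    using x(2)[OF that] x(4)[of v] by (auto simp: \<mu>_def elim!: Ints_cases)
  have "sum \<mu> S \<le> split_bound G S" if S: "S \<subseteq> verts G" for S
  proof -
    have "real (sum \<mu> S) = (\<Sum>v\<in>S. lookup x v)"
      unfolding of_nat_sum by (rule sum.cong) (use \<mu> S in auto)
    with x(3)[OF S] have "real (sum \<mu> S) \<le> real (split_bound G S)" by linarith
    then show ?thesis by (simp only: of_nat_le_iff)
  qed
  then have "feasible_split G \<mu>" using feasible_split_iff[OF G] by blast
  then show "x \<in> split_vectors G" using x(1) \<mu> by (auto simp: split_vectors_def)
qed

lemma split_polytope_eq:
  assumes G: "graph G"
  shows "split_polytope G = polymatroid_set (verts G) (split_bound G)"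
proof -
  have "finite (verts G)" using G by (simp add: graph_def)
  from polymatroid_set_integral[OF this submodular_split_bound[OF G]]
  show ?thesis unfolding split_polytope_def split_vectors_eq[OF G] by simp
qed

text \<open>Each entry is at most f(V). Finiteness is what makes the convex hull a polytope.\<close>

lemma finite_split_vectors:
  fixes G :: "'v mgraph"
  assumes G: "graph G"
  shows "finite (split_vectors G)"
proof -
  let ?V = "verts G"
  let ?r = "\<lambda>x :: 'v \<Rightarrow>\<^sub>0 real. restrict (lookup x) ?V"
  have fin: "finite ?V" using G by (simp add: graph_def)
  have "?r ` split_vectors G \<subseteq> ?V \<rightarrow>\<^sub>E real ` {..split_bound G ?V}"
  proof clarify
    fix x assume "x \<in> split_vectors G"
    then obtain \<mu> where x: "feasible_split G \<mu>"
      "\<And>v. v \<in> ?V \<Longrightarrow> lookup x v = real (\<mu> v)" by (auto simp: split_vectors_def)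
    have "\<mu> v \<le> split_bound G ?V" if "v \<in> ?V" for v
      using feasible_split_le_bound[OF G x(1) order_refl] member_le_sum[OF that, of \<mu>] fin by simp
    then show "?r x \<in> ?V \<rightarrow>\<^sub>E real ` {..split_bound G ?V}" using x(2) by auto
  qed
  then have "finite (?r ` split_vectors G)"
    by (rule finite_subset) (intro finite_PiE fin finite_imageI finite_atMost)
  moreover have "inj_on ?r (split_vectors G)"
  proof (rule inj_onI)
    fix x y assume xy: "x \<in> split_vectors G" "y \<in> split_vectors G" "?r x = ?r y"
    show "x = y"
    proof (rule poly_mapping_eqI)
      fix v
      show "lookup x v = lookup y v"
      proof (cases "v \<in> ?V")
        case True
        then show ?thesis using fun_cong[OF xy(3), of v] by simp
      next
        case False
        then have "v \<notin> keys x" "v \<notin> keys y"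
          using xy(1,2) by (auto simp: split_vectors_def)
        then show ?thesis by (simp add: in_keys_iff)
      qed
    qed
  qed
  ultimately show ?thesis by (rule finite_imageD)
qed

lemma polymatroid_split_polytope:
  assumes G: "graph G"
  shows "polymatroid (verts G) (split_polytope G)"
  unfolding polymatroid_def
proof (intro conjI exI)
  show "finite (verts G)" using G by (simp add: graph_def)
  show "polytope (split_polytope G)"
    unfolding polytope_def split_polytope_def using finite_split_vectors[OF G] by blast
  show "submodular (verts G) (split_bound G)" by (rule submodular_split_bound[OF G])
  show "split_polytope G = {x. keys x \<subseteq> verts G \<and> (\<forall>v\<in>verts G. 0 \<le> lookup x v) \<and>
      (\<forall>S. S \<subseteq> verts G \<longrightarrow> (\<Sum>v\<in>S. lookup x v) \<le> real (split_bound G S))}"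
    unfolding split_polytope_eq[OF G] polymatroid_set_def ..
qed

lemma integral_points_split_polytope:
  assumes G: "graph G"
  shows "integral_points (split_polytope G) = split_vectors G"
  unfolding integral_points_def split_vectors_eq[OF G] split_polytope_eq[OF G] fractional_def by blast

section \<open>The greedy algorithm\<close>

definition within_bound :: "'v mgraph \<Rightarrow> ('v \<Rightarrow> nat) \<Rightarrow> bool" where
  "within_bound G x \<longleftrightarrow> (\<forall>S\<subseteq>verts G. sum x S \<le> split_bound G S)"

text \<open>The test is sound for arbitrary targets: \<open>solve\<close> returns a rooted
  orientation even when it fails, and such loads obey all bounds. Completeness is the correctness of
  the augmentation.\<close>

lemma met_solve_iff:
  assumes G: "graph G" and L: "undirected L = edges G" and vs: "set vs = verts G" and r: "r \<in> verts G"
  shows "met r (target vs x) (solve r L (target vs x)) \<longleftrightarrow> within_bound G x"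
proof
  assume met: "met r (target vs x) (solve r L (target vs x))"
  let ?D = "solve r L (target vs x)"
  have D: "spans G r ?D" by (rule solve_correct(1)[OF G L vs r])
  have "sum x S \<le> split_bound G S" if S: "S \<subseteq> verts G" for S
  proof -
    have "(\<Sum>v\<in>S. x v + 1) \<le> (\<Sum>v\<in>S. load r ?D v)"
      by (rule sum_mono) (use met vs S in \<open>auto simp: met_target Suc_le_eq\<close>)
    then have "sum x S + card S \<le> (\<Sum>v\<in>S. load r ?D v)" unfolding sum.distrib by simp
    then show ?thesis using load_le_split_bound[OF G D S] by linarith
  qed
  then show "within_bound G x" by (simp add: within_bound_def)
qed (use solve_correct(2)[OF G L vs r] in \<open>auto simp: within_bound_def\<close>)

lemma bump_target: "bump u (target vs x) = target vs (x(u := Suc (x u)))"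
  by (simp add: bump_def)

lemma tight_Un:
  assumes G: "graph G" and z: "within_bound G z" and S: "S \<subseteq> verts G" "sum z S = split_bound G S"
    and T: "T \<subseteq> verts G" "sum z T = split_bound G T"
  shows "sum z (S \<union> T) = split_bound G (S \<union> T)"
proof -
  have fin: "finite S" "finite T"
    using G S(1) T(1) finite_subset[of _ "verts G"] by (auto simp: graph_def)
  have "split_bound G (S \<union> T) + split_bound G (S \<inter> T) \<le> split_bound G S + split_bound G T"
    using submodular_split_bound[OF G] S(1) T(1) by (simp add: submodular_def)
  moreover have "sum z (S \<union> T) + sum z (S \<inter> T) = sum z S + sum z T"
    using fin by (rule sum.union_inter)
  moreover have "S \<union> T \<subseteq> verts G" "S \<inter> T \<subseteq> verts G" using S(1) T(1) by auto
  then have "sum z (S \<union> T) \<le> split_bound G (S \<union> T)" "sum z (S \<inter> T) \<le> split_bound G (S \<inter> T)"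
    using z unfolding within_bound_def by blast+
  ultimately show ?thesis using S(2) T(2) by linarith
qed

text \<open>Adding a unit at \<open>u\<close> changes only the sums over sets containing
  \<open>u\<close>, each by one, so by integrality a violated set had no slack.\<close>

lemma blocked_tight:
  assumes G: "graph G" and z: "within_bound G z" and nz: "\<not> within_bound G (z(u := Suc (z u)))"
  shows "\<exists>S\<subseteq>verts G. u \<in> S \<and> sum z S = split_bound G S"
proof -
  obtain S where S: "S \<subseteq> verts G" "split_bound G S < sum (z(u := Suc (z u))) S"
    using nz by (auto simp: within_bound_def not_le)
  have fin: "finite S" using G S(1) finite_subset[of S "verts G"] by (auto simp: graph_def)
  have z_S: "sum z S \<le> split_bound G S" using z S(1) by (simp add: within_bound_def)
  have "u \<in> S"
  proof (rule ccontr)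
    assume "u \<notin> S"
    then have "sum (z(u := Suc (z u))) S = sum z S" by (intro sum.cong) auto
    then show False using S(2) z_S by simp
  qed
  moreover have "sum (z(u := Suc (z u))) S = Suc (sum z S)"
    using fin \<open>u \<in> S\<close> by (simp add: sum.remove[of S u])
  ultimately show ?thesis using S z_S by (intro exI[of _ S]) auto
qed

text \<open>As long as no bump fails, the value at \<open>u\<close> is at least the number of
  rounds. After |E| rounds a further unit would exceed f(V), which is at most |E|, so a maximal
  value has been reached.\<close>

lemma saturate_target:
  assumes G: "graph G" and L: "undirected L = edges G" and vs: "set vs = verts G" and r: "r \<in> verts G"
    and u: "u \<in> verts G" and z: "within_bound G z"
  obtains k where "saturate r L (target vs z) u = target vs (z(u := k))" "z u \<le> k"
    "within_bound G (z(u := k))" "\<not> within_bound G (z(u := Suc k))"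
proof -
  let ?st = "\<lambda>xs. foldl (\<lambda>t _. try_bump r L u t) (target vs z) xs"
  have inv: "\<exists>k. ?st xs = target vs (z(u := k)) \<and> z u \<le> k \<and> within_bound G (z(u := k)) \<and>
      (\<not> within_bound G (z(u := Suc k)) \<or> length xs \<le> k)" for xs :: "('a \<times> 'a) list"
  proof (induction xs rule: rev_induct)
    case Nil
    show ?case using z by (intro exI[of _ "z u"]) simp
  next
    case (snoc e xs)
    then obtain k where k: "?st xs = target vs (z(u := k))" "z u \<le> k" "within_bound G (z(u := k))"
      "\<not> within_bound G (z(u := Suc k)) \<or> length xs \<le> k" by blast
    have b: "bump u (target vs (z(u := k))) = target vs (z(u := Suc k))"
      by (subst bump_target) simp
    have st: "?st (xs @ [e]) = (if within_bound G (z(u := Suc k)) then target vs (z(u := Suc k)) else target vs (z(u := k)))"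
    proof -
      have "?st (xs @ [e]) = try_bump r L u (target vs (z(u := k)))"
        by (simp only: foldl_append foldl_Cons foldl_Nil k(1))
      then show ?thesis
        by (simp only: try_bump_def b met_solve_iff[OF G L vs r])
    qed
    show ?case
    proof (cases "within_bound G (z(u := Suc k))")
      case True
      then have "?st (xs @ [e]) = target vs (z(u := Suc k))" using st by (simp only: if_True)
      moreover have "length (xs @ [e]) \<le> Suc k" using k(4) True by simp
      ultimately show ?thesis using k(2) True by (intro exI[of _ "Suc k"] conjI disjI2) (assumption | simp)+
    next
      case False
      then have "?st (xs @ [e]) = target vs (z(u := k))" using st by (simp only: if_False)
      then show ?thesis using k(2,3) False by blast
    qed
  qed
  obtain k where k: "?st L = target vs (z(u := k))" "z u \<le> k" "within_bound G (z(u := k))"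
    "\<not> within_bound G (z(u := Suc k)) \<or> length L \<le> k" using inv[of L] by blast
  have "\<not> within_bound G (z(u := Suc k))"
  proof
    assume w: "within_bound G (z(u := Suc k))"
    have "Suc k = (z(u := Suc k)) u" by simp
    also have "\<dots> \<le> sum (z(u := Suc k)) (verts G)"
      using G u by (intro member_le_sum) (auto simp: graph_def)
    also have "\<dots> \<le> split_bound G (verts G)" using w by (simp add: within_bound_def)
    also have "\<dots> \<le> size (edges G)" using split_bound_verts[OF G] G by (simp add: graph_def)
    also have "\<dots> = length L" unfolding L[symmetric] by simp
    finally show False using k(4) w by simp
  qed
  with k(1-3) show thesis unfolding saturate_def[symmetric] by (intro that)
qed

text \<open>This is the optimality certificate: the greedy sum over each prefix equals f(S) for some
  S containing the prefix. Any other point has sum at most f(S) over S, and by nonnegativity over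
  the prefix as well.\<close>

lemma greedy_prefix:
  assumes G: "graph G" and L: "undirected L = edges G" and vs: "set vs = verts G" and r: "r \<in> verts G"
    and us: "set us \<subseteq> verts G" "distinct us"
  shows "\<exists>z. foldl (saturate r L) (target vs (\<lambda>_. 0)) us = target vs z \<and> within_bound G z \<and>
    (\<forall>v. v \<notin> set us \<longrightarrow> z v = 0) \<and>
    (\<forall>k. \<exists>S\<subseteq>verts G. set (take k us) \<subseteq> S \<and> (\<Sum>v\<in>set (take k us). z v) = split_bound G S)"
  using us
proof (induction us rule: rev_induct)
  case Nil
  have "split_bound G {} = 0"
    using split_bound_eq[OF G, of "{}"] ncls_adj_rel[OF G] by (simp add: touching_def)
  then show ?case by (intro exI[of _ "\<lambda>_. 0"]) (auto simp: within_bound_def)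
next
  case (snoc u us)
  then obtain z where z: "foldl (saturate r L) (target vs (\<lambda>_. 0)) us = target vs z" "within_bound G z"
    "\<forall>v. v \<notin> set us \<longrightarrow> z v = 0"
    "\<forall>k. \<exists>S\<subseteq>verts G. set (take k us) \<subseteq> S \<and> (\<Sum>v\<in>set (take k us). z v) = split_bound G S"
    by auto
  have u: "u \<in> verts G" "u \<notin> set us" using snoc.prems by auto
  obtain k where k: "saturate r L (target vs z) u = target vs (z(u := k))" "z u \<le> k"
    "within_bound G (z(u := k))" "\<not> within_bound G (z(u := Suc k))"
    using saturate_target[OF G L vs r u(1) z(2)] by blast
  let ?z = "z(u := k)"
  have old: "(\<Sum>v\<in>set (take j us). ?z v) = (\<Sum>v\<in>set (take j us). z v)" for j
    using u(2) set_take_subset[of j us] by (intro sum.cong) auto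
  have full: "\<exists>S\<subseteq>verts G. set (us @ [u]) \<subseteq> S \<and> (\<Sum>v\<in>set (us @ [u]). ?z v) = split_bound G S"
  proof -
    obtain S where S: "S \<subseteq> verts G" "set us \<subseteq> S" "(\<Sum>v\<in>set us. ?z v) = split_bound G S"
      using z(4)[rule_format, of "length us"] old[of "length us"] by auto
    have fin: "finite S" using G S(1) finite_subset[of S "verts G"] by (auto simp: graph_def)
    have "(\<Sum>v\<in>set us. ?z v) \<le> sum ?z S" using S(2) fin by (intro sum_mono2) auto
    moreover have "sum ?z S \<le> split_bound G S" using k(3) S(1) by (simp add: within_bound_def)
    ultimately have tS: "sum ?z S = split_bound G S" using S(3) by linarith
    obtain T where T: "T \<subseteq> verts G" "u \<in> T" "sum ?z T = split_bound G T"
      using blocked_tight[OF G k(3), of u] k(4) by auto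
    have "sum ?z (S \<union> T) = split_bound G (S \<union> T)"
      by (rule tight_Un[OF G k(3) S(1) tS T(1,3)])
    \<comment> \<open>The vertices of \<open>S \<union> T\<close> outside the prefix have not been
      raised, so they contribute 0.\<close>
    moreover have "sum ?z (S \<union> T) = (\<Sum>v\<in>set (us @ [u]). ?z v)"
      using S T fin G finite_subset[OF T(1)] z(3)
      by (intro sum.mono_neutral_right) (auto simp: graph_def)
    ultimately show ?thesis using S T by (intro exI[of _ "S \<union> T"]) auto
  qed
  have "\<exists>S\<subseteq>verts G. set (take j (us @ [u])) \<subseteq> S \<and> (\<Sum>v\<in>set (take j (us @ [u])). ?z v) = split_bound G S" for j
  proof (cases "j \<le> length us")
    case True
    then show ?thesis using z(4)[rule_format, of j] old[of j] by simp
  next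
    case False
    then have "take j (us @ [u]) = us @ [u]" by simp
    then show ?thesis using full by (simp only:)
  qed
  moreover have "foldl (saturate r L) (target vs (\<lambda>_. 0)) (us @ [u]) = target vs ?z"
    using z(1) k(1) by simp
  moreover have "\<forall>v. v \<notin> set (us @ [u]) \<longrightarrow> ?z v = 0" using z(3) by simp
  ultimately show ?case using k(3) by blast
qed

text \<open>Abel summation for descending coefficients and nonnegative prefix sums. The lower bound
  \<open>m\<close> strengthens the induction: when the last entry \<open>u\<close> is removed,
  \<open>c u\<close> takes over its role for the shorter list.\<close>

lemma sum_desc_nonneg:
  fixes a c :: "'v \<Rightarrow> real"
  assumes "sorted_wrt (\<lambda>u v. c v \<le> c u) us" "\<And>v. v \<in> set us \<Longrightarrow> m \<le> c v" "0 \<le> m"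
    and "\<And>k. 0 \<le> sum_list (map a (take k us))"
  shows "m * sum_list (map a us) \<le> sum_list (map (\<lambda>v. c v * a v) us)"
  using assms
proof (induction us arbitrary: m rule: rev_induct)
  case (snoc u us)
  have pre: "0 \<le> sum_list (map a (take k us))" for k
  proof -
    have "take (min k (length us)) (us @ [u]) = take k us" by (cases "k \<le> length us") auto
    then show ?thesis using snoc.prems(4)[of "min k (length us)"] by (simp only:)
  qed
  have "c u * sum_list (map a us) \<le> sum_list (map (\<lambda>v. c v * a v) us)"
    using snoc.prems pre by (intro snoc.IH) (auto simp: sorted_wrt_append order_trans)
  moreover have "0 \<le> sum_list (map a (us @ [u]))" using snoc.prems(4)[of "Suc (length us)"] by simp
  then have "m * sum_list (map a (us @ [u])) \<le> c u * sum_list (map a (us @ [u]))"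
    using snoc.prems(2)[of u] by (intro mult_right_mono) auto
  ultimately show ?case by (simp add: algebra_simps)
qed simp

lemma rat_less_iff: "0 < r \<Longrightarrow> 0 < s \<Longrightarrow> rat_less r s \<longleftrightarrow> r < s"
  by (simp add: rat_less_def rat_less_code)

text \<open>\<open>rat_less\<close> ignores signs, so it agrees with the order only on positive
  keys; \<open>greedy\<close> filters these out beforehand.\<close>

lemma sort_desc_correct:
  assumes "\<And>p. p \<in> set l \<Longrightarrow> 0 < snd p"
  shows "mset (sort_desc l) = mset l \<and> sorted_wrt (\<lambda>p q. snd q \<le> snd p) (sort_desc l)"
  using assms
proof (induction l rule: rev_induct)
  case (snoc e l)
  let ?s = "sort_desc l"
  have IH: "mset ?s = mset l" "sorted_wrt (\<lambda>p q. snd q \<le> snd p) ?s"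
    using snoc by auto
  have pos: "0 < snd e" "\<And>f. f \<in> set ?s \<Longrightarrow> 0 < snd f"
    using snoc.prems mset_eq_setD[OF IH(1)] by auto
  have s: "sort_desc (l @ [e]) = filter (\<lambda>f. \<not> snd f < snd e) ?s @ e # filter (\<lambda>f. snd f < snd e) ?s"
    using pos rat_less_iff by (simp add: sort_desc_def insert_desc_def cong: filter_cong)
  have "mset (sort_desc (l @ [e])) = mset (l @ [e])"
    unfolding s using IH(1) by (simp add: multiset_partition[symmetric] mset_filter)
  moreover have "sorted_wrt (\<lambda>p q. snd q \<le> snd p) (sort_desc (l @ [e]))"
    unfolding s sorted_wrt_append using IH(2) by (auto simp: sorted_wrt_filter)
  ultimately show ?case by blast
qed (simp add: sort_desc_def)

lemma optimize_correct:
  assumes "i \<in> optimization_inputs"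
  shows "optimization_solution i (optimize i)"
proof -
  obtain n es c where i: "i = ((n, es), c)" by (metis prod.exhaust)
  let ?G = "graph_of (n, es)"
  have G: "graph ?G" and len: "length c = n"
    using assms by (auto simp: optimization_inputs_def i)
  have r: "0 \<in> verts ?G" using G by (auto simp: graph_def)
  have vs: "set [0..<n] = verts ?G" by auto
  let ?l = "filter (\<lambda>p. 0 < snd p) (target [0..<n] ((!) c))"
  let ?us = "map fst (sort_desc ?l)"
  have srt: "mset (sort_desc ?l) = mset ?l" "sorted_wrt (\<lambda>p q. snd q \<le> snd p) (sort_desc ?l)"
    using sort_desc_correct[of ?l] by auto
  have set_s: "set (sort_desc ?l) = set ?l" using srt(1) by (rule mset_eq_setD)
  have us_set: "set ?us = {v. v < n \<and> 0 < c ! v}" by (force simp: set_s)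
  have "mset ?us = mset (map fst ?l)" using srt(1) by simp
  moreover have "distinct (map fst ?l)" by (auto simp: distinct_map inj_on_def)
  ultimately have us_distinct: "distinct ?us" by (metis mset_eq_imp_distinct_iff)
  have us_sorted: "sorted_wrt (\<lambda>u v. real_of_rat (c ! v) \<le> real_of_rat (c ! u)) ?us"
    unfolding sorted_wrt_map
    by (rule sorted_wrt_mono_rel[OF _ srt(2)]) (auto simp: set_s of_rat_less_eq)
  have "\<exists>z. foldl (saturate 0 es) (target [0..<n] (\<lambda>_. 0)) ?us = target [0..<n] z \<and> within_bound ?G z \<and>
    (\<forall>v. v \<notin> set ?us \<longrightarrow> z v = 0) \<and>
    (\<forall>k. \<exists>S\<subseteq>verts ?G. set (take k ?us) \<subseteq> S \<and> (\<Sum>v\<in>set (take k ?us). z v) = split_bound ?G S)"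
    by (rule greedy_prefix[OF G edges_graph_of[symmetric] vs r _ us_distinct]) (use us_set in auto)
  then obtain z where z: "foldl (saturate 0 es) (target [0..<n] (\<lambda>_. 0)) ?us = target [0..<n] z"
    "within_bound ?G z" "\<And>v. v \<notin> set ?us \<Longrightarrow> z v = 0"
    "\<And>k. \<exists>S\<subseteq>verts ?G. set (take k ?us) \<subseteq> S \<and> (\<Sum>v\<in>set (take k ?us). z v) = split_bound ?G S"
    by blast
  have opt: "optimize i = map (\<lambda>v. of_nat (z v)) [0..<n]"
    by (simp add: optimize_def greedy_def i enumerate_eq_target len comp_def z(1))
  define x where "x = Abs_poly_mapping (\<lambda>v. if v < n then real (z v) else 0)"
  have lx: "lookup x v = (if v < n then real (z v) else 0)" for v
    unfolding x_def by (subst lookup_Abs_poly_mapping) (auto intro: finite_subset[of _ "{..<n}"] split: if_splits)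
  have "x \<in> split_polytope ?G"
  proof -
    have "(\<Sum>v\<in>S. lookup x v) \<le> real (split_bound ?G S)" if "S \<subseteq> {..<n}" for S
    proof -
      have "(\<Sum>v\<in>S. lookup x v) = real (sum z S)"
        unfolding of_nat_sum by (rule sum.cong) (use that in \<open>auto simp: lx\<close>)
      also have "\<dots> \<le> real (split_bound ?G S)"
        using z(2) that by (simp only: of_nat_le_iff within_bound_def verts_graph_of)
      finally show ?thesis .
    qed
    then show ?thesis
      unfolding split_polytope_eq[OF G] polymatroid_set_def by (auto simp: in_keys_iff lx split: if_splits)
  qed
  moreover have "(\<Sum>v<n. real_of_rat (c ! v) * lookup y v)
      \<le> (\<Sum>v<n. real_of_rat (c ! v) * lookup x v)" if "y \<in> split_polytope ?G" for y
  proof -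
    have y: "\<And>v. v < n \<Longrightarrow> 0 \<le> lookup y v"
      "\<And>S. S \<subseteq> {..<n} \<Longrightarrow> (\<Sum>v\<in>S. lookup y v) \<le> real (split_bound ?G S)"
      using that unfolding split_polytope_eq[OF G] polymatroid_set_def by auto
    let ?c = "\<lambda>v. real_of_rat (c ! v)"
    let ?a = "\<lambda>v. lookup x v - lookup y v"
    \<comment> \<open>The certificate set S gives y(prefix) at most y(S), at most f(S), which is the
      greedy sum over the prefix.\<close>
    have prefix: "0 \<le> sum_list (map ?a (take k ?us))" for k
    proof -
      let ?P = "set (take k ?us)"
      have P: "?P \<subseteq> {..<n}" using set_take_subset[of k ?us] us_set by auto
      obtain S where S: "S \<subseteq> {..<n}" "?P \<subseteq> S" "(\<Sum>v\<in>?P. z v) = split_bound ?G S"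
        using z(4)[of k] by auto
      have "(\<Sum>v\<in>?P. lookup y v) \<le> (\<Sum>v\<in>S. lookup y v)"
        using S y(1) finite_subset[OF S(1)] by (intro sum_mono2) auto
      also have "\<dots> \<le> real (split_bound ?G S)" using S(1) by (rule y(2))
      also have "\<dots> = (\<Sum>v\<in>?P. lookup x v)"
        unfolding S(3)[symmetric] of_nat_sum by (rule sum.cong) (use P in \<open>auto simp: lx\<close>)
      finally have "0 \<le> sum ?a ?P" by (simp add: sum_subtractf)
      then show ?thesis
        using us_distinct by (subst sum_list_distinct_conv_sum_set) auto
    qed
    have "0 * sum_list (map ?a ?us) \<le> sum_list (map (\<lambda>v. ?c v * ?a v) ?us)"
      by (rule sum_desc_nonneg[OF us_sorted _ _ prefix]) (use us_set in auto)
    then have "0 \<le> (\<Sum>v\<in>set ?us. ?c v * ?a v)"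
      using us_distinct by (simp only: sum_list_distinct_conv_sum_set mult_zero_left)
    \<comment> \<open>The vertices left out have coefficient at most 0 and greedy value 0, so the
      remaining products are nonnegative.\<close>
    also have "\<dots> \<le> (\<Sum>v<n. ?c v * ?a v)"
    proof (rule sum_mono2)
      show "set ?us \<subseteq> {..<n}" using us_set by auto
      fix v assume v: "v \<in> {..<n} - set ?us"
      then have "?c v \<le> 0" using us_set by auto
      moreover have "?a v \<le> 0" using v z(3)[of v] y(1)[of v] by (simp add: lx)
      ultimately show "0 \<le> ?c v * ?a v" by (rule mult_nonpos_nonpos)
    qed simp
    finally show ?thesis by (simp add: right_diff_distrib sum_subtractf)
  qed
  ultimately show ?thesis
    unfolding optimization_solution_def Let_def i split fst_conv
    using opt by (auto simp: i lx intro!: bexI[of _ x])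
qed

theorem theorem5:
  shows "(\<forall>G :: 'v mgraph. graph G \<longrightarrow>
            polymatroid (verts G) (split_polytope G) \<and>
            integral_points (split_polytope G) = split_vectors G) \<and>
         polytime_solvable (enc_pair enc_graph (enc_list enc_rat)) (enc_list enc_rat)
            optimization_inputs optimization_solution \<and>
         polytime_solvable (enc_pair enc_graph (enc_list enc_nat))
            (enc_pair enc_graph (enc_list enc_nat))
            splitting_inputs splitting_solution"
proof (intro conjI allI impI)
  fix G :: "'v mgraph" assume G: "graph G"
  show "polymatroid (verts G) (split_polytope G)" by (rule polymatroid_split_polytope[OF G])
  show "integral_points (split_polytope G) = split_vectors G" by (rule integral_points_split_polytope[OF G])
next
  show "polytime_solvable (enc_pair enc_graph (enc_list enc_rat)) (enc_list enc_rat)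
      optimization_inputs optimization_solution"
    using polytime_optimize optimize_correct by (rule polytime_solvableI)
  show "polytime_solvable (enc_pair enc_graph (enc_list enc_nat)) (enc_pair enc_graph (enc_list enc_nat))
      splitting_inputs splitting_solution"
    using polytime_split_graph split_graph_correct by (rule polytime_solvableI)
qed

end
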